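(* Let $\epsilon\in(0,1)$ and $M\ge1$. Let $V_0\in V_d(\mathbb{R}^n)$ be a $d$-varifold with compact support such that $\|V_0\|(\mathbb{R}^n)\le M$, and let $(V_\epsilon(t))_{t\in[0,1]}$ be the approximate mean curvature flow starting from $V_0$. For any $\phi\in C^1([0,1]\times\mathbb{R}^n,\mathbb{R}_+)$ and $0\le a\le b\le1$, $$\|V_\epsilon(b)\|(\phi(b,\cdot))-\|V_\epsilon(a)\|(\phi(a,\cdot))=\int_a^b\delta(V_\epsilon(t),\phi(t,\cdot))\big(h_\epsilon(\cdot,V_\epsilon(t))\big)\,dt+\int_a^b\|V_\epsilon(t)\|(\partial_t\phi(t,\cdot))\,dt.$$
   Context: Let $n\ge 2$, $1\le d\le n$. $G_{d,n}$ is the Grassmannian of $d$-dimensional linear subspaces of $\mathbb{R}^n$; $S\in G_{d,n}$ is identified with the orthogonal projection matrix onto $S$. A $d$-varifold is a nonnegative Radon measure on $\mathbb{R}^n\times G_{d,n}$; $V_d(\mathbb{R}^n)$ is the set of $d$-varifolds; $\|V\|(A)=V(A\times G_{d,n})$ and $\|V\|(\varphi)=\int\varphi\,d\|V\|$. Weighted first variation: $\delta(V,\varphi)(X)=\int\varphi(x)\,\mathrm{div}_SX(x)\,dV(x,S)+\int\nabla\varphi(x)\cdot X(x)\,dV(x,S)$ with $\mathrm{div}_SX=\mathrm{tr}(S\,DX)$ ($\nabla$ and $D$ denote space derivatives). Push-forward: for a $C^1$ diffeomorphism $f$ of $\mathbb{R}^n$, $f_\#V(\varphi)=\int\varphi(f(x),Df(x)(S))\,J_Sf(x)\,dV(x,S)$,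 where $J_Sf(x)=\det(Y^tY)^{1/2}$, $Y=Df(x)(s_1|\dots|s_d)$ with $(s_i)$ an orthonormal basis of $S$. Kernel: $\psi\in C^\infty(\mathbb{R}^n)$ is a fixed radially symmetric function (depending only on $n$) with $0\le\psi\le1$, $\psi=1$ on $\{|x|\le 1/2\}$, $\psi=0$ on $\{|x|\ge1\}$, $|\nabla\psi|\le3$; $\Phi_\epsilon(x)=c(\epsilon)\psi(x)(2\pi\epsilon^2)^{-n/2}\exp(-|x|^2/(2\epsilon^2))$ with $c(\epsilon)$ such that $\int\Phi_\epsilon=1$. Approximate mean curvature: $h_\epsilon(\cdot,V)=\Phi_\epsilon*\tilde h_\epsilon(\cdot,V)$, $\tilde h_\epsilon(y,V)=-\dfrac{(\delta V*\Phi_\epsilon)(y)}{(\|V\|*\Phi_\epsilon)(y)+\epsilon}$, where $(\|V\|*\Phi_\epsilon)(y)=\int\Phi_\epsilon(x-y)\,d\|V\|(x)$, $(\delta V*\Phi_\epsilon)(y)=\int S(\nabla\Phi_\epsilon(x-y))\,dV(x,S)$. Approximate mean curvature flow: for a subdivision $\mathcal{T}=\{0=t_0<\dots<t_m=1\}$ of $[0,1]$ with size $\delta(\mathcal{T})=\max_i(t_i-t_{i-1})$ satisfying $c_3\delta(\mathcal{T})\le(M+1)^{-3}\epsilon^8$ ($c_3$ a constant depending only on $n$ ensuring that all maps below are $C^1$ diffeomorphisms and masses stay $\le M+1$), set $V_{\epsilon,\mathcal{T}}(0)=V_0$ and $V_{\epsilon,\mathcal{T}}(t)=[\mathrm{id}+(t-t_i)h_\epsilon(\cdot,V_{\epsilon,\mathcal{T}}(t_i))]_\#V_{\epsilon,\mathcal{T}}(t_i)$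 for $t\in[t_i,t_{i+1}]$. For $V_0$ compactly supported, $V_\epsilon(t)$ is the weak-$*$ limit of $V_{\epsilon,\mathcal{T}_j}(t)$ for any sequence of subdivisions with $\delta(\mathcal{T}_j)\to0$; the limit exists for every $t\in[0,1]$ and does not depend on the sequence. *)

theory Defs
  imports "Jordan_Normal_Form.Determinant" "HOL-Analysis.Analysis"
begin

text \<open>Matrices over \<open>real ^ 'n\<close> use the vocabulary of \<open>HOL-Analysis\<close>;
  \<open>Jordan_Normal_Form\<close> is needed only for a determinant whose size is a natural number.\<close>

hide_const (open) Determinant.det Matrix.mat Matrix.row Matrix.rows Matrix.col Matrix.cols
  Matrix.vec Matrix.vec_index Matrix.scalar_prod
hide_type (open) Matrix.vec Matrix.mat
no_notation Matrix.vec_index (infixl \<open>$\<close> 100)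
no_notation Matrix.scalar_prod (infix \<open>\<bullet>\<close> 70)
no_notation Matrix.transpose_mat (\<open>(_\<^sup>T)\<close> [1000])

section \<open>Derivatives\<close>

definition grad :: "(real ^ 'n \<Rightarrow> real) \<Rightarrow> real ^ 'n \<Rightarrow> real ^ 'n" where
  "grad f x = (THE D. GDERIV f x :> D)"

primrec k_times_cont_diff :: "nat \<Rightarrow> ('a::real_normed_vector \<Rightarrow> real) \<Rightarrow> bool" where
  "k_times_cont_diff 0 = (\<lambda>f. continuous_on UNIV f)"
| "k_times_cont_diff (Suc k) = (\<lambda>f. (\<forall>x. f differentiable at x) \<and>
     (\<forall>v. k_times_cont_diff k (\<lambda>x. frechet_derivative f (at x) v)))"

definition smooth :: "('a::real_normed_vector \<Rightarrow> real) \<Rightarrow> bool" where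
  "smooth f \<longleftrightarrow> (\<forall>k. k_times_cont_diff k f)"

text \<open>On \<open>{0..1} \<times> UNIV\<close> this is continuous differentiability up to the boundary,
  with one-sided time derivatives at the endpoints.\<close>

definition C1_on :: "'a::real_normed_vector set \<Rightarrow> ('a \<Rightarrow> real) \<Rightarrow> bool" where
  "C1_on A f \<longleftrightarrow> (\<exists>f' :: 'a \<Rightarrow> 'a \<Rightarrow>\<^sub>L real. continuous_on A f' \<and>
     (\<forall>p\<in>A. (f has_derivative blinfun_apply (f' p)) (at p within A)))"

section \<open>Grassmannian and varifolds\<close>

definition grassmannian :: "nat \<Rightarrow> (real ^ 'n ^ 'n) set" where
  "grassmannian d = {S. transpose S = S \<and> S ** S = S \<and> rank S = d}"

definition subspace_of :: "real ^ 'n ^ 'n \<Rightarrow> (real ^ 'n) set" where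
  "subspace_of S = range (\<lambda>v. S *v v)"

definition proj_onto :: "(real ^ 'n) set \<Rightarrow> real ^ 'n ^ 'n" where
  "proj_onto U = (THE P. transpose P = P \<and> P ** P = P \<and> subspace_of P = U)"

abbreviation grassmann_bundle :: "nat \<Rightarrow> ((real ^ 'n) \<times> (real ^ 'n ^ 'n)) set" where
  "grassmann_bundle d \<equiv> UNIV \<times> grassmannian d"

abbreviation grassmann_borel :: "nat \<Rightarrow> ((real ^ 'n) \<times> (real ^ 'n ^ 'n)) measure" where
  "grassmann_borel d \<equiv> restrict_space borel (grassmann_bundle d)"

text \<open>The bundle is locally compact and second countable, so its nonnegative Radon measures
  are the Borel measures that are finite on compact sets.\<close>

definition varifolds :: "nat \<Rightarrow> ((real ^ 'n) \<times> (real ^ 'n ^ 'n)) measure set" where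
  "varifolds d = {V. sets V = sets (grassmann_borel d) \<and>
     (\<forall>K. compact K \<and> K \<subseteq> grassmann_bundle d \<longrightarrow> emeasure V K < \<infinity>)}"

definition mass :: "((real ^ 'n) \<times> (real ^ 'n ^ 'n)) measure \<Rightarrow> (real ^ 'n) measure" where
  "mass V = distr V borel fst"

definition measure_support :: "'a::topological_space measure \<Rightarrow> 'a set" where
  "measure_support V =
     {p \<in> space V. \<forall>U. open U \<and> p \<in> U \<longrightarrow> emeasure V (U \<inter> space V) > 0}"

definition test_function :: "nat \<Rightarrow> ((real ^ 'n) \<times> (real ^ 'n ^ 'n) \<Rightarrow> real) \<Rightarrow> bool" where
  "test_function d \<phi> \<longleftrightarrow> continuous_on (grassmann_bundle d) \<phi> \<and>
     (\<exists>K. compact K \<and> K \<subseteq> grassmann_bundle d \<and> (\<forall>p \<in> grassmann_bundle d - K. \<phi> p = 0))"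

definition weak_star_limit ::
  "nat \<Rightarrow> (nat \<Rightarrow> ((real ^ 'n) \<times> (real ^ 'n ^ 'n)) measure) \<Rightarrow>
   ((real ^ 'n) \<times> (real ^ 'n ^ 'n)) measure \<Rightarrow> bool" where
  "weak_star_limit d W V \<longleftrightarrow> (\<forall>\<phi>. test_function d \<phi> \<longrightarrow>
     (\<lambda>j. \<integral>p. \<phi> p \<partial>W j) \<longlonglongrightarrow> (\<integral>p. \<phi> p \<partial>V))"

section \<open>First variation and push-forward\<close>

definition div_along :: "real ^ 'n ^ 'n \<Rightarrow> (real ^ 'n \<Rightarrow> real ^ 'n) \<Rightarrow> real ^ 'n \<Rightarrow> real" where
  "div_along S X x = trace (S ** jacobian X (at x))"

definition weighted_first_variation ::
  "((real ^ 'n) \<times> (real ^ 'n ^ 'n)) measure \<Rightarrow> (real ^ 'n \<Rightarrow> real) \<Rightarrow>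
   (real ^ 'n \<Rightarrow> real ^ 'n) \<Rightarrow> real" where
  "weighted_first_variation V \<phi> X =
     (\<integral>(x, S). \<phi> x * div_along S X x \<partial>V) + (\<integral>(x, S). grad \<phi> x \<bullet> X x \<partial>V)"

definition orthonormal_basis_of :: "nat \<Rightarrow> (real ^ 'n) set \<Rightarrow> (nat \<Rightarrow> real ^ 'n) \<Rightarrow> bool" where
  "orthonormal_basis_of d U s \<longleftrightarrow>
     (\<forall>i<d. \<forall>j<d. s i \<bullet> s j = (if i = j then 1 else 0)) \<and> span (s ` {..<d}) = U"

text \<open>The \<open>(i, j)\<close> entry of \<open>Y\<^sup>t Y\<close> is the inner product of the columns \<open>i\<close> and \<open>j\<close> of \<open>Y\<close>;
  the value does not depend on the choice of the orthonormal basis.\<close>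

definition tangential_jacobian ::
  "nat \<Rightarrow> (real ^ 'n \<Rightarrow> real ^ 'n) \<Rightarrow> real ^ 'n \<Rightarrow> real ^ 'n ^ 'n \<Rightarrow> real" where
  "tangential_jacobian d f x S =
     (let s = (SOME s. orthonormal_basis_of d (subspace_of S) s);
          Y = (\<lambda>i. jacobian f (at x) *v s i)
      in sqrt (Determinant.det (Matrix.mat d d (\<lambda>(i, j). Y i \<bullet> Y j))))"

text \<open>The integral formula for \<open>f\<^sub># V\<close> says that it is the image, under
  \<open>(x, S) \<mapsto> (f x, Df(x)(S))\<close>, of the measure with density \<open>J\<^sub>S f\<close> with respect to \<open>V\<close>.\<close>

definition push_forward ::
  "nat \<Rightarrow> (real ^ 'n \<Rightarrow> real ^ 'n) \<Rightarrow> ((real ^ 'n) \<times> (real ^ 'n ^ 'n)) measure \<Rightarrow>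
   ((real ^ 'n) \<times> (real ^ 'n ^ 'n)) measure" where
  "push_forward d f V =
     distr (density V (\<lambda>(x, S). ennreal (tangential_jacobian d f x S))) (grassmann_borel d)
       (\<lambda>(x, S). (f x, proj_onto ((\<lambda>v. jacobian f (at x) *v v) ` subspace_of S)))"

section \<open>Approximate mean curvature\<close>

definition kernel_profile :: "(real ^ 'n \<Rightarrow> real) \<Rightarrow> bool" where
  "kernel_profile \<psi> \<longleftrightarrow> smooth \<psi> \<and>
     (\<forall>x y. norm x = norm y \<longrightarrow> \<psi> x = \<psi> y) \<and>
     (\<forall>x. 0 \<le> \<psi> x \<and> \<psi> x \<le> 1) \<and>
     (\<forall>x. norm x \<le> 1/2 \<longrightarrow> \<psi> x = 1) \<and>
     (\<forall>x. norm x \<ge> 1 \<longrightarrow> \<psi> x = 0) \<and>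
     (\<forall>x. norm (grad \<psi> x) \<le> 3)"

definition truncated_gaussian ::
  "(real ^ 'n \<Rightarrow> real) \<Rightarrow> real \<Rightarrow> real ^ 'n \<Rightarrow> real" where
  "truncated_gaussian \<psi> \<epsilon> x =
     \<psi> x * (2 * pi * \<epsilon>\<^sup>2) powr (- (real CARD('n) / 2)) * exp (- ((norm x)\<^sup>2 / (2 * \<epsilon>\<^sup>2)))"

definition mollifier :: "(real ^ 'n \<Rightarrow> real) \<Rightarrow> real \<Rightarrow> real ^ 'n \<Rightarrow> real" where
  "mollifier \<psi> \<epsilon> x = (1 / (\<integral>y. truncated_gaussian \<psi> \<epsilon> y \<partial>lborel)) * truncated_gaussian \<psi> \<epsilon> x"

definition smoothed_mass ::
  "(real ^ 'n \<Rightarrow> real) \<Rightarrow> real \<Rightarrow> ((real ^ 'n) \<times> (real ^ 'n ^ 'n)) measure \<Rightarrow> real ^ 'n \<Rightarrow> real" where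
  "smoothed_mass \<psi> \<epsilon> V y = (\<integral>x. mollifier \<psi> \<epsilon> (x - y) \<partial>mass V)"

definition smoothed_first_variation ::
  "(real ^ 'n \<Rightarrow> real) \<Rightarrow> real \<Rightarrow> ((real ^ 'n) \<times> (real ^ 'n ^ 'n)) measure \<Rightarrow>
   real ^ 'n \<Rightarrow> real ^ 'n" where
  "smoothed_first_variation \<psi> \<epsilon> V y = (\<integral>(x, S). S *v grad (mollifier \<psi> \<epsilon>) (x - y) \<partial>V)"

definition h_tilde ::
  "(real ^ 'n \<Rightarrow> real) \<Rightarrow> real \<Rightarrow> ((real ^ 'n) \<times> (real ^ 'n ^ 'n)) measure \<Rightarrow>
   real ^ 'n \<Rightarrow> real ^ 'n" where
  "h_tilde \<psi> \<epsilon> V y =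
     - ((1 / (smoothed_mass \<psi> \<epsilon> V y + \<epsilon>)) *\<^sub>R smoothed_first_variation \<psi> \<epsilon> V y)"

definition approx_mean_curvature ::
  "(real ^ 'n \<Rightarrow> real) \<Rightarrow> real \<Rightarrow> ((real ^ 'n) \<times> (real ^ 'n ^ 'n)) measure \<Rightarrow>
   real ^ 'n \<Rightarrow> real ^ 'n" where
  "approx_mean_curvature \<psi> \<epsilon> V x = (\<integral>y. mollifier \<psi> \<epsilon> (x - y) *\<^sub>R h_tilde \<psi> \<epsilon> V y \<partial>lborel)"

section \<open>Approximate mean curvature flow\<close>

text \<open>A subdivision \<open>0 = t\<^sub>0 < \<dots> < t\<^sub>m = 1\<close> is the list of its points.\<close>

definition subdivision :: "real list \<Rightarrow> bool" where
  "subdivision ts \<longleftrightarrow> ts \<noteq> [] \<and> hd ts = 0 \<and> last ts = 1 \<and> sorted_wrt (<) ts"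

definition mesh :: "real list \<Rightarrow> real" where
  "mesh ts = Max {ts ! Suc i - ts ! i | i. Suc i < length ts}"

definition flow_step ::
  "nat \<Rightarrow> (real ^ 'n \<Rightarrow> real) \<Rightarrow> real \<Rightarrow> real \<Rightarrow>
   ((real ^ 'n) \<times> (real ^ 'n ^ 'n)) measure \<Rightarrow> ((real ^ 'n) \<times> (real ^ 'n ^ 'n)) measure" where
  "flow_step d \<psi> \<epsilon> s V = push_forward d (\<lambda>x. x + s *\<^sub>R approx_mean_curvature \<psi> \<epsilon> V x) V"

primrec discrete_flow_node ::
  "nat \<Rightarrow> (real ^ 'n \<Rightarrow> real) \<Rightarrow> real \<Rightarrow> ((real ^ 'n) \<times> (real ^ 'n ^ 'n)) measure \<Rightarrow>
   real list \<Rightarrow> nat \<Rightarrow> ((real ^ 'n) \<times> (real ^ 'n ^ 'n)) measure" where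
  "discrete_flow_node d \<psi> \<epsilon> V\<^sub>0 ts 0 = V\<^sub>0"
| "discrete_flow_node d \<psi> \<epsilon> V\<^sub>0 ts (Suc i) =
     flow_step d \<psi> \<epsilon> (ts ! Suc i - ts ! i) (discrete_flow_node d \<psi> \<epsilon> V\<^sub>0 ts i)"

text \<open>The least index with \<open>t \<le> t\<^sub>k\<close> is \<open>0\<close> for \<open>t = 0\<close>, and \<open>i + 1\<close> for \<open>t\<close> in the half-open
  interval from \<open>t\<^sub>i\<close> to \<open>t\<^sub>i\<^sub>+\<^sub>1\<close>. At a point \<open>t\<^sub>i\<close> the step of length \<open>0\<close> starting there
  is the identity, so the formula holds on the closed interval.\<close>

definition discrete_flow ::
  "nat \<Rightarrow> (real ^ 'n \<Rightarrow> real) \<Rightarrow> real \<Rightarrow> ((real ^ 'n) \<times> (real ^ 'n ^ 'n)) measure \<Rightarrow>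
   real list \<Rightarrow> real \<Rightarrow> ((real ^ 'n) \<times> (real ^ 'n ^ 'n)) measure" where
  "discrete_flow d \<psi> \<epsilon> V\<^sub>0 ts t =
     (case (LEAST k. t \<le> ts ! k) of
        0 \<Rightarrow> V\<^sub>0
      | Suc i \<Rightarrow> flow_step d \<psi> \<epsilon> (t - ts ! i) (discrete_flow_node d \<psi> \<epsilon> V\<^sub>0 ts i))"

text \<open>\<open>V\<close> is the flow starting from \<open>V\<^sub>0\<close>: at each time it is the limit along every sequence of
  admissible subdivisions with mesh tending to \<open>0\<close>. Since the admissibility bound holds
  eventually along such sequences when \<open>\<epsilon> > 0\<close>, \<open>M \<ge> 1\<close>, the notion does not depend on the
  value of \<open>c\<^sub>3\<close>.\<close>

definition is_approx_mcf ::
  "nat \<Rightarrow> (real ^ 'n \<Rightarrow> real) \<Rightarrow> real \<Rightarrow> real \<Rightarrow> real \<Rightarrow>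
   ((real ^ 'n) \<times> (real ^ 'n ^ 'n)) measure \<Rightarrow>
   (real \<Rightarrow> ((real ^ 'n) \<times> (real ^ 'n ^ 'n)) measure) \<Rightarrow> bool" where
  "is_approx_mcf d \<psi> c\<^sub>3 M \<epsilon> V\<^sub>0 V \<longleftrightarrow> (\<forall>t\<in>{0..1}. V t \<in> varifolds d \<and>
     (\<forall>T. (\<forall>j. subdivision (T j) \<and> c\<^sub>3 * mesh (T j) \<le> (M + 1) powi (-3) * \<epsilon> ^ 8) \<longrightarrow>
        (\<lambda>j. mesh (T j)) \<longlonglongrightarrow> 0 \<longrightarrow>
        weak_star_limit d (\<lambda>j. discrete_flow d \<psi> \<epsilon> V\<^sub>0 (T j) t) (V t)))"

end

theory Submission
  imports Defs
begin

text \<open>Applied to one step of the discrete scheme, the first-order expansion of the tangential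
  Jacobian gives the claimed identity up to \<open>o(\<tau>)\<close>, uniformly over varifolds with mass at most \<open>M + 1\<close>
  and support in a fixed ball. Such bounds hold along fine uniform subdivisions: by Fubini,
  \<open>\<integral> div\<^sub>S h dV\<close> is minus the integral of \<open>\<bar>\<delta>V * \<Phi>\<bar>\<^sup>2 / (\<parallel>V\<parallel> * \<Phi> + \<epsilon>)\<close>, so one step of
  length \<open>\<tau>\<close> increases the mass by \<open>O(\<tau>\<^sup>2)\<close> only, and it moves points by \<open>O(\<tau>)\<close>.
  Summing the steps, it remains to pass to the limit. The same use of Fubini writes the first variation in
  the direction \<open>h\<close> as an integral over \<open>y\<close> of \<open>h\<^sub>\<epsilon>\<close> before mollification against the integral of a
  continuous function with respect to \<open>V\<close>; both factors converge pointwise under weak convergence and are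
  bounded, so dominated convergence applies, first in \<open>y\<close> and then in \<open>t\<close>.\<close>

section \<open>Orthogonal projections and the Grassmannian\<close>

text \<open>The hypothesis gives no regularity of the flow in time: each \<open>V t\<close> is only
  a limit of measures tested by compactly supported functions. Measurability in \<open>t\<close> of
  both integrands is therefore part of the claim, and it is inherited from step functions. Since the
  limit is the same along every admissible sequence, the subdivisions may be chosen uniform. Bounds
  on mass and support common to all approximations make every continuous function usable as a test
  function, in particular the time slices of the weight. The allowance \<open>M + 1\<close> leaves
  room for N mass gains of order 1/N^2, whose sum is of order 1/N. The weight is only C^1, so one
  step of length tau has error o(tau) and not O(tau^2); N errors of size o(1/N) still vanish. A step
  also rotates planes. As these are encoded by projection matrices, the expansion of the Jacobian
  has to be accompanied by an estimate for the projection onto an image plane, and this needs a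
  lower bound for the derivative of the step map.\<close>

definition is_proj :: "real ^ 'n ^ 'n \<Rightarrow> bool" where
  "is_proj S \<longleftrightarrow> transpose S = S \<and> S ** S = S"

lemma grassmannianD: "S \<in> grassmannian d \<Longrightarrow> is_proj S" "S \<in> grassmannian d \<Longrightarrow> rank S = d"
  by (auto simp: grassmannian_def is_proj_def)

lemma grassmannian_iff: "S \<in> grassmannian d \<longleftrightarrow> is_proj S \<and> rank S = d"
  by (auto simp: grassmannian_def is_proj_def)

lemma symmetric_inner:
  fixes S :: "real ^ 'n ^ 'n"
  assumes "transpose S = S"
  shows "(S *v u) \<bullet> v = u \<bullet> (S *v v)"
  by (metis assms dot_lmul_matrix transpose_matrix_vector)

lemma is_proj_inner: "is_proj S \<Longrightarrow> (S *v u) \<bullet> v = u \<bullet> (S *v v)"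
  by (simp add: is_proj_def symmetric_inner)

lemma is_proj_idem: "is_proj S \<Longrightarrow> S *v (S *v u) = S *v u"
  by (simp add: is_proj_def matrix_vector_mul_assoc)

lemma norm_is_proj_le:
  assumes "is_proj S" shows "norm (S *v v) \<le> norm v"
proof -
  have "norm (S *v v) ^ 2 = (S *v v) \<bullet> v"
    using assms by (metis is_proj_idem is_proj_inner power2_norm_eq_inner)
  also have "\<dots> \<le> norm (S *v v) * norm v" by (rule norm_cauchy_schwarz)
  finally show ?thesis
    by (metis mult_le_cancel_left_pos norm_ge_zero order_le_less power2_eq_square)
qed

lemma mem_subspace_of: "is_proj S \<Longrightarrow> u \<in> subspace_of S \<longleftrightarrow> S *v u = u"
  by (metis (no_types, lifting) is_proj_idem image_iff rangeI subspace_of_def)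

lemma subspace_subspace_of: "subspace (subspace_of S)"
  unfolding subspace_of_def
  by (metis matrix_vector_mul_linear subspace_UNIV linear_subspace_image)

lemma dim_subspace_of: "dim (subspace_of S) = rank S"
  by (simp add: subspace_of_def rank_dim_range)

lemma exists_orthonormal_basis_of:
  fixes U :: "(real ^ 'n) set"
  assumes "subspace U" "dim U = d"
  shows "\<exists>s. orthonormal_basis_of d U s"
proof -
  obtain B where B: "B \<subseteq> U" "pairwise orthogonal B" "\<And>x. x \<in> B \<Longrightarrow> norm x = 1"
    "independent B" "card B = dim U" "span B = U"
    using orthonormal_basis_subspace[OF assms(1)] by metis
  have "finite B" using B(4) by (rule independent_imp_finite)
  then obtain s where s: "bij_betw s {0..<card B} B"
    using ex_bij_betw_nat_finite by blast
  have img: "s ` {..<d} = B" and inj: "inj_on s {..<d}"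
    using s B(5) assms(2) by (auto simp: bij_betw_def atLeast0LessThan)
  have "s i \<bullet> s j = (if i = j then 1 else 0)" if "i < d" "j < d" for i j
  proof (cases "i = j")
    case True
    then show ?thesis using B(3)[of "s i"] img that by (auto simp: norm_eq_1)
  next
    case False
    then have "s i \<noteq> s j" using inj that by (auto simp: inj_on_def)
    then have "orthogonal (s i) (s j)"
      using B(2) img that unfolding pairwise_def by blast
    then show ?thesis using False by (simp add: orthogonal_def)
  qed
  then show ?thesis using img B(6) unfolding orthonormal_basis_of_def by (intro exI[of _ s]) blast
qed

lemma orthonormal_basis_ofD:
  assumes "orthonormal_basis_of d U s"
  shows "\<And>i j. i < d \<Longrightarrow> j < d \<Longrightarrow> s i \<bullet> s j = (if i = j then 1 else 0)" "span (s ` {..<d}) = U"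
    "\<And>i. i < d \<Longrightarrow> s i \<in> U"
  using assms unfolding orthonormal_basis_of_def by (auto intro: span_base)

text \<open>The difference of the two sides lies in the plane and is orthogonal to every basis
  vector, hence to the whole plane and to itself.\<close>

lemma is_proj_expand:
  assumes S: "is_proj S" and s: "orthonormal_basis_of d (subspace_of S) s"
  shows "S *v v = (\<Sum>i<d. (s i \<bullet> v) *\<^sub>R s i)"
proof -
  let ?w = "S *v v - (\<Sum>i<d. (s i \<bullet> v) *\<^sub>R s i)"
  note D = orthonormal_basis_ofD[OF s]
  have fix_s: "S *v s i = s i" if "i < d" for i
    using D(3)[OF that] mem_subspace_of[OF S] by blast
  have w: "?w \<in> subspace_of S"
    by (intro subspace_diff subspace_subspace_of subspace_sum subspace_scale D(3))
       (auto simp: subspace_of_def)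
  have orth: "s k \<bullet> ?w = 0" if "k < d" for k
  proof -
    have "s k \<bullet> (S *v v) = s k \<bullet> v"
      using is_proj_inner[OF S] fix_s[OF that] by metis
    moreover have "(\<Sum>i<d. (s i \<bullet> v) * (s k \<bullet> s i)) = (\<Sum>i<d. if i = k then s k \<bullet> v else 0)"
      by (rule sum.cong) (use D(1) that in auto)
    ultimately show ?thesis using that
      by (simp add: inner_diff_right inner_sum_right)
  qed
  have "s ` {..<d} \<subseteq> {x. x \<bullet> ?w = 0}" using orth by auto
  moreover have "subspace {x. x \<bullet> ?w = 0}"
    by (simp add: subspace_def inner_add_left)
  ultimately have "subspace_of S \<subseteq> {x. x \<bullet> ?w = 0}"
    using D(2) span_minimal by blast
  then have "?w \<bullet> ?w = 0" using w by blast
  then show ?thesis by simp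
qed

lemma trace_mult_row: "trace (S ** (A :: real ^ 'n ^ 'n)) = (\<Sum>k\<in>UNIV. (S *v (A *v axis k 1)) $ k)"
  by (simp add: trace_def matrix_vector_mult_basis column_def) (simp add: matrix_matrix_mult_def matrix_vector_mult_def)

text \<open>Expand \<open>S\<close> in the basis and exchange the sums over basis vectors and
  coordinates. In this form the divergence along a plane appears as the linear term of a Gram
  determinant.\<close>

lemma trace_is_proj_mult:
  assumes S: "is_proj S" and s: "orthonormal_basis_of d (subspace_of S) s"
  shows "trace (S ** A) = (\<Sum>i<d. s i \<bullet> (A *v s i))"
proof -
  have "trace (S ** A) = (\<Sum>k\<in>UNIV. \<Sum>i<d. (s i \<bullet> (A *v axis k 1)) * s i $ k)"
    by (simp add: trace_mult_row is_proj_expand[OF S s] sum_component)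
  also have "\<dots> = (\<Sum>i<d. s i \<bullet> (A *v (\<Sum>k\<in>UNIV. s i $ k *\<^sub>R axis k 1)))"
    by (subst sum.swap)
       (simp add: inner_sum_right linear_sum[OF matrix_vector_mul_linear] linear_scale[OF matrix_vector_mul_linear] mult.commute)
  also have "\<dots> = (\<Sum>i<d. s i \<bullet> (A *v s i))"
    by (simp add: basis_expansion scalar_mult_eq_scaleR[symmetric])
  finally show ?thesis .
qed

lemma trace_is_proj:
  assumes "is_proj S" shows "trace S = real (rank S)"
proof -
  obtain s where s: "orthonormal_basis_of (rank S) (subspace_of S) s"
    using exists_orthonormal_basis_of[OF subspace_subspace_of dim_subspace_of] by blast
  have "trace (S ** mat 1) = (\<Sum>i<rank S. s i \<bullet> (mat 1 *v s i))"
    by (rule trace_is_proj_mult[OF assms s])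
  also have "\<dots> = (\<Sum>i<rank S. 1)" by (rule sum.cong) (auto simp: orthonormal_basis_ofD(1)[OF s])
  finally show ?thesis by simp
qed

text \<open>The trace is continuous while the rank is not, so this description shows that the
  Grassmannian is closed.\<close>

lemma grassmannian_iff_trace: "S \<in> grassmannian d \<longleftrightarrow> is_proj S \<and> trace S = real d"
  using trace_is_proj by (auto simp: grassmannian_iff)

section \<open>Matrix norms and compactness of the Grassmannian\<close>

lemma norm_matrix_le:
  fixes A :: "real ^ 'n ^ 'm"
  assumes "\<And>v. norm (A *v v) \<le> c * norm v"
  shows "norm A \<le> real CARD('m) * real CARD('n) * c"
proof -
  have entry: "\<bar>A $ i $ j\<bar> \<le> c" for i j
  proof -
    have "\<bar>A $ i $ j\<bar> = \<bar>(A *v axis j 1) $ i\<bar>"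
      by (simp add: matrix_vector_mult_basis column_def)
    also have "\<dots> \<le> c * norm (axis j 1 :: real ^ 'n)"
      using component_le_norm_cart assms order_trans by blast
    finally show ?thesis by simp
  qed
  have "norm A \<le> (\<Sum>i\<in>UNIV. norm (A $ i))" by (rule norm_vec_def[THEN eq_refl, THEN order_trans]) (rule L2_set_le_sum, simp)
  also have "\<dots> \<le> (\<Sum>i\<in>(UNIV::'m set). \<Sum>j\<in>(UNIV::'n set). c)"
    by (intro sum_mono order_trans[OF norm_le_l1_cart] entry)
  finally show ?thesis by (simp add: mult.assoc)
qed

lemma norm_matrix_vector_mult_le:
  fixes A :: "real ^ 'n ^ 'm"
  shows "norm (A *v v) \<le> norm A * norm v"
proof -
  have "norm (A *v v) = L2_set (\<lambda>i. A $ i \<bullet> v) UNIV"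
    by (simp add: norm_vec_def matrix_vector_mult_def inner_vec_def L2_set_def)
  also have "\<dots> \<le> L2_set (\<lambda>i. norm (A $ i) * norm v) UNIV"
    unfolding L2_set_def
    by (intro real_sqrt_le_mono sum_mono)
       (metis Cauchy_Schwarz_ineq2 abs_ge_zero power2_abs power_mono)
  also have "\<dots> = norm A * norm v"
    by (simp add: norm_vec_def L2_set_left_distrib)
  finally show ?thesis .
qed

lemma continuous_on_matrix_vector_mult [continuous_intros]:
  fixes f :: "'a::topological_space \<Rightarrow> real ^ 'n ^ 'm"
  assumes "continuous_on A f" "continuous_on A g"
  shows "continuous_on A (\<lambda>x. f x *v g x)"
  unfolding matrix_vector_mult_def using assms by (auto intro!: continuous_intros)

lemma continuous_on_matrix_matrix_mult [continuous_intros]: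
  fixes f :: "'a::topological_space \<Rightarrow> real ^ 'n ^ 'm" and g :: "'a \<Rightarrow> real ^ 'k ^ 'n"
  assumes "continuous_on A f" "continuous_on A g"
  shows "continuous_on A (\<lambda>x. f x ** g x)"
  unfolding matrix_matrix_mult_def using assms by (auto intro!: continuous_intros)

lemma continuous_on_trace [continuous_intros]:
  fixes f :: "'a::topological_space \<Rightarrow> real ^ 'n ^ 'n"
  assumes "continuous_on A f" shows "continuous_on A (\<lambda>x. trace (f x))"
  unfolding trace_def using assms by (auto intro!: continuous_intros)

text \<open>The norm of a matrix is here the Euclidean norm of its entries, so passing from the
  operator bound 1 costs a dimensional factor.\<close>

lemma norm_grassmannian_le:
  fixes S :: "real ^ 'n ^ 'n"
  assumes "is_proj S" shows "norm S \<le> real CARD('n) * real CARD('n)"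
  using norm_matrix_le[of S 1] norm_is_proj_le[OF assms] by simp

text \<open>Because the fibre is compact, later cutoffs, bounds and moduli of continuity only have
  to confine the space variable to a ball.\<close>

lemma compact_grassmannian: "compact (grassmannian d :: (real ^ 'n ^ 'n) set)"
proof -
  have "closed {S :: real ^ 'n ^ 'n. transpose S = S \<and> S ** S = S \<and> trace S = real d}"
    by (intro closed_Collect_conj closed_Collect_eq continuous_intros)
       (auto simp: transpose_def intro!: continuous_intros)
  moreover have "{S :: real ^ 'n ^ 'n. transpose S = S \<and> S ** S = S \<and> trace S = real d} = grassmannian d"
    by (auto simp: grassmannian_iff_trace is_proj_def)
  moreover have "bounded (grassmannian d :: (real ^ 'n ^ 'n) set)"
    unfolding bounded_iff using norm_grassmannian_le grassmannianD(1) by blast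
  ultimately show ?thesis by (simp add: compact_eq_bounded_closed)
qed

text \<open>Each matrix fixes the range of the other, so \<open>Q ** P = P\<close> and
  \<open>P ** Q = Q\<close>; transposing the first product turns it into the second.\<close>

lemma is_proj_unique:
  assumes P: "is_proj P" and Q: "is_proj Q" and eq: "subspace_of P = subspace_of Q"
  shows "P = Q"
proof -
  have QP: "Q ** P = P"
  proof (subst matrix_eq, intro allI)
    fix v
    have "P *v v \<in> subspace_of Q" using eq by (auto simp: subspace_of_def)
    then show "(Q ** P) *v v = P *v v"
      using mem_subspace_of[OF Q] by (simp add: matrix_vector_mul_assoc[symmetric])
  qed
  have PQ: "P ** Q = Q"
  proof (subst matrix_eq, intro allI)
    fix v
    have "Q *v v \<in> subspace_of P" using eq by (auto simp: subspace_of_def)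
    then show "(P ** Q) *v v = Q *v v"
      using mem_subspace_of[OF P] by (simp add: matrix_vector_mul_assoc[symmetric])
  qed
  have "P = transpose (Q ** P)" using QP P by (simp add: is_proj_def)
  also have "\<dots> = P ** Q" using P Q by (simp add: matrix_transpose_mul is_proj_def)
  finally show ?thesis using PQ by simp
qed

lemma is_proj_exists:
  fixes U :: "(real ^ 'n) set"
  assumes U: "subspace U" shows "\<exists>P. is_proj P \<and> subspace_of P = U"
proof -
  obtain s where s: "orthonormal_basis_of (dim U) U s"
    using exists_orthonormal_basis_of[OF U] by blast
  note D = orthonormal_basis_ofD[OF s]
  define p where "p v = (\<Sum>i<dim U. (s i \<bullet> v) *\<^sub>R s i)" for v
  have lin: "linear p"
    unfolding p_def by (intro linearI)
      (simp_all add: inner_add_right scaleR_add_left sum.distrib scaleR_sum_right)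
  define P where "P = matrix p"
  have Pv: "P *v v = p v" for v
    unfolding P_def using lin by (simp add: matrix_vector_mul)
  have p_in: "p v \<in> U" for v
    unfolding p_def by (intro subspace_sum[OF U] subspace_scale[OF U] D(3)) auto
  have p_s: "p (s k) = s k" if "k < dim U" for k
  proof -
    have "p (s k) = (\<Sum>i<dim U. if i = k then s k else 0)"
      unfolding p_def by (rule sum.cong) (use D(1) that in auto)
    then show ?thesis using that by simp
  qed
  have p_id: "p u = u" if "u \<in> U" for u
  proof -
    have "subspace {u. p u = u}"
      using lin by (auto simp: subspace_def linear_add linear_scale linear_0)
    moreover have "s ` {..<dim U} \<subseteq> {u. p u = u}" using p_s by auto
    ultimately have "U \<subseteq> {u. p u = u}" using D(2) span_minimal by blast
    then show ?thesis using that by blast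
  qed
  have sym: "(P *v u) \<bullet> v = u \<bullet> (P *v v)" for u v
    by (simp add: Pv p_def inner_sum_left inner_sum_right inner_commute mult.commute)
  have "transpose P = P"
  proof (subst matrix_eq, intro allI)
    fix v
    have "u \<bullet> (transpose P *v v) = u \<bullet> (P *v v)" for u
      by (metis sym dot_lmul_matrix inner_commute transpose_matrix_vector)
    then show "transpose P *v v = P *v v" by (metis vector_eq_ldot)
  qed
  moreover have "P ** P = P"
    by (subst matrix_eq) (simp add: matrix_vector_mul_assoc[symmetric] Pv p_id p_in)
  moreover have "subspace_of P = U"
    unfolding subspace_of_def Pv using p_in p_id by (metis image_subset_iff rangeI subsetI subset_antisym)
  ultimately show ?thesis unfolding is_proj_def by blast
qed

lemma proj_onto:
  fixes U :: "(real ^ 'n) set"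
  assumes U: "subspace U"
  shows "is_proj (proj_onto U)" "subspace_of (proj_onto U) = U"
proof -
  have "\<exists>!P. transpose P = P \<and> P ** P = P \<and> subspace_of P = U"
    using is_proj_exists[OF U] is_proj_unique unfolding is_proj_def by metis
  from theI'[OF this] show "is_proj (proj_onto U)" "subspace_of (proj_onto U) = U"
    unfolding proj_onto_def is_proj_def by auto
qed

lemma proj_onto_subspace_of: "is_proj S \<Longrightarrow> proj_onto (subspace_of S) = S"
  using proj_onto[OF subspace_subspace_of] is_proj_unique by blast

section \<open>Images of planes under injective linear maps\<close>

definition image_plane :: "real ^ 'n ^ 'n \<Rightarrow> real ^ 'n ^ 'n \<Rightarrow> real ^ 'n ^ 'n" where
  "image_plane L S = proj_onto ((\<lambda>v. L *v v) ` subspace_of S)"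

lemma subspace_image_subspace_of: "subspace ((\<lambda>v. L *v v) ` subspace_of S)"
  by (intro linear_subspace_image matrix_vector_mul_linear subspace_subspace_of)

lemma is_proj_image_plane: "is_proj (image_plane L S)"
  unfolding image_plane_def by (rule proj_onto[OF subspace_image_subspace_of])

lemma subspace_of_image_plane: "subspace_of (image_plane L S) = (\<lambda>v. L *v v) ` subspace_of S"
  unfolding image_plane_def by (rule proj_onto[OF subspace_image_subspace_of])

lemma image_plane_id: "is_proj S \<Longrightarrow> image_plane (mat 1) S = S"
  unfolding image_plane_def by (simp add: proj_onto_subspace_of)

text \<open>The lower bound is injectivity in quantitative form, so the dimension of the plane is
  kept.\<close>

lemma image_plane_grassmannian:
  assumes L: "\<And>u. norm u \<le> k * norm (L *v u)" and S: "S \<in> grassmannian d"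
  shows "image_plane L S \<in> grassmannian d"
proof -
  have "inj ((*v) L)"
  proof (rule injI)
    fix x y assume "L *v x = L *v y"
    then show "x = y" using L[of "x - y"] by (simp add: matrix_vector_mult_diff_distrib)
  qed
  then have "dim ((\<lambda>v. L *v v) ` subspace_of S) = dim (subspace_of S)"
    by (intro dim_image_eq matrix_vector_mul_linear) (auto intro: inj_on_subset)
  then show ?thesis
    using S is_proj_image_plane subspace_of_image_plane[of L S]
    by (metis dim_subspace_of grassmannian_iff)
qed

text \<open>With P and P' the projections onto the two images, this bounds (I - P') P. A vector of
  the first image is \<open>L *v u\<close> with \<open>u\<close> in the plane and
  \<open>norm u\<close> at most \<open>k\<close> times its length. Replacing it by the corresponding
  vector of the second image costs at most \<open>\<eta> * norm u\<close>, and I - P' annihilates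
  the replacement.\<close>

lemma image_plane_defect:
  assumes L: "\<And>u. norm u \<le> k * norm (L *v u)" and S: "is_proj S" and S': "is_proj S'"
    and k: "k \<ge> 0" and diff: "\<And>u. norm ((L ** S) *v u - (L' ** S') *v u) \<le> \<eta> * norm u" and "\<eta> \<ge> 0"
  shows "norm (image_plane L S *v w - image_plane L' S' *v (image_plane L S *v w)) \<le> k * \<eta> * norm w"
proof -
  let ?P = "image_plane L S" and ?P' = "image_plane L' S'"
  have P': "is_proj ?P'" and P: "is_proj ?P" by (rule is_proj_image_plane)+
  have "?P *v w \<in> (\<lambda>v. L *v v) ` subspace_of S"
    unfolding subspace_of_image_plane[symmetric] by (auto simp: subspace_of_def)
  then obtain u where u: "S *v u = u" "?P *v w = L *v u"
    using mem_subspace_of[OF S] by blast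
  have "(L' ** S') *v u \<in> subspace_of ?P'"
    unfolding subspace_of_image_plane by (auto simp: subspace_of_def matrix_vector_mul_assoc[symmetric])
  then have fixed: "?P' *v ((L' ** S') *v u) = (L' ** S') *v u"
    using mem_subspace_of[OF P'] by blast
  let ?z = "L *v u - (L' ** S') *v u"
  have "(?P *v w - ?P' *v (?P *v w)) = ?z - ?P' *v ?z"
    by (simp add: u(2) matrix_vector_mult_diff_distrib fixed)
  also have "norm \<dots> \<le> norm ?z"
  proof -
    have "norm (?z - ?P' *v ?z) ^ 2 = (?z - ?P' *v ?z) \<bullet> ?z"
      using is_proj_inner[OF P'] is_proj_idem[OF P']
      by (simp add: power2_norm_eq_inner inner_diff_left inner_diff_right)
    also have "\<dots> \<le> norm (?z - ?P' *v ?z) * norm ?z" by (rule norm_cauchy_schwarz)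
    finally show ?thesis
      by (metis mult_le_cancel_left_pos norm_ge_zero order_le_less power2_eq_square)
  qed
  also have "?z = (L ** S) *v u - (L' ** S') *v u"
    using u(1) by (simp add: matrix_vector_mul_assoc[symmetric])
  also have "norm \<dots> \<le> \<eta> * norm u" by (rule diff)
  also have "\<dots> \<le> \<eta> * (k * norm (?P *v w))" using L[of u] u(2) \<open>\<eta> \<ge> 0\<close> by (intro mult_left_mono) auto
  also have "\<dots> \<le> \<eta> * (k * norm w)"
    using norm_is_proj_le[OF P] k \<open>\<eta> \<ge> 0\<close> by (intro mult_left_mono) auto
  finally show ?thesis by (simp add: mult_ac)
qed

text \<open>Serves twice: for the continuity of the image plane in both arguments, and with
  \<open>L' = mat 1\<close> for the rotation of a plane by one step.\<close>

lemma image_plane_diff: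
  assumes L: "\<And>u. norm u \<le> k * norm (L *v u)" and L': "\<And>u. norm u \<le> k * norm (L' *v u)"
    and S: "is_proj S" and S': "is_proj S'" and k: "k \<ge> 0"
    and diff: "\<And>u. norm ((L ** S) *v u - (L' ** S') *v u) \<le> \<eta> * norm u" and \<eta>: "\<eta> \<ge> 0"
  shows "norm (image_plane L S - image_plane L' S' :: real ^ 'n ^ 'n) \<le> real CARD('n) * real CARD('n) * (2 * k * \<eta>)"
proof (rule norm_matrix_le)
  fix v :: "real ^ 'n"
  let ?P = "image_plane L S" and ?P' = "image_plane L' S'"
  have P': "is_proj ?P'" and P: "is_proj ?P" by (rule is_proj_image_plane)+
  have d1: "norm (?P *v w - ?P' *v (?P *v w)) \<le> k * \<eta> * norm w" for w
    by (rule image_plane_defect[OF L S S' k diff \<eta>])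
  have d2: "norm (?P' *v w - ?P *v (?P' *v w)) \<le> k * \<eta> * norm w" for w
    by (rule image_plane_defect[OF L' S' S k _ \<eta>]) (metis diff norm_minus_commute)
  let ?y = "v - ?P' *v v"
  \<comment> \<open>\<open>P - P' = P (I - P') - (I - P) P'\<close>, and \<open>P (I - P')\<close> is the transpose of \<open>(I - P') P\<close>.\<close>
  have t: "norm (?P *v ?y) \<le> k * \<eta> * norm v"
  proof -
    let ?z = "?P *v ?y"
    have "norm ?z ^ 2 = (?P *v ?z) \<bullet> ?y"
      by (metis P is_proj_idem is_proj_inner inner_commute power2_norm_eq_inner)
    also have "\<dots> = (?P *v ?z - ?P' *v (?P *v ?z)) \<bullet> v"
      using is_proj_inner[OF P'] by (simp add: inner_diff_left inner_diff_right)
    also have "\<dots> \<le> norm (?P *v ?z - ?P' *v (?P *v ?z)) * norm v" by (rule norm_cauchy_schwarz)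
    also have "\<dots> \<le> (k * \<eta> * norm ?z) * norm v"
      by (intro mult_right_mono d1) auto
    finally have "norm ?z * norm ?z \<le> norm ?z * (k * \<eta> * norm v)"
      by (simp add: power2_eq_square mult_ac)
    then show ?thesis
      using k \<eta> by (metis mult_le_cancel_left_pos mult_nonneg_nonneg norm_ge_zero order_le_less)
  qed
  have "(?P - ?P') *v v = ?P *v ?y - (?P' *v v - ?P *v (?P' *v v))"
    by (simp add: matrix_vector_mult_diff_distrib matrix_vector_mult_diff_rdistrib)
  also have "norm \<dots> \<le> k * \<eta> * norm v + k * \<eta> * norm v"
    by (intro order_trans[OF norm_triangle_ineq4] add_mono t d2)
  finally show "norm ((?P - ?P') *v v) \<le> 2 * k * \<eta> * norm v" by (simp add: mult_ac)
qed

section \<open>The tangential Jacobian\<close>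

text \<open>The squared d-dimensional volume of the parallelepiped spanned by the vectors.\<close>

definition gram_det :: "nat \<Rightarrow> (nat \<Rightarrow> real ^ 'n) \<Rightarrow> real" where
  "gram_det d v = Determinant.det (Matrix.mat d d (\<lambda>(i, j). v i \<bullet> v j))"

lemma gram_det_cong: "(\<And>i. i < d \<Longrightarrow> v i = w i) \<Longrightarrow> gram_det d v = gram_det d w"
  unfolding gram_det_def by (intro arg_cong[where f = Determinant.det] eq_matI) auto

text \<open>If C is the matrix of coefficients and G the Gram matrix of the \<open>u\<close>, then
  the Gram matrix of the \<open>v\<close> is the product of the transpose of C, of G and of
  C.\<close>

lemma gram_det_change_basis:
  assumes "\<And>i. i < d \<Longrightarrow> v i = (\<Sum>k<d. C k i *\<^sub>R u k)"
  shows "gram_det d v = (Determinant.det (Matrix.mat d d (\<lambda>(i, j). C i j)))\<^sup>2 * gram_det d u"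
proof -
  let ?C = "Matrix.mat d d (\<lambda>(i, j). C i j)" and ?G = "Matrix.mat d d (\<lambda>(i, j). u i \<bullet> u j)"
  have "Matrix.mat d d (\<lambda>(i, j). v i \<bullet> v j) = transpose_mat ?C * (?G * ?C)"
  proof (rule eq_matI)
    fix i j assume ij: "i < dim_row (transpose_mat ?C * (?G * ?C))" "j < dim_col (transpose_mat ?C * (?G * ?C))"
    then have "i < d" "j < d" by auto
    have "(transpose_mat ?C * (?G * ?C)) $$ (i, j) = (\<Sum>k<d. C k i * (\<Sum>l<d. (u k \<bullet> u l) * C l j))"
      using \<open>i < d\<close> \<open>j < d\<close> by (simp add: Matrix.scalar_prod_def atLeast0LessThan)
    also have "\<dots> = (\<Sum>k<d. C k i *\<^sub>R u k) \<bullet> (\<Sum>l<d. C l j *\<^sub>R u l)"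
      by (simp only: inner_sum_left inner_scaleR_left) (simp add: inner_sum_right mult.commute)
    finally show "Matrix.mat d d (\<lambda>(i, j). v i \<bullet> v j) $$ (i, j) = (transpose_mat ?C * (?G * ?C)) $$ (i, j)"
      using \<open>i < d\<close> \<open>j < d\<close> assms by simp
  qed auto
  moreover have c: "?C \<in> carrier_mat d d" "transpose_mat ?C \<in> carrier_mat d d" "?G \<in> carrier_mat d d" "?G * ?C \<in> carrier_mat d d"
    by auto
  ultimately show ?thesis
    unfolding gram_det_def
    by (simp only: det_mult[OF c(2) c(4)] det_mult[OF c(3) c(1)] Determinant.det_transpose[OF c(1)] power2_eq_square mult_ac)
qed

lemma gram_det_orthonormal:
  assumes "orthonormal_basis_of d U s" shows "gram_det d s = 1"
proof -
  have "Matrix.mat d d (\<lambda>(i, j). s i \<bullet> s j) = 1\<^sub>m d"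
    by (rule eq_matI) (auto simp: orthonormal_basis_ofD(1)[OF assms])
  then show ?thesis by (simp add: gram_det_def)
qed

lemma tendsto_det_mat:
  fixes f :: "'a \<Rightarrow> nat \<Rightarrow> nat \<Rightarrow> real"
  assumes "\<And>i j. i < d \<Longrightarrow> j < d \<Longrightarrow> ((\<lambda>x. f x i j) \<longlongrightarrow> g i j) F"
  shows "((\<lambda>x. Determinant.det (Matrix.mat d d (\<lambda>(i, j). f x i j))) \<longlongrightarrow>
    Determinant.det (Matrix.mat d d (\<lambda>(i, j). g i j))) F"
proof -
  \<comment> \<open>The Leibniz sum exhibits the determinant as a polynomial in the entries.\<close>
  have eq: "Determinant.det (Matrix.mat d d (\<lambda>(i, j). h i j)) =
      (\<Sum>p | p permutes {0..<d}. of_int (sign p) * (\<Prod>i = 0..<d. h i (p i)))" for h :: "nat \<Rightarrow> nat \<Rightarrow> real"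
    by (subst det_def'[of _ d]) (auto intro!: sum.cong prod.cong dest: permutes_in_image)
  show ?thesis
    unfolding eq
    by (intro tendsto_intros assms) (auto dest: permutes_in_image)
qed

definition plane_jacobian :: "nat \<Rightarrow> real ^ 'n ^ 'n \<Rightarrow> real ^ 'n ^ 'n \<Rightarrow> real" where
  "plane_jacobian d L S = sqrt (gram_det d (\<lambda>i. L *v (SOME s. orthonormal_basis_of d (subspace_of S) s) i))"

lemma tangential_jacobian_eq:
  "tangential_jacobian d f x S = plane_jacobian d (jacobian f (at x)) S"
  by (simp add: tangential_jacobian_def plane_jacobian_def gram_det_def Let_def)

lemma some_orthonormal_basis:
  assumes "S \<in> grassmannian d"
  shows "orthonormal_basis_of d (subspace_of S) (SOME s. orthonormal_basis_of d (subspace_of S) s)"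
proof (rule someI_ex[of "orthonormal_basis_of d (subspace_of S)"])
  show "\<exists>s. orthonormal_basis_of d (subspace_of S) s"
    by (rule exists_orthonormal_basis_of)
       (use assms in \<open>auto simp: subspace_subspace_of dim_subspace_of grassmannian_iff\<close>)
qed

text \<open>The projections of a fixed orthonormal basis of \<open>S\<^sub>0\<close> remain a basis of every nearby plane \<open>S\<close>.
  The resulting formula involves no choice depending on \<open>S\<close>, so it gives continuity in \<open>S\<close>.\<close>

lemma plane_jacobian_quotient:
  assumes S: "S \<in> grassmannian d" and ne: "gram_det d (\<lambda>i. S *v v i) \<noteq> 0"
  shows "plane_jacobian d L S = sqrt (gram_det d (\<lambda>i. L *v (S *v v i)) / gram_det d (\<lambda>i. S *v v i))"
proof -
  define s where "s = (SOME s. orthonormal_basis_of d (subspace_of S) s)"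
  have s: "orthonormal_basis_of d (subspace_of S) s"
    unfolding s_def by (rule some_orthonormal_basis[OF S])
  define C where "C k i = s k \<bullet> v i" for k i
  have ex: "S *v v i = (\<Sum>k<d. C k i *\<^sub>R s k)" for i
    unfolding C_def by (rule is_proj_expand[OF grassmannianD(1)[OF S] s])
  have exL: "L *v (S *v v i) = (\<Sum>k<d. C k i *\<^sub>R (L *v s k))" for i
    by (simp add: ex linear_sum[OF matrix_vector_mul_linear] linear_scale[OF matrix_vector_mul_linear])
  let ?c = "(Determinant.det (Matrix.mat d d (\<lambda>(i, j). C i j)))\<^sup>2"
  have "gram_det d (\<lambda>i. S *v v i) = ?c * gram_det d s"
    by (rule gram_det_change_basis) (rule ex)
  then have 1: "gram_det d (\<lambda>i. S *v v i) = ?c" by (simp add: gram_det_orthonormal[OF s])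
  have 2: "gram_det d (\<lambda>i. L *v (S *v v i)) = ?c * gram_det d (\<lambda>i. L *v s i)"
    by (rule gram_det_change_basis) (rule exL)
  show ?thesis using ne unfolding plane_jacobian_def s_def[symmetric] 1 2 by simp
qed

lemma tendsto_gram_det:
  assumes "\<And>i. i < d \<Longrightarrow> ((\<lambda>x. v x i) \<longlongrightarrow> w i) F"
  shows "((\<lambda>x. gram_det d (v x)) \<longlongrightarrow> gram_det d w) F"
  unfolding gram_det_def by (rule tendsto_det_mat) (intro tendsto_inner assms)

lemma tendsto_matrix_vector_mult [tendsto_intros]:
  fixes f :: "'a \<Rightarrow> real ^ 'n ^ 'm"
  assumes "(f \<longlongrightarrow> A) F" "(g \<longlongrightarrow> v) F"
  shows "((\<lambda>x. f x *v g x) \<longlongrightarrow> A *v v) F"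
  unfolding matrix_vector_mult_def using assms by (auto intro!: tendsto_intros)

lemma continuous_on_plane_jacobian:
  "continuous_on (UNIV \<times> grassmannian d) (\<lambda>(L :: real ^ 'n ^ 'n, S). plane_jacobian d L S)"
  unfolding continuous_on_def
proof
  fix p0 :: "(real ^ 'n ^ 'n) \<times> (real ^ 'n ^ 'n)" assume "p0 \<in> UNIV \<times> grassmannian d"
  then obtain L0 S0 where p0: "p0 = (L0, S0)" and S0: "S0 \<in> grassmannian d" by auto
  define s where "s = (SOME s. orthonormal_basis_of d (subspace_of S0) s)"
  have s: "orthonormal_basis_of d (subspace_of S0) s"
    unfolding s_def by (rule some_orthonormal_basis[OF S0])
  let ?F = "at p0 within UNIV \<times> grassmannian d"
  let ?D = "\<lambda>p. gram_det d (\<lambda>i. snd p *v s i)"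
  let ?N = "\<lambda>p. gram_det d (\<lambda>i. fst p *v (snd p *v s i))"
  have S0s: "S0 *v s i = s i" if "i < d" for i
    using orthonormal_basis_ofD(3)[OF s that] mem_subspace_of[OF grassmannianD(1)[OF S0]] by blast
  have D0: "?D p0 = 1"
    using gram_det_cong[of d "\<lambda>i. S0 *v s i" s] S0s gram_det_orthonormal[OF s] by (simp add: p0)
  have limD: "(?D \<longlongrightarrow> ?D p0) ?F" and limN: "(?N \<longlongrightarrow> ?N p0) ?F"
    by (rule tendsto_gram_det; intro tendsto_intros)+
  \<comment> \<open>The denominator equals 1 at the base point, so the quotient formula is available
    on a whole neighbourhood.\<close>
  have ev: "\<forall>\<^sub>F p in ?F. ?D p \<noteq> 0"
    using limD by (rule tendsto_imp_eventually_ne) (simp add: D0)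
  have lim: "((\<lambda>p. sqrt (?N p / ?D p)) \<longlongrightarrow> sqrt (?N p0 / ?D p0)) ?F"
    by (intro tendsto_intros limD limN) (simp add: D0)
  have "\<forall>\<^sub>F p in ?F. p \<in> UNIV \<times> grassmannian d" by (simp add: eventually_at_filter)
  then have ev': "\<forall>\<^sub>F p in ?F. sqrt (?N p / ?D p) = (case p of (L, S) \<Rightarrow> plane_jacobian d L S)"
    using ev by eventually_elim (auto simp: plane_jacobian_quotient)
  have val: "sqrt (?N p0 / ?D p0) = (case p0 of (L, S) \<Rightarrow> plane_jacobian d L S)"
    using D0 plane_jacobian_quotient[OF S0, of s L0] by (simp add: p0)
  show "((\<lambda>(L, S). plane_jacobian d L S) \<longlongrightarrow> (case p0 of (L, S) \<Rightarrow> plane_jacobian d L S)) ?F"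
    using Lim_transform_eventually[OF lim ev'] unfolding val .
qed

section \<open>Expansion of products, determinants and square roots near the identity\<close>

lemma prod_one_plus_expansion:
  "\<exists>K\<ge>0. \<forall>(e :: nat \<Rightarrow> real) \<eta>. 0 \<le> \<eta> \<longrightarrow> \<eta> \<le> 1 \<longrightarrow> (\<forall>i<d. \<bar>e i\<bar> \<le> \<eta>) \<longrightarrow>
     \<bar>(\<Prod>i<d. 1 + e i) - 1 - (\<Sum>i<d. e i)\<bar> \<le> K * \<eta>\<^sup>2"
proof (induction d)
  case 0
  show ?case by (intro exI[of _ 0]) auto
next
  case (Suc d)
  then obtain K where K: "K \<ge> 0" "\<And>(e :: nat \<Rightarrow> real) \<eta>. 0 \<le> \<eta> \<Longrightarrow> \<eta> \<le> 1 \<Longrightarrow> (\<forall>i<d. \<bar>e i\<bar> \<le> \<eta>) \<Longrightarrow>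
     \<bar>(\<Prod>i<d. 1 + e i) - 1 - (\<Sum>i<d. e i)\<bar> \<le> K * \<eta>\<^sup>2" by blast
  show ?case
  \<comment> \<open>One more factor turns the remainder R into R (1 + e_d) plus e_d times the sum of
    the earlier e_i. The first part is at most 2 K eta^2 because eta \<le> 1, the second at most d
    eta^2.\<close>
  proof (intro exI[of _ "2 * K + real d"] conjI allI impI)
    show "0 \<le> 2 * K + real d" using K(1) by simp
    fix e :: "nat \<Rightarrow> real" and \<eta> :: real
    assume \<eta>: "0 \<le> \<eta>" "\<eta> \<le> 1" and e: "\<forall>i<Suc d. \<bar>e i\<bar> \<le> \<eta>"
    let ?R = "(\<Prod>i<d. 1 + e i) - 1 - (\<Sum>i<d. e i)"
    have R: "\<bar>?R\<bar> \<le> K * \<eta>\<^sup>2" using K(2)[of \<eta> e] \<eta> e by simp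
    have ed: "\<bar>e d\<bar> \<le> \<eta>" using e by simp
    have s: "\<bar>\<Sum>i<d. e i\<bar> \<le> real d * \<eta>"
      using sum_norm_bound[of "{..<d}" e \<eta>] e by simp
    have "(\<Prod>i<Suc d. 1 + e i) - 1 - (\<Sum>i<Suc d. e i) = ?R * (1 + e d) + (\<Sum>i<d. e i) * e d"
      by (simp add: algebra_simps)
    also have "\<bar>\<dots>\<bar> \<le> \<bar>?R\<bar> * \<bar>1 + e d\<bar> + \<bar>\<Sum>i<d. e i\<bar> * \<bar>e d\<bar>"
      by (metis abs_mult abs_triangle_ineq)
    also have "\<dots> \<le> (K * \<eta>\<^sup>2) * 2 + (real d * \<eta>) * \<eta>"
      using ed \<eta> K(1) by (intro add_mono mult_mono R s) auto
    finally show "\<bar>(\<Prod>i<Suc d. 1 + e i) - 1 - (\<Sum>i<Suc d. e i)\<bar> \<le> (2 * K + real d) * \<eta>\<^sup>2"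
      by (simp add: algebra_simps power2_eq_square)
  qed
qed

text \<open>Every permutation other than the identity moves at least two indices, so it contributes
  at least two off-diagonal factors.\<close>

lemma det_one_plus_expansion:
  "\<exists>K\<ge>0. \<forall>(E :: nat \<Rightarrow> nat \<Rightarrow> real) \<eta>. 0 \<le> \<eta> \<longrightarrow> \<eta> \<le> 1 \<longrightarrow> (\<forall>i<d. \<forall>j<d. \<bar>E i j\<bar> \<le> \<eta>) \<longrightarrow>
     \<bar>Determinant.det (Matrix.mat d d (\<lambda>(i, j). (if i = j then 1 else 0) + E i j)) - 1 - (\<Sum>i<d. E i i)\<bar> \<le> K * \<eta>\<^sup>2"
proof -
  obtain K where K: "K \<ge> 0" "\<And>(e :: nat \<Rightarrow> real) \<eta>. 0 \<le> \<eta> \<Longrightarrow> \<eta> \<le> 1 \<Longrightarrow> (\<forall>i<d. \<bar>e i\<bar> \<le> \<eta>) \<Longrightarrow>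
     \<bar>(\<Prod>i<d. 1 + e i) - 1 - (\<Sum>i<d. e i)\<bar> \<le> K * \<eta>\<^sup>2"
    using prod_one_plus_expansion[of d] by blast
  let ?P = "{p. p permutes {0..<d}}"
  have fin: "finite ?P" by (simp add: finite_permutations)
  show ?thesis
  \<comment> \<open>\<open>K\<close> handles the identity. Each other permutation contributes at
    most 2^d eta^2: all factors are at most 2 in absolute value, and two of them are at most
    eta.\<close>
  proof (intro exI[of _ "K + real (card ?P) * 2 ^ d"] conjI allI impI)
    show "0 \<le> K + real (card ?P) * 2 ^ d" using K(1) by simp
    fix E :: "nat \<Rightarrow> nat \<Rightarrow> real" and \<eta> :: real
    assume \<eta>: "0 \<le> \<eta>" "\<eta> \<le> 1" and E: "\<forall>i<d. \<forall>j<d. \<bar>E i j\<bar> \<le> \<eta>"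
    define a where "a i j = (if i = j then 1 else 0) + E i j" for i j
    define T where "T p = of_int (sign p) * (\<Prod>i = 0..<d. a i (p i))" for p
    have det: "Determinant.det (Matrix.mat d d (\<lambda>(i, j). a i j)) = (\<Sum>p\<in>?P. T p)"
      unfolding T_def
      by (subst det_def'[of _ d]) (auto intro!: sum.cong prod.cong dest: permutes_in_image)
    have off: "\<bar>T p\<bar> \<le> 2 ^ d * \<eta>\<^sup>2" if p: "p \<in> ?P - {id}" for p
    proof -
      from p have perm: "p permutes {0..<d}" and "p \<noteq> id" by auto
      then obtain i0 where i0: "p i0 \<noteq> i0" by (metis eq_id_iff)
      \<comment> \<open>By injectivity of \<open>p\<close>, the image of a moved index is itself
        moved; this is the second off-diagonal factor.\<close>
      define i1 where "i1 = p i0"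
      have i0d: "i0 < d" using i0 perm by (metis atLeastLessThan_iff le0 permutes_not_in)
      have i1d: "i1 < d" using permutes_in_image[OF perm, of i0] i0d by (simp add: i1_def)
      have i1: "p i1 \<noteq> i1" using i0 perm unfolding i1_def by (metis permutes_inverses(2))
      have ne: "i0 \<noteq> i1" using i0 i1_def by auto
      have pd: "p i < d" if "i < d" for i using permutes_in_image[OF perm, of i] that by simp
      have le2: "\<bar>a i (p i)\<bar> \<le> 2" if "i < d" for i
      proof -
        have "\<bar>E i (p i)\<bar> \<le> 1" using E that pd[OF that] \<eta>(2) by fastforce
        then show ?thesis unfolding a_def by (auto simp: abs_le_iff)
      qed
      have le\<eta>: "\<bar>a i (p i)\<bar> \<le> \<eta>" if "i < d" "p i \<noteq> i" for i
        using E that pd[OF that(1)] unfolding a_def by auto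
      have "\<bar>T p\<bar> = (\<Prod>i = 0..<d. \<bar>a i (p i)\<bar>)"
        unfolding T_def by (simp add: abs_mult abs_prod sign_def)
      also have "\<dots> = (\<Prod>i\<in>{0..<d} - {i0, i1}. \<bar>a i (p i)\<bar>) * (\<Prod>i\<in>{i0, i1}. \<bar>a i (p i)\<bar>)"
        by (rule prod.subset_diff) (use i0d i1d in auto)
      also have "\<dots> \<le> (\<Prod>i\<in>{0..<d} - {i0, i1}. 2) * (\<Prod>i\<in>{i0, i1}. \<eta>)"
        by (intro mult_mono prod_mono prod_nonneg) (use le2 le\<eta> i0 i1 i0d i1d \<eta> in auto)
      also have "\<dots> = 2 ^ card ({0..<d} - {i0, i1}) * \<eta>\<^sup>2"
        using ne by (simp add: power2_eq_square)
      also have "\<dots> \<le> 2 ^ d * \<eta>\<^sup>2"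
        by (intro mult_right_mono power_increasing)
           (auto intro: order_trans[OF card_mono[of "{0..<d}"]])
      finally show ?thesis .
    qed
    have "T id = (\<Prod>i<d. 1 + E i i)"
      by (simp add: T_def a_def atLeast0LessThan)
    then have tid: "\<bar>T id - 1 - (\<Sum>i<d. E i i)\<bar> \<le> K * \<eta>\<^sup>2"
      using K(2)[of \<eta> "\<lambda>i. E i i"] \<eta> E by simp
    have "(\<Sum>p\<in>?P. T p) = T id + (\<Sum>p\<in>?P - {id}. T p)"
      by (rule sum.remove[OF fin]) (simp add: permutes_id)
    moreover have "\<bar>\<Sum>p\<in>?P - {id}. T p\<bar> \<le> real (card ?P) * (2 ^ d * \<eta>\<^sup>2)"
    proof -
      have "\<bar>\<Sum>p\<in>?P - {id}. T p\<bar> \<le> (\<Sum>p\<in>?P - {id}. 2 ^ d * \<eta>\<^sup>2)"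
        by (rule order_trans[OF sum_abs]) (intro sum_mono off)
      also have "\<dots> \<le> real (card ?P) * (2 ^ d * \<eta>\<^sup>2)"
        unfolding sum_constant by (intro mult_right_mono) (auto intro!: card_mono fin)
      finally show ?thesis .
    qed
    ultimately show "\<bar>Determinant.det (Matrix.mat d d (\<lambda>(i, j). (if i = j then 1 else 0) + E i j)) - 1 - (\<Sum>i<d. E i i)\<bar>
       \<le> (K + real (card ?P) * 2 ^ d) * \<eta>\<^sup>2"
      using tid det unfolding a_def by (simp add: algebra_simps)
  qed
qed

text \<open>With r = sqrt (1 + z) the error is exactly - (r - 1)^2 / 2, while z = (r - 1) (r + 1)
  and r + 1 \<ge> 1.\<close>

lemma sqrt_one_plus_expansion:
  fixes z :: real assumes "z \<ge> -1"
  shows "\<bar>sqrt (1 + z) - 1 - z / 2\<bar> \<le> z\<^sup>2"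
proof -
  define r where "r = sqrt (1 + z)"
  have r: "r \<ge> 0" and z: "z = (r - 1) * (r + 1)" using assms by (simp_all add: r_def algebra_simps)
  have "r - 1 - z / 2 = - ((r - 1)\<^sup>2 / 2)"
    unfolding z by (simp add: power2_eq_square field_simps)
  then have "\<bar>r - 1 - z / 2\<bar> = (r - 1)\<^sup>2 / 2" by simp
  also have "\<dots> \<le> (r - 1)\<^sup>2 * 1" by simp
  also have "\<dots> \<le> (r - 1)\<^sup>2 * (r + 1)\<^sup>2" using r by (intro mult_left_mono) (simp_all add: one_le_power)
  finally show ?thesis unfolding r_def[symmetric] by (simp add: z power_mult_distrib)
qed

text \<open>On an orthonormal basis of the plane, the Gram matrix of 1 + tau A differs from the
  identity by tau times the symmetrized form of A, up to tau^2. Its determinant has linear term 2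
  tau tr(S A), and the square root halves it. The matrix enters only through its operator bound
  \<open>c\<close>, so \<open>K\<close> and \<open>\<tau>0\<close> are uniform in \<open>A\<close>
  and \<open>S\<close>.\<close>

lemma plane_jacobian_expansion:
  assumes c: "c \<ge> 0"
  shows "\<exists>K\<ge>0. \<exists>\<tau>0>0. \<forall>(A :: real ^ 'n ^ 'n) S \<tau>. (\<forall>v. norm (A *v v) \<le> c * norm v) \<longrightarrow> S \<in> grassmannian d \<longrightarrow>
    0 \<le> \<tau> \<longrightarrow> \<tau> \<le> \<tau>0 \<longrightarrow> \<bar>plane_jacobian d (mat 1 + \<tau> *\<^sub>R A) S - 1 - \<tau> * trace (S ** A)\<bar> \<le> K * \<tau>\<^sup>2"
proof -
  obtain K where K: "K \<ge> 0" "\<And>(E :: nat \<Rightarrow> nat \<Rightarrow> real) \<eta>. 0 \<le> \<eta> \<Longrightarrow> \<eta> \<le> 1 \<Longrightarrow> (\<forall>i<d. \<forall>j<d. \<bar>E i j\<bar> \<le> \<eta>) \<Longrightarrow>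
     \<bar>Determinant.det (Matrix.mat d d (\<lambda>(i, j). (if i = j then 1 else 0) + E i j)) - 1 - (\<Sum>i<d. E i i)\<bar> \<le> K * \<eta>\<^sup>2"
    using det_one_plus_expansion[of d] by blast
  \<comment> \<open>For tau \<le> 1 the entries of the perturbation \<open>E\<close> are at most
    \<open>c' * \<tau>\<close>. With \<open>z\<close> the Gram determinant minus 1,
    \<open>K1\<close> bounds the second-order part of \<open>z\<close> and
    \<open>K2 * \<tau>\<close> bounds \<open>z\<close> itself. The choice of \<open>\<tau>0\<close>
    gives \<open>c' * \<tau> \<le> 1\<close> for the determinant expansion and
    \<open>K2 * \<tau> \<le> 1\<close>, hence z \<ge> -1, for the square root.\<close>
  define c' where "c' = 2 * c + c\<^sup>2"
  define K1 where "K1 = K * c'\<^sup>2 + real d * c\<^sup>2"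
  define K2 where "K2 = K1 + 2 * real d * c"
  have pos: "c' \<ge> 0" "K1 \<ge> 0" "K2 \<ge> 0" using c K(1) by (auto simp: c'_def K1_def K2_def)
  define \<tau>0 where "\<tau>0 = 1 / (1 + c' + K2)"
  have \<tau>0: "\<tau>0 > 0" "\<tau>0 \<le> 1" "c' * \<tau>0 \<le> 1" "K2 * \<tau>0 \<le> 1"
    using pos by (auto simp: \<tau>0_def divide_simps add_pos_nonneg)
  show ?thesis
  proof (rule exI[of _ "K1 + K2\<^sup>2"], rule conjI, use pos in simp,
      rule exI[of _ \<tau>0], intro conjI allI impI, rule \<tau>0(1))
    fix A S :: "real ^ 'n ^ 'n" and \<tau> :: real
    assume A: "\<forall>v. norm (A *v v) \<le> c * norm v" and S: "S \<in> grassmannian d" and \<tau>: "0 \<le> \<tau>" "\<tau> \<le> \<tau>0"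
    define s where "s = (SOME s. orthonormal_basis_of d (subspace_of S) s)"
    have s: "orthonormal_basis_of d (subspace_of S) s"
      unfolding s_def by (rule some_orthonormal_basis[OF S])
    have s1: "norm (s i) = 1" if "i < d" for i
      using orthonormal_basis_ofD(1)[OF s that that] by (simp add: norm_eq_1)
    have As: "norm (A *v s i) \<le> c" if "i < d" for i using A[rule_format, of "s i"] s1[OF that] by simp
    define E where "E i j = \<tau> * ((A *v s i) \<bullet> s j + s i \<bullet> (A *v s j)) + \<tau>\<^sup>2 * ((A *v s i) \<bullet> (A *v s j))" for i j
    have b1: "\<bar>(A *v s i) \<bullet> s j\<bar> \<le> c" if "i < d" "j < d" for i j
      using Cauchy_Schwarz_ineq2[of "A *v s i" "s j"] As[OF that(1)] s1[OF that(2)] by simp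
    have b2: "\<bar>(A *v s i) \<bullet> (A *v s j)\<bar> \<le> c\<^sup>2" if "i < d" "j < d" for i j
      using order_trans[OF Cauchy_Schwarz_ineq2 mult_mono[OF As[OF that(1)] As[OF that(2)]]] c
      by (simp add: power2_eq_square)
    have \<tau>2: "\<tau>\<^sup>2 \<le> \<tau>" using \<tau> \<tau>0(2) by (simp add: power2_eq_square mult_left_le)
    have El: "\<bar>E i j\<bar> \<le> c' * \<tau>" if "i < d" "j < d" for i j
    proof -
      have "\<bar>E i j\<bar> \<le> \<bar>\<tau> * ((A *v s i) \<bullet> s j + s i \<bullet> (A *v s j))\<bar> + \<bar>\<tau>\<^sup>2 * ((A *v s i) \<bullet> (A *v s j))\<bar>"
        unfolding E_def by (rule abs_triangle_ineq)
      also have "\<dots> = \<tau> * \<bar>(A *v s i) \<bullet> s j + s i \<bullet> (A *v s j)\<bar> + \<tau>\<^sup>2 * \<bar>(A *v s i) \<bullet> (A *v s j)\<bar>"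
        using \<tau> by (simp add: abs_mult)
      also have "\<dots> \<le> \<tau> * (c + c) + \<tau> * c\<^sup>2"
      proof (intro add_mono mult_mono \<tau>2 b2 that \<tau>)
        show "\<bar>(A *v s i) \<bullet> s j + s i \<bullet> (A *v s j)\<bar> \<le> c + c"
          using b1[OF that] b1[OF that(2) that(1)]
          by (intro order_trans[OF abs_triangle_ineq]) (simp add: inner_commute)
      qed auto
      finally show ?thesis by (simp add: c'_def algebra_simps)
    qed
    let ?L = "mat 1 + \<tau> *\<^sub>R A"
    have Lv: "?L *v v = v + \<tau> *\<^sub>R (A *v v)" for v
      by (simp add: matrix_vector_mult_add_rdistrib scaleR_matrix_vector_assoc)
    have "gram_det d (\<lambda>i. ?L *v s i) = Determinant.det (Matrix.mat d d (\<lambda>(i, j). (if i = j then 1 else 0) + E i j))"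
      unfolding gram_det_def Lv
      by (intro arg_cong[where f = Determinant.det] eq_matI)
         (auto simp: E_def inner_add_left inner_add_right orthonormal_basis_ofD(1)[OF s] power2_eq_square algebra_simps)
    moreover have "\<bar>Determinant.det (Matrix.mat d d (\<lambda>(i, j). (if i = j then 1 else 0) + E i j)) - 1 - (\<Sum>i<d. E i i)\<bar> \<le> K * (c' * \<tau>)\<^sup>2"
      using El \<tau> pos \<tau>0(3) by (intro K(2)) (auto intro: order_trans[OF mult_left_mono])
    ultimately have g: "\<bar>gram_det d (\<lambda>i. ?L *v s i) - 1 - (\<Sum>i<d. E i i)\<bar> \<le> K * (c' * \<tau>)\<^sup>2" by simp
    let ?t = "trace (S ** A)"
    have t: "?t = (\<Sum>i<d. s i \<bullet> (A *v s i))"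
      by (rule trace_is_proj_mult[OF grassmannianD(1)[OF S] s])
    have tb: "\<bar>?t\<bar> \<le> real d * c"
      unfolding t using sum_norm_bound[of "{..<d}" "\<lambda>i. s i \<bullet> (A *v s i)" c] b1 by (simp add: inner_commute)
    have "(\<Sum>i<d. E i i) - 2 * \<tau> * ?t = \<tau>\<^sup>2 * (\<Sum>i<d. (A *v s i) \<bullet> (A *v s i))"
      unfolding t E_def by (simp add: sum.distrib sum_distrib_left inner_commute algebra_simps)
    moreover have "\<bar>\<Sum>i<d. (A *v s i) \<bullet> (A *v s i)\<bar> \<le> real d * c\<^sup>2"
    proof -
      have "\<bar>\<Sum>i<d. (A *v s i) \<bullet> (A *v s i)\<bar> \<le> (\<Sum>i<d. c\<^sup>2)"
        by (rule order_trans[OF sum_abs], rule sum_mono, rule b2) auto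
      then show ?thesis by simp
    qed
    ultimately have e: "\<bar>(\<Sum>i<d. E i i) - 2 * \<tau> * ?t\<bar> \<le> real d * c\<^sup>2 * \<tau>\<^sup>2"
      by (simp add: abs_mult mult.commute mult_left_mono)
    define z where "z = gram_det d (\<lambda>i. ?L *v s i) - 1"
    have z1: "\<bar>z - 2 * \<tau> * ?t\<bar> \<le> K1 * \<tau>\<^sup>2"
      using g e unfolding z_def K1_def by (simp add: power_mult_distrib algebra_simps)
    have "\<bar>2 * \<tau> * ?t\<bar> = 2 * \<tau> * \<bar>?t\<bar>" using \<tau> by (simp add: abs_mult)
    then have "\<bar>z\<bar> \<le> K1 * \<tau>\<^sup>2 + 2 * \<tau> * \<bar>?t\<bar>"
      using z1 by linarith
    also have "\<dots> \<le> K1 * \<tau> + 2 * \<tau> * (real d * c)"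
      using \<tau>2 tb pos \<tau> by (intro add_mono mult_left_mono) auto
    finally have z2: "\<bar>z\<bar> \<le> K2 * \<tau>" by (simp add: K2_def algebra_simps)
    also have "K2 * \<tau> \<le> 1" using \<tau> \<tau>0(4) pos by (meson mult_left_mono order_trans)
    finally have "z \<ge> -1" by simp
    from sqrt_one_plus_expansion[OF this]
    have "\<bar>sqrt (1 + z) - 1 - z / 2\<bar> \<le> z\<^sup>2" .
    also have "z\<^sup>2 \<le> K2\<^sup>2 * \<tau>\<^sup>2"
      using power_mono[OF z2, of 2] by (simp add: power_mult_distrib)
    finally have "\<bar>sqrt (1 + z) - 1 - \<tau> * ?t\<bar> \<le> K2\<^sup>2 * \<tau>\<^sup>2 + K1 * \<tau>\<^sup>2 / 2"
      using z1 by linarith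
    also have "\<dots> \<le> (K1 + K2\<^sup>2) * \<tau>\<^sup>2" using pos by (simp add: algebra_simps)
    finally show "\<bar>plane_jacobian d ?L S - 1 - \<tau> * ?t\<bar> \<le> (K1 + K2\<^sup>2) * \<tau>\<^sup>2"
      unfolding plane_jacobian_def s_def[symmetric] z_def by simp
  qed
qed

section \<open>Push-forward of varifolds with bounded mass and support\<close>

text \<open>The image plane jumps where the linear map degenerates on the plane, so continuity is
  claimed only on maps with a common lower bound.\<close>

lemma continuous_on_image_plane:
  assumes k: "k \<ge> 0"
  shows "continuous_on ({L :: real ^ 'n ^ 'n. \<forall>u. norm u \<le> k * norm (L *v u)} \<times> grassmannian d) (\<lambda>(L, S). image_plane L S)"
  unfolding continuous_on_def
proof
  let ?A = "{L :: real ^ 'n ^ 'n. \<forall>u. norm u \<le> k * norm (L *v u)} \<times> (grassmannian d :: (real ^ 'n ^ 'n) set)"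
  fix p0 assume p0: "p0 \<in> ?A"
  let ?c = "real CARD('n) * real CARD('n) * (2 * k)"
  let ?h = "\<lambda>p. (\<lambda>(L, S). image_plane L S) p"
  have bound: "norm (?h p - ?h p0) \<le> ?c * norm (fst p ** snd p - fst p0 ** snd p0)" if "p \<in> ?A" for p
  proof -
    have "norm (image_plane (fst p) (snd p) - image_plane (fst p0) (snd p0)) \<le>
        real CARD('n) * real CARD('n) * (2 * k * norm (fst p ** snd p - fst p0 ** snd p0))"
      by (rule image_plane_diff)
         (use that p0 k grassmannianD(1) norm_matrix_vector_mult_le in
          \<open>auto simp: matrix_vector_mult_diff_rdistrib[symmetric]\<close>)
    then show ?thesis by (simp add: split_beta mult_ac)
  qed
  have "((\<lambda>p. ?c * norm (fst p ** snd p - fst p0 ** snd p0)) \<longlongrightarrow> ?c * norm (fst p0 ** snd p0 - fst p0 ** snd p0)) (at p0 within ?A)"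
    unfolding matrix_matrix_mult_def by (intro tendsto_intros)
  then have lim: "((\<lambda>p. ?c * norm (fst p ** snd p - fst p0 ** snd p0)) \<longlongrightarrow> 0) (at p0 within ?A)" by simp
  have "\<forall>\<^sub>F p in at p0 within ?A. p \<in> ?A" by (auto simp: eventually_at_filter)
  then have "\<forall>\<^sub>F p in at p0 within ?A. norm (?h p - ?h p0) \<le> ?c * norm (fst p ** snd p - fst p0 ** snd p0)"
    by eventually_elim (rule bound)
  from Lim_null_comparison[OF this lim] show "(?h \<longlongrightarrow> ?h p0) (at p0 within ?A)"
    by (simp add: Lim_null[symmetric])
qed

text \<open>The support condition is stated almost everywhere, a form that passes easily through
  densities, images and weak limits. The radius and the mass bound are explicit parameters because
  uniformity in them is what later limits rest on.\<close>

definition bounded_varifold :: "nat \<Rightarrow> real \<Rightarrow> real \<Rightarrow> ((real ^ 'n) \<times> (real ^ 'n ^ 'n)) measure \<Rightarrow> bool" where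
  "bounded_varifold d R m V \<longleftrightarrow> sets V = sets (grassmann_borel d) \<and>
     emeasure V (space V) \<le> ennreal m \<and> (AE p in V. norm (fst p) \<le> R)"

lemma space_grassmann_borel: "space (grassmann_borel d) = UNIV \<times> grassmannian d"
  by (simp add: space_restrict_space)

lemma bounded_varifold_sets: "bounded_varifold d R m V \<Longrightarrow> sets V = sets (grassmann_borel d)"
  by (simp add: bounded_varifold_def)

lemma bounded_varifold_space: "bounded_varifold d R m V \<Longrightarrow> space V = UNIV \<times> grassmannian d"
  using sets_eq_imp_space_eq[OF bounded_varifold_sets] space_grassmann_borel by metis

lemma bounded_varifold_finite: "bounded_varifold d R m V \<Longrightarrow> finite_measure V"
  by (rule finite_measureI) (auto simp: bounded_varifold_def top_unique)

lemma bounded_varifold_measure: 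
  assumes "bounded_varifold d R m V" "m \<ge> 0"
  shows "measure V (space V) \<le> m"
  using assms unfolding bounded_varifold_def measure_def by (simp add: enn2real_leI)

lemma bounded_varifold_AE:
  assumes "bounded_varifold d R m V"
  shows "AE (x, S) in V. norm x \<le> R \<and> S \<in> grassmannian d"
proof -
  have "AE p in V. p \<in> space V" by (rule AE_space)
  moreover have "AE p in V. norm (fst p) \<le> R" using assms by (simp add: bounded_varifold_def)
  ultimately show ?thesis
    by eventually_elim (auto simp: bounded_varifold_space[OF assms])
qed

lemma bounded_varifold_mono:
  assumes "bounded_varifold d R m V" "R \<le> R'" "m \<le> m'"
  shows "bounded_varifold d R' m' V"
  using assms unfolding bounded_varifold_def
  by (auto elim!: eventually_mono intro: order_trans ennreal_leI)

lemma borel_measurable_continuous_on_bundle: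
  assumes "sets V = sets (grassmann_borel d)" "continuous_on (grassmann_bundle d) g"
  shows "g \<in> borel_measurable V"
  using borel_measurable_continuous_on_restrict[OF assms(2)] measurable_cong_sets[OF assms(1) refl] by blast

lemma bounded_varifold_integrable:
  fixes g :: "_ \<Rightarrow> 'b::{banach, second_countable_topology}"
  assumes V: "bounded_varifold d R m V" and g: "g \<in> borel_measurable V"
    and C: "\<And>x S. norm x \<le> R \<Longrightarrow> S \<in> grassmannian d \<Longrightarrow> norm (g (x, S)) \<le> C"
  shows "integrable V g"
  by (rule finite_measure.integrable_const_bound[OF bounded_varifold_finite[OF V] _ g, of C])
     (use bounded_varifold_AE[OF V] in \<open>eventually_elim, auto intro: C\<close>)

lemma bounded_varifold_integral_le:
  fixes g :: "_ \<Rightarrow> 'b::{banach, second_countable_topology}"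
  assumes V: "bounded_varifold d R m V" and m: "m \<ge> 0"
    and C: "\<And>x S. norm x \<le> R \<Longrightarrow> S \<in> grassmannian d \<Longrightarrow> norm (g (x, S)) \<le> C" "C \<ge> 0"
  shows "norm (\<integral>p. g p \<partial>V) \<le> C * m"
proof (cases "integrable V g")
  case True
  have "norm (\<integral>p. g p \<partial>V) \<le> (\<integral>p. norm (g p) \<partial>V)" by (rule integral_norm_bound)
  also have "\<dots> \<le> (\<integral>p. C \<partial>V)"
  proof (rule integral_mono_AE)
    show "integrable V (\<lambda>p. norm (g p))" using True by simp
    show "integrable V (\<lambda>p. C)" using bounded_varifold_finite[OF V] by (simp add: finite_measure.integrable_const)
    show "AE p in V. norm (g p) \<le> C" using bounded_varifold_AE[OF V] by eventually_elim (auto intro: C)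
  qed
  also have "\<dots> = C * measure V (space V)" by (simp add: mult.commute)
  also have "\<dots> \<le> C * m" using bounded_varifold_measure[OF V m] C(2) by (rule mult_left_mono)
  finally show ?thesis .
next
  \<comment> \<open>A function that is not integrable has integral 0 by convention, and 0 satisfies
    the bound.\<close>
  case False
  then show ?thesis using m C(2) by (simp add: not_integrable_integral_eq)
qed

lemma continuous_on_bundle_bounded:
  fixes g :: "(real ^ 'n) \<times> (real ^ 'n ^ 'n) \<Rightarrow> 'b::real_normed_vector"
  assumes "continuous_on (grassmann_bundle d) g"
  shows "\<exists>C\<ge>0. \<forall>x S. norm x \<le> R \<longrightarrow> S \<in> grassmannian d \<longrightarrow> norm (g (x, S)) \<le> C"
proof -
  have "compact (g ` (cball 0 R \<times> grassmannian d))"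
    by (intro compact_continuous_image continuous_on_subset[OF assms] compact_Times compact_cball compact_grassmannian) auto
  then obtain C where C: "\<forall>y\<in>g ` (cball 0 R \<times> grassmannian d). norm y \<le> C"
    using compact_imp_bounded bounded_iff by metis
  then have "norm (g (x, S)) \<le> max C 0" if "norm x \<le> R" "S \<in> grassmannian d" for x S
    using that by (intro max.coboundedI1) auto
  then show ?thesis by (intro exI[of _ "max C 0"]) auto
qed

lemma bounded_varifold_integrable_continuous:
  fixes g :: "_ \<Rightarrow> 'b::{banach, second_countable_topology}"
  assumes V: "bounded_varifold d R m V" and g: "continuous_on (grassmann_bundle d) g"
  shows "integrable V g"
proof -
  obtain C where "\<forall>x S. norm x \<le> R \<longrightarrow> S \<in> grassmannian d \<longrightarrow> norm (g (x, S)) \<le> C"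
    using continuous_on_bundle_bounded[OF g, of R] by blast
  then show ?thesis
    by (intro bounded_varifold_integrable[OF V borel_measurable_continuous_on_bundle[OF bounded_varifold_sets[OF V] g], of C]) auto
qed

lemma integral_mass:
  fixes g :: "real ^ 'n \<Rightarrow> 'b::{banach, second_countable_topology}"
  assumes V: "sets V = sets (grassmann_borel d)" and g: "g \<in> borel_measurable borel"
  shows "(\<integral>x. g x \<partial>mass V) = (\<integral>(x, S). g x \<partial>V)"
proof -
  have "continuous_on (grassmann_bundle d) (fst :: (real ^ 'n) \<times> (real ^ 'n ^ 'n) \<Rightarrow> _)" by (intro continuous_intros)
  from borel_measurable_continuous_on_bundle[OF V this] have "fst \<in> borel_measurable V" .
  from integral_distr[OF this g] show ?thesis unfolding mass_def by (simp add: split_beta')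
qed

text \<open>The properties of a step map that turn the formal push-forward into its integral
  formula. Continuity gives measurability, and the lower bound keeps image planes in the
  Grassmannian. The density has to be nonnegative because \<open>ennreal\<close> sends negative
  reals to 0 and \<open>sqrt\<close> is negative at negative arguments.\<close>

locale plane_map =
  fixes d :: nat and f :: "real ^ 'n \<Rightarrow> real ^ 'n" and L :: "real ^ 'n \<Rightarrow> real ^ 'n ^ 'n" and k :: real
  assumes jac: "\<And>x. jacobian f (at x) = L x" and cont_f: "continuous_on UNIV f" and cont_L: "continuous_on UNIV L"
    and k: "k \<ge> 0" and lower: "\<And>x u. norm u \<le> k * norm (L x *v u)"
    and J_nonneg: "\<And>x S. S \<in> grassmannian d \<Longrightarrow> 0 \<le> plane_jacobian d (L x) S"
begin

abbreviation "lift \<equiv> (\<lambda>(x, S). (f x, image_plane (L x) S))"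
abbreviation "J \<equiv> (\<lambda>(x, S). plane_jacobian d (L x) S)"

lemma continuous_on_lift: "continuous_on (grassmann_bundle d) lift"
proof -
  have "continuous_on (grassmann_bundle d) (\<lambda>p. (\<lambda>(L, S). image_plane L S) (L (fst p), snd p))"
    by (rule continuous_on_compose2[OF continuous_on_image_plane[OF k, of d]])
       (auto intro!: continuous_intros continuous_on_compose2[OF cont_L] lower)
  then show ?thesis
    unfolding split_beta by (intro continuous_intros continuous_on_compose2[OF cont_f]) auto
qed

lemma continuous_on_J: "continuous_on (grassmann_bundle d) J"
proof -
  have "continuous_on (grassmann_bundle d) (\<lambda>p. (\<lambda>(L, S). plane_jacobian d L S) (L (fst p), snd p))"
    by (rule continuous_on_compose2[OF continuous_on_plane_jacobian[of d]])
       (auto intro!: continuous_intros continuous_on_compose2[OF cont_L])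
  then show ?thesis unfolding split_beta by simp
qed

lemma lift_grassmannian: "S \<in> grassmannian d \<Longrightarrow> image_plane (L x) S \<in> grassmannian d"
  by (rule image_plane_grassmannian[OF lower])

lemma push_forward_eq:
  "push_forward d f V = distr (density V (\<lambda>p. ennreal (J p))) (grassmann_borel d) lift"
  unfolding push_forward_def tangential_jacobian_eq jac image_plane_def by (simp add: split_beta')

lemma lift_measurable:
  assumes V: "sets V = sets (grassmann_borel d)"
  shows "lift \<in> measurable V (grassmann_borel d)"
proof (rule measurable_restrict_space2)
  have "space V = UNIV \<times> grassmannian d"
    using sets_eq_imp_space_eq[OF V] space_grassmann_borel by metis
  then show "lift \<in> space V \<rightarrow> UNIV \<times> grassmannian d" using lift_grassmannian by auto
  show "lift \<in> borel_measurable V" by (rule borel_measurable_continuous_on_bundle[OF V continuous_on_lift])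
qed

lemma J_measurable: "sets V = sets (grassmann_borel d) \<Longrightarrow> J \<in> borel_measurable V"
  by (rule borel_measurable_continuous_on_bundle[OF _ continuous_on_J])

lemma J_AE_nonneg: "sets V = sets (grassmann_borel d) \<Longrightarrow> AE p in V. 0 \<le> J p"
  by (rule AE_I2) (use sets_eq_imp_space_eq[of V "grassmann_borel d"] space_grassmann_borel[of d] J_nonneg in \<open>auto simp: space_grassmann_borel\<close>)

lemma sets_push_forward: "sets (push_forward d f V) = sets (grassmann_borel d)"
  by (simp add: push_forward_eq)

lemma integral_push_forward:
  fixes q :: "_ \<Rightarrow> 'b::{banach, second_countable_topology}"
  assumes V: "sets V = sets (grassmann_borel d)" and q: "q \<in> borel_measurable (grassmann_borel d)"
  shows "(\<integral>p. q p \<partial>push_forward d f V) = (\<integral>p. J p *\<^sub>R q (lift p) \<partial>V)"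
proof -
  have lm: "lift \<in> measurable V (grassmann_borel d)" by (rule lift_measurable[OF V])
  have "(\<integral>p. q p \<partial>push_forward d f V) = (\<integral>p. q (lift p) \<partial>density V (\<lambda>p. ennreal (J p)))"
    unfolding push_forward_eq by (rule integral_distr) (use lm q in auto)
  also have "\<dots> = (\<integral>p. J p *\<^sub>R q (lift p) \<partial>V)"
    by (rule integral_density[OF measurable_compose[OF lm q] J_measurable[OF V] J_AE_nonneg[OF V]])
  finally show ?thesis .
qed

lemma bounded_varifold_push_forward:
  assumes V: "bounded_varifold d R m V"
    and R': "\<And>x. norm x \<le> R \<Longrightarrow> norm (f x) \<le> R'" and m': "(\<integral>p. J p \<partial>V) \<le> m'"
  shows "bounded_varifold d R' m' (push_forward d f V)"
  unfolding bounded_varifold_def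
proof (intro conjI sets_push_forward)
  note sV = bounded_varifold_sets[OF V]
  note lm = lift_measurable[OF sV]
  have "emeasure (push_forward d f V) (space (push_forward d f V)) = emeasure (density V (\<lambda>p. ennreal (J p))) (lift -` space (grassmann_borel d) \<inter> space V)"
    unfolding push_forward_eq by (subst emeasure_distr) (use lm in \<open>auto\<close>)
  also have "lift -` space (grassmann_borel d) \<inter> space V = space V"
    using measurable_space[OF lm] by blast
  also have "emeasure (density V (\<lambda>p. ennreal (J p))) (space V) = (\<integral>\<^sup>+p. ennreal (J p) \<partial>V)"
    using J_measurable[OF sV] by (subst emeasure_density) (auto intro!: nn_integral_cong)
  also have "\<dots> = ennreal (\<integral>p. J p \<partial>V)"
    by (rule nn_integral_eq_integral[OF bounded_varifold_integrable_continuous[OF V continuous_on_J] J_AE_nonneg[OF sV]])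
  also have "\<dots> \<le> ennreal m'" by (rule ennreal_leI[OF m'])
  finally show "emeasure (push_forward d f V) (space (push_forward d f V)) \<le> ennreal m'" .
  have "AE p in V. norm (fst (lift p)) \<le> R'"
    using bounded_varifold_AE[OF V] by eventually_elim (auto intro: R')
  then have "AE p in density V (\<lambda>p. ennreal (J p)). norm (fst (lift p)) \<le> R'"
    by (subst AE_density) (use J_measurable[OF sV] in auto)
  moreover have "Measurable.pred (grassmann_borel d) (\<lambda>p :: (real ^ 'n) \<times> (real ^ 'n ^ 'n). norm (fst p) \<le> R')"
  proof -
    have "fst \<in> borel_measurable (grassmann_borel d :: ((real ^ 'n) \<times> (real ^ 'n ^ 'n)) measure)"
      by (rule borel_measurable_continuous_on_bundle[OF refl]) (intro continuous_intros)
    then show ?thesis by measurable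
  qed
  ultimately show "AE p in push_forward d f V. norm (fst p) \<le> R'"
    unfolding push_forward_eq by (subst AE_distr_iff) (use lm in \<open>auto simp: pred_def\<close>)
qed

end

section \<open>The mollifier\<close>

lemma grad_eqI:
  assumes "(f has_derivative (\<lambda>v. v \<bullet> D)) (at x)" shows "grad f x = D"
  unfolding grad_def
proof (rule the_equality)
  show "GDERIV f x :> D" using assms by (simp add: gderiv_def)
  fix D' assume "GDERIV f x :> D'"
  then have "(\<lambda>v. v \<bullet> D') = (\<lambda>v. v \<bullet> D)"
    unfolding gderiv_def using assms has_derivative_unique by blast
  then show "D' = D" by (metis vector_eq_ldot)
qed

lemma linear_eq_inner_axis:
  fixes f :: "real ^ 'n \<Rightarrow> real"
  assumes "linear f" shows "f v = v \<bullet> (\<Sum>i\<in>UNIV. f (axis i 1) *\<^sub>R axis i 1)"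
proof -
  have "f v = f (\<Sum>i\<in>UNIV. v $ i *\<^sub>R axis i 1)"
    by (simp add: basis_expansion scalar_mult_eq_scaleR[symmetric])
  also have "\<dots> = (\<Sum>i\<in>UNIV. v $ i * f (axis i 1))"
    by (simp add: linear_sum[OF assms] linear_scale[OF assms])
  finally show ?thesis by (simp add: inner_sum_right inner_axis mult.commute)
qed

lemma has_derivative_grad:
  fixes f :: "real ^ 'n \<Rightarrow> real"
  assumes "(f has_derivative f') (at x)"
  shows "(f has_derivative (\<lambda>v. v \<bullet> grad f x)) (at x)" "grad f x = (\<Sum>i\<in>UNIV. f' (axis i 1) *\<^sub>R axis i 1)"
proof -
  have lin: "linear f'" by (rule has_derivative_linear[OF assms])
  have d: "(f has_derivative (\<lambda>v. v \<bullet> (\<Sum>i\<in>UNIV. f' (axis i 1) *\<^sub>R axis i 1))) (at x)"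
    by (rule has_derivative_eq_rhs[OF assms]) (rule ext, rule linear_eq_inner_axis[OF lin])
  show 2: "grad f x = (\<Sum>i\<in>UNIV. f' (axis i 1) *\<^sub>R axis i 1)" by (rule grad_eqI[OF d])
  show "(f has_derivative (\<lambda>v. v \<bullet> grad f x)) (at x)" unfolding 2 by (rule d)
qed

lemma smooth_grad:
  fixes f :: "real ^ 'n \<Rightarrow> real"
  assumes "smooth f"
  shows "(f has_derivative (\<lambda>v. v \<bullet> grad f x)) (at x)" "continuous_on UNIV (grad f)"
proof -
  have s: "k_times_cont_diff (Suc 0) f" using assms unfolding smooth_def by blast
  then have d: "(f has_derivative frechet_derivative f (at x)) (at x)" for x
    by (intro frechet_derivative_works[THEN iffD1]) simp
  show "(f has_derivative (\<lambda>v. v \<bullet> grad f x)) (at x)" by (rule has_derivative_grad[OF d])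
  have "grad f = (\<lambda>x. \<Sum>i\<in>UNIV. frechet_derivative f (at x) (axis i 1) *\<^sub>R axis i 1)"
    using has_derivative_grad(2)[OF d] by auto
  then show "continuous_on UNIV (grad f)"
    using s by (auto intro!: continuous_intros)
qed

text \<open>If two points are closer than 1 and one of them lies in the ball, both lie in the ball
  enlarged by 1, which is compact; otherwise both values are 0.\<close>

lemma uniformly_continuous_compact_support:
  fixes g :: "'a::heine_borel \<Rightarrow> 'b::real_normed_vector"
  assumes g: "continuous_on UNIV g" and z: "\<And>x. x \<notin> cball a r \<Longrightarrow> g x = 0"
  shows "uniformly_continuous_on UNIV g"
  unfolding uniformly_continuous_on_def
proof (intro allI impI)
  fix e :: real assume "e > 0"
  have "uniformly_continuous_on (cball a (r + 1)) g"
    by (rule compact_uniformly_continuous[OF continuous_on_subset[OF g]]) auto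
  then obtain \<delta> where \<delta>: "\<delta> > 0" "\<And>x y. x \<in> cball a (r + 1) \<Longrightarrow> y \<in> cball a (r + 1) \<Longrightarrow> dist y x < \<delta> \<Longrightarrow> dist (g y) (g x) < e"
    using \<open>e > 0\<close> by (rule uniformly_continuous_onE) blast
  show "\<exists>\<delta>>0. \<forall>x\<in>UNIV. \<forall>y\<in>UNIV. dist y x < \<delta> \<longrightarrow> dist (g y) (g x) < e"
  proof (intro exI[of _ "min \<delta> 1"] conjI ballI impI)
    fix x y :: 'a assume xy: "dist y x < min \<delta> 1"
    show "dist (g y) (g x) < e"
    proof (cases "x \<in> cball a r \<or> y \<in> cball a r")
      case True
      moreover have "dist a x \<le> dist a y + dist y x" "dist a y \<le> dist a x + dist y x" "dist y x < 1"
        using xy dist_triangle[of a x y] dist_triangle[of a y x] by (simp_all add: dist_commute)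
      ultimately have "x \<in> cball a (r + 1)" "y \<in> cball a (r + 1)"
        unfolding mem_cball by linarith+
      then show ?thesis using \<delta>(2) xy by simp
    next
      case False then show ?thesis using z \<open>e > 0\<close> by simp
    qed
  qed (use \<delta>(1) in auto)
qed

lemma bounded_compact_support:
  fixes g :: "'a::heine_borel \<Rightarrow> 'b::real_normed_vector"
  assumes g: "continuous_on UNIV g" and z: "\<And>x. x \<notin> cball a r \<Longrightarrow> g x = 0"
  shows "\<exists>C\<ge>0. \<forall>x. norm (g x) \<le> C"
proof -
  have "compact (g ` cball a r)"
    by (intro compact_continuous_image continuous_on_subset[OF g]) auto
  then obtain C where C: "\<forall>y\<in>g ` cball a r. norm y \<le> C"
    using compact_imp_bounded bounded_iff by metis
  have "norm (g x) \<le> max C 0" for x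
  proof (cases "x \<in> cball a r")
    case True
    then have "norm (g x) \<le> C" using C by blast
    then show ?thesis by simp
  next
    case False
    then show ?thesis using z by simp
  qed
  then show ?thesis by (intro exI[of _ "max C 0"]) auto
qed

locale mcf_kernel =
  fixes \<psi> :: "real ^ 'n \<Rightarrow> real" and \<epsilon> :: real
  assumes kernel: "kernel_profile \<psi>" and eps: "0 < \<epsilon>"
begin

abbreviation "\<Phi> \<equiv> mollifier \<psi> \<epsilon>"
abbreviation "G \<equiv> grad (mollifier \<psi> \<epsilon>)"

lemma mollifier_grad:
  "(\<Phi> has_derivative (\<lambda>v. v \<bullet> G x)) (at x)" "continuous_on UNIV G"
proof -
  define C where "C = (1 / (\<integral>y. truncated_gaussian \<psi> \<epsilon> y \<partial>lborel)) * (2 * pi * \<epsilon>\<^sup>2) powr (- (real CARD('n) / 2))"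
  define c where "c = - (1 / (2 * \<epsilon>\<^sup>2))"
  have \<Phi>: "\<Phi> = (\<lambda>x. C * (\<psi> x * exp (c * (x \<bullet> x))))"
    unfolding mollifier_def truncated_gaussian_def C_def c_def by (auto simp: power2_norm_eq_inner)
  define g where "g x = C *\<^sub>R (exp (c * (x \<bullet> x)) *\<^sub>R (grad \<psi> x + (2 * c * \<psi> x) *\<^sub>R x))" for x
  have sm: "smooth \<psi>" using kernel unfolding kernel_profile_def by blast
  note d\<psi> = smooth_grad[OF sm]
  have d: "(\<Phi> has_derivative (\<lambda>v. v \<bullet> g x)) (at x)" for x
    unfolding \<Phi>
  proof (rule has_derivative_eq_rhs[OF has_derivative_mult_right[OF has_derivative_mult[OF d\<psi>(1)]]])
    have "((\<lambda>x :: real ^ 'n. c * (x \<bullet> x)) has_derivative (\<lambda>v. c * (x \<bullet> v + v \<bullet> x))) (at x)"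
      by (rule has_derivative_mult_right[OF has_derivative_inner[OF has_derivative_ident has_derivative_ident]])
    from DERIV_compose_FDERIV[OF DERIV_exp this]
    show "((\<lambda>x. exp (c * (x \<bullet> x))) has_derivative (\<lambda>v. c * (x \<bullet> v + v \<bullet> x) * exp (c * (x \<bullet> x)))) (at x)" .
    show "(\<lambda>v. C * (\<psi> x * (c * (x \<bullet> v + v \<bullet> x) * exp (c * (x \<bullet> x))) + v \<bullet> grad \<psi> x * exp (c * (x \<bullet> x)))) = (\<lambda>v. v \<bullet> g x)"
    proof (rule ext)
      fix v
      have 1: "x \<bullet> v = v \<bullet> x" by (rule inner_commute)
      show "C * (\<psi> x * (c * (x \<bullet> v + v \<bullet> x) * exp (c * (x \<bullet> x))) + v \<bullet> grad \<psi> x * exp (c * (x \<bullet> x))) = v \<bullet> g x"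
        unfolding g_def 1 by (simp add: inner_add_right algebra_simps)
    qed
  qed
  have eq: "G = g" by (rule ext, rule grad_eqI[OF d])
  show "(\<Phi> has_derivative (\<lambda>v. v \<bullet> G x)) (at x)" unfolding eq by (rule d)
  have "continuous_on UNIV \<psi>"
    by (intro continuous_at_imp_continuous_on ballI has_derivative_continuous[OF d\<psi>(1)])
  then show "continuous_on UNIV G"
    unfolding eq g_def by (intro continuous_intros d\<psi>(2))
qed

lemma mollifier_continuous: "continuous_on UNIV \<Phi>"
  by (intro continuous_at_imp_continuous_on ballI has_derivative_continuous[OF mollifier_grad(1)])

lemma mollifier_nonneg: "0 \<le> \<Phi> x"
proof -
  have "0 \<le> \<psi> y" for y using kernel unfolding kernel_profile_def by blast
  then have tg: "0 \<le> truncated_gaussian \<psi> \<epsilon> y" for y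
    unfolding truncated_gaussian_def by (intro mult_nonneg_nonneg powr_ge_zero exp_ge_zero)
  show ?thesis
    unfolding mollifier_def
    by (intro mult_nonneg_nonneg divide_nonneg_nonneg tg Bochner_Integration.integral_nonneg) simp
qed

lemma mollifier_support: "x \<notin> cball 0 1 \<Longrightarrow> \<Phi> x = 0"
proof -
  assume "x \<notin> cball 0 1"
  then have "\<psi> x = 0" using kernel unfolding kernel_profile_def by (metis linorder_not_le mem_cball_0 order_less_imp_le)
  then show ?thesis by (simp add: mollifier_def truncated_gaussian_def)
qed

lemma mollifier_grad_support: assumes x: "x \<notin> cball 0 1" shows "G x = 0"
proof (rule grad_eqI)
  have "((\<lambda>_. 0) has_derivative (\<lambda>v. v \<bullet> 0)) (at x)" by simp
  then show "(\<Phi> has_derivative (\<lambda>v. v \<bullet> 0)) (at x)"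
    by (rule has_derivative_transform_within_open[where s = "- cball 0 1"])
       (use x mollifier_support in auto)
qed

lemma mollifier_grad_uniform: "uniformly_continuous_on UNIV G"
  by (rule uniformly_continuous_compact_support[OF mollifier_grad(2) mollifier_grad_support])

lemma mollifier_uniform: "uniformly_continuous_on UNIV \<Phi>"
  by (rule uniformly_continuous_compact_support[OF mollifier_continuous mollifier_support])

text \<open>A common bound for the kernel and its gradient. It is determined by the kernel alone and
  not by any varifold, which makes all estimates for a step uniform.\<close>

definition "\<kappa> = (SOME C. C \<ge> 0 \<and> (\<forall>x. norm (\<Phi> x) \<le> C) \<and> (\<forall>x. norm (G x) \<le> C))"

lemma \<kappa>: "\<kappa> \<ge> 0" "\<bar>\<Phi> x\<bar> \<le> \<kappa>" "norm (G x) \<le> \<kappa>"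
proof -
  obtain C1 C2 where "C1 \<ge> 0" "C2 \<ge> 0" "\<forall>x. norm (\<Phi> x) \<le> C1" "\<forall>x. norm (G x) \<le> C2"
    using bounded_compact_support[OF mollifier_continuous mollifier_support]
      bounded_compact_support[OF mollifier_grad(2) mollifier_grad_support] by metis
  then have "\<exists>C. C \<ge> 0 \<and> (\<forall>x. norm (\<Phi> x) \<le> C) \<and> (\<forall>x. norm (G x) \<le> C)"
    by (intro exI[of _ "max C1 C2"]) (auto intro: max.coboundedI1 max.coboundedI2)
  from someI_ex[OF this] show "\<kappa> \<ge> 0" "\<bar>\<Phi> x\<bar> \<le> \<kappa>" "norm (G x) \<le> \<kappa>"
    unfolding \<kappa>_def by auto
qed

text \<open>The gradient is uniformly continuous, so the linearization error is small uniformly in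
  the base point. This is what permits differentiation under an integral over all
  translates.\<close>

lemma mollifier_linearization:
  assumes "e > 0"
  shows "\<exists>\<delta>>0. \<forall>z v. norm v < \<delta> \<longrightarrow> \<bar>\<Phi> (z + v) - \<Phi> z - v \<bullet> G z\<bar> \<le> e * norm v"
proof -
  obtain \<delta> where \<delta>: "\<delta> > 0" "\<And>x y. dist y x < \<delta> \<Longrightarrow> dist (G y) (G x) < e"
    using uniformly_continuous_onE[OF mollifier_grad_uniform \<open>e > 0\<close>] by (metis UNIV_I)
  show ?thesis
  proof (intro exI[of _ \<delta>] conjI allI impI \<delta>(1))
    fix z v :: "real ^ 'n" assume v: "norm v < \<delta>"
    have "norm (\<Phi> (z + v) - \<Phi> z - (\<lambda>w. w \<bullet> G z) ((z + v) - z)) \<le> norm ((z + v) - z) * e"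
    proof (rule differentiable_bound_linearization[where S = "ball z \<delta>" and f' = "\<lambda>x w. w \<bullet> G x"])
      fix x assume x: "x \<in> ball z \<delta>"
      show "onorm ((\<lambda>w. w \<bullet> G x) - (\<lambda>w. w \<bullet> G z)) \<le> e"
      proof (rule onorm_le)
        fix w
        have "norm (G x - G z) \<le> e"
          using \<delta>(2)[of x z] x by (simp add: dist_norm norm_minus_commute)
        then have "\<bar>w \<bullet> (G x - G z)\<bar> \<le> norm w * e"
          by (meson Cauchy_Schwarz_ineq2 mult_left_mono norm_ge_zero order_trans)
        then show "norm (((\<lambda>w. w \<bullet> G x) - (\<lambda>w. w \<bullet> G z)) w) \<le> e * norm w"
          by (simp add: inner_diff_right mult.commute)
      qed
      show "(\<Phi> has_derivative (\<lambda>w. w \<bullet> G x)) (at x within ball z \<delta>)"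
        by (rule has_derivative_at_withinI[OF mollifier_grad(1)])
    next
      fix t :: real assume t: "t \<in> {0..1}"
      have "\<bar>t\<bar> * norm v \<le> norm v" using t by (intro mult_left_le_one_le) auto
      then show "z + t *\<^sub>R (z + v - z) \<in> ball z \<delta>" using v by (simp add: dist_norm)
    qed (use \<delta>(1) in auto)
    then show "\<bar>\<Phi> (z + v) - \<Phi> z - v \<bullet> G z\<bar> \<le> e * norm v" by (simp add: mult.commute)
  qed
qed

section \<open>Convolution of an integrable field with the kernel\<close>

lemma continuous_on_convolution:
  fixes g :: "real ^ 'n \<Rightarrow> real" and w :: "real ^ 'n \<Rightarrow> 'b::{banach, second_countable_topology}"
  assumes g: "uniformly_continuous_on UNIV g" and b: "\<And>x. \<bar>g x\<bar> \<le> C" and w: "integrable lborel w"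
  shows "integrable lborel (\<lambda>y. g (x - y) *\<^sub>R w y)" "continuous_on UNIV (\<lambda>x. \<integral>y. g (x - y) *\<^sub>R w y \<partial>lborel)"
proof -
  have gm: "(\<lambda>y. g (x - y)) \<in> borel_measurable lborel" for x
  proof -
    have "continuous_on UNIV (\<lambda>y. g (x - y))"
      by (rule continuous_on_compose2[OF uniformly_continuous_imp_continuous[OF g]]) (auto intro!: continuous_intros)
    then show ?thesis by (simp add: borel_measurable_continuous_onI)
  qed
  have int: "integrable lborel (\<lambda>y. g (x - y) *\<^sub>R w y)" for x
  proof (rule Bochner_Integration.integrable_bound)
    show "integrable lborel (\<lambda>y. C *\<^sub>R w y)" using w by simp
    show "(\<lambda>y. g (x - y) *\<^sub>R w y) \<in> borel_measurable lborel"
      by (intro borel_measurable_scaleR gm borel_measurable_integrable w)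
    show "AE y in lborel. norm (g (x - y) *\<^sub>R w y) \<le> norm (C *\<^sub>R w y)"
      by (rule AE_I2) (use b in \<open>auto intro!: mult_right_mono order_trans[OF b abs_ge_self]\<close>)
  qed
  then show "integrable lborel (\<lambda>y. g (x - y) *\<^sub>R w y)" .
  define I where "I = (\<integral>y. norm (w y) \<partial>lborel)"
  have I: "I \<ge> 0" unfolding I_def by (rule Bochner_Integration.integral_nonneg) simp
  show "continuous_on UNIV (\<lambda>x. \<integral>y. g (x - y) *\<^sub>R w y \<partial>lborel)"
    unfolding continuous_on_iff
  proof (intro ballI allI impI)
    fix x e assume "(e :: real) > 0"
    \<comment> \<open>The modulus of continuity of \<open>g\<close> is multiplied by the L1 norm
      \<open>I\<close>; adding 1 avoids dividing by 0 when \<open>I = 0\<close>.\<close>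
    define e' where "e' = e / (2 * (I + 1))"
    have e': "e' > 0" using \<open>e > 0\<close> I by (simp add: e'_def)
    obtain \<delta> where \<delta>: "\<delta> > 0" "\<And>x y. dist y x < \<delta> \<Longrightarrow> dist (g y) (g x) < e'"
      using uniformly_continuous_onE[OF g e'] by (metis UNIV_I)
    show "\<exists>\<delta>>0. \<forall>x'\<in>UNIV. dist x' x < \<delta> \<longrightarrow> dist (\<integral>y. g (x' - y) *\<^sub>R w y \<partial>lborel) (\<integral>y. g (x - y) *\<^sub>R w y \<partial>lborel) < e"
    proof (intro exI[of _ \<delta>] conjI ballI impI \<delta>(1))
      fix x' assume x': "dist x' x < \<delta>"
      have "norm ((\<integral>y. g (x' - y) *\<^sub>R w y \<partial>lborel) - (\<integral>y. g (x - y) *\<^sub>R w y \<partial>lborel)) =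
          norm (\<integral>y. (g (x' - y) - g (x - y)) *\<^sub>R w y \<partial>lborel)"
        using int by (simp add: scaleR_left_diff_distrib)
      also have "\<dots> \<le> (\<integral>y. e' * norm (w y) \<partial>lborel)"
      proof (rule Bochner_Integration.integral_norm_bound_integral)
        show "integrable lborel (\<lambda>y. (g (x' - y) - g (x - y)) *\<^sub>R w y)"
          using int by (simp add: scaleR_left_diff_distrib)
        show "integrable lborel (\<lambda>y. e' * norm (w y))" using w by simp
        fix y
        have "\<bar>g (x' - y) - g (x - y)\<bar> \<le> e'"
          using \<delta>(2)[of "x' - y" "x - y"] x' by (simp add: dist_norm)
        then show "norm ((g (x' - y) - g (x - y)) *\<^sub>R w y) \<le> e' * norm (w y)"
          by (simp add: mult_right_mono)
      qed
      also have "\<dots> = e' * I" by (simp add: I_def)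
      also have "\<dots> \<le> e' * (I + 1)" using e' by simp
      also have "\<dots> = e / 2"
      proof -
        have "I + 1 \<noteq> 0" using I by linarith
        then show ?thesis unfolding e'_def by (simp add: field_simps)
      qed
      also have "\<dots> < e" using \<open>e > 0\<close> by simp
      finally show "dist (\<integral>y. g (x' - y) *\<^sub>R w y \<partial>lborel) (\<integral>y. g (x - y) *\<^sub>R w y \<partial>lborel) < e"
        by (simp add: dist_norm)
    qed
  qed
qed

lemma uniformly_continuous_grad_inner: "uniformly_continuous_on UNIV (\<lambda>x. v \<bullet> G x)"
  by (rule bounded_linear.uniformly_continuous_on[OF bounded_linear_inner_right mollifier_grad_uniform])

lemma grad_inner_bound: "\<bar>v \<bullet> G x\<bar> \<le> norm v * \<kappa>"
  by (meson Cauchy_Schwarz_ineq2 mult_left_mono norm_ge_zero order_trans \<kappa>(3))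

text \<open>The difference quotient is controlled by the uniform linearization of the kernel times
  the L1 norm of \<open>w\<close>, so integrability of \<open>w\<close> suffices.\<close>

lemma has_derivative_convolution:
  fixes w :: "real ^ 'n \<Rightarrow> 'b::{banach, second_countable_topology}"
  assumes w: "integrable lborel w"
  shows "((\<lambda>x. \<integral>y. \<Phi> (x - y) *\<^sub>R w y \<partial>lborel) has_derivative (\<lambda>v. \<integral>y. (v \<bullet> G (x - y)) *\<^sub>R w y \<partial>lborel)) (at x)"
proof -
  have i1: "integrable lborel (\<lambda>y. \<Phi> (x - y) *\<^sub>R w y)" for x
    by (rule continuous_on_convolution(1)[OF mollifier_uniform \<kappa>(2) w])
  have i2: "integrable lborel (\<lambda>y. (v \<bullet> G (x - y)) *\<^sub>R w y)" for v x
    by (rule continuous_on_convolution(1)[OF uniformly_continuous_grad_inner grad_inner_bound w])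
  define I where "I = (\<integral>y. norm (w y) \<partial>lborel)"
  have I: "I \<ge> 0" unfolding I_def by (rule Bochner_Integration.integral_nonneg) simp
  let ?D = "\<lambda>v. \<integral>y. (v \<bullet> G (x - y)) *\<^sub>R w y \<partial>lborel"
  have bl: "bounded_linear ?D"
  proof (rule bounded_linear_intro[where K = "\<kappa> * I"])
    show "?D (u + v) = ?D u + ?D v" for u v using i2 by (simp add: inner_add_left scaleR_left_distrib)
    show "?D (r *\<^sub>R v) = r *\<^sub>R ?D v" for r v
      by (simp add: scaleR_scaleR[symmetric] del: scaleR_scaleR)
    show "norm (?D v) \<le> norm v * (\<kappa> * I)" for v
    proof -
      have "norm (?D v) \<le> (\<integral>y. norm v * \<kappa> * norm (w y) \<partial>lborel)"
      proof (rule Bochner_Integration.integral_norm_bound_integral)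
        show "integrable lborel (\<lambda>y. (v \<bullet> G (x - y)) *\<^sub>R w y)" by (rule i2)
        show "integrable lborel (\<lambda>y. norm v * \<kappa> * norm (w y))" using w by simp
        show "norm ((v \<bullet> G (x - y)) *\<^sub>R w y) \<le> norm v * \<kappa> * norm (w y)" for y
          unfolding norm_scaleR by (rule mult_right_mono[OF grad_inner_bound norm_ge_zero])
      qed
      also have "\<dots> = norm v * (\<kappa> * I)" unfolding I_def by simp
      finally show ?thesis .
    qed
  qed
  show ?thesis
    unfolding has_derivative_at_alt
  proof (rule conjI[OF bl], intro allI impI)
    fix e :: real assume "e > 0"
    define e' where "e' = e / (I + 1)"
    have e': "e' > 0" using \<open>e > 0\<close> I by (simp add: e'_def)
    obtain \<delta> where \<delta>: "\<delta> > 0" "\<And>z v. norm v < \<delta> \<Longrightarrow> \<bar>\<Phi> (z + v) - \<Phi> z - v \<bullet> G z\<bar> \<le> e' * norm v"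
      using mollifier_linearization[OF e'] by blast
    show "\<exists>\<delta>>0. \<forall>x'. norm (x' - x) < \<delta> \<longrightarrow>
      norm ((\<integral>y. \<Phi> (x' - y) *\<^sub>R w y \<partial>lborel) - (\<integral>y. \<Phi> (x - y) *\<^sub>R w y \<partial>lborel) - ?D (x' - x)) \<le> e * norm (x' - x)"
    proof (intro exI[of _ \<delta>] conjI allI impI \<delta>(1))
      fix x' assume x': "norm (x' - x) < \<delta>"
      have "(\<integral>y. \<Phi> (x' - y) *\<^sub>R w y \<partial>lborel) - (\<integral>y. \<Phi> (x - y) *\<^sub>R w y \<partial>lborel) - ?D (x' - x)
        = (\<integral>y. (\<Phi> (x' - y) - \<Phi> (x - y) - (x' - x) \<bullet> G (x - y)) *\<^sub>R w y \<partial>lborel)"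
        using i1 i2 by (simp add: scaleR_left_diff_distrib)
      also have "norm \<dots> \<le> (\<integral>y. e' * norm (x' - x) * norm (w y) \<partial>lborel)"
      proof (rule Bochner_Integration.integral_norm_bound_integral)
        show "integrable lborel (\<lambda>y. (\<Phi> (x' - y) - \<Phi> (x - y) - (x' - x) \<bullet> G (x - y)) *\<^sub>R w y)"
          using i1 i2 by (simp add: scaleR_left_diff_distrib)
        show "integrable lborel (\<lambda>y. e' * norm (x' - x) * norm (w y))" using w by simp
        fix y
        have "\<bar>\<Phi> ((x - y) + (x' - x)) - \<Phi> (x - y) - (x' - x) \<bullet> G (x - y)\<bar> \<le> e' * norm (x' - x)"
          by (rule \<delta>(2)[OF x'])
        moreover have "(x - y) + (x' - x) = x' - y" by simp
        ultimately show "norm ((\<Phi> (x' - y) - \<Phi> (x - y) - (x' - x) \<bullet> G (x - y)) *\<^sub>R w y) \<le> e' * norm (x' - x) * norm (w y)"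
          unfolding norm_scaleR by (intro mult_right_mono) simp_all
      qed
      also have "\<dots> = (e' * I) * norm (x' - x)" unfolding I_def by simp
      also have "\<dots> \<le> (e' * (I + 1)) * norm (x' - x)"
        using e' by (intro mult_right_mono mult_left_mono) simp_all
      also have "e' * (I + 1) = e"
      proof -
        have "I + 1 \<noteq> 0" using I by linarith
        then show ?thesis unfolding e'_def using nonzero_eq_divide_eq by blast
      qed
      finally show "norm ((\<integral>y. \<Phi> (x' - y) *\<^sub>R w y \<partial>lborel) - (\<integral>y. \<Phi> (x - y) *\<^sub>R w y \<partial>lborel) - ?D (x' - x)) \<le> e * norm (x' - x)" .
    qed
  qed
qed

end

section \<open>The approximate mean curvature vector\<close>

lemma continuous_on_cball_bounded:
  fixes g :: "'a::heine_borel \<Rightarrow> 'b::real_normed_vector"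
  assumes "continuous_on UNIV g"
  shows "\<exists>C\<ge>0. \<forall>x\<in>cball a R. norm (g x) \<le> C"
proof -
  have "compact (g ` cball a R)" by (rule compact_continuous_image[OF continuous_on_subset[OF assms]]) auto
  then obtain B where B: "\<forall>z\<in>g ` cball a R. norm z \<le> B" using compact_imp_bounded bounded_iff by metis
  then have "\<forall>x\<in>cball a R. norm (g x) \<le> max B 0" by (auto intro: max.coboundedI1)
  then show ?thesis by (intro exI[of _ "max B 0"]) simp
qed

context mcf_kernel
begin

abbreviation "ht \<equiv> h_tilde \<psi> \<epsilon>"
abbreviation "h \<equiv> approx_mean_curvature \<psi> \<epsilon>"

lemma continuous_on_translates:
  "continuous_on A (\<lambda>x. \<Phi> (f x))" "continuous_on A (\<lambda>x. G (f x))" if "continuous_on A f"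
  using continuous_on_compose2[OF mollifier_continuous that] continuous_on_compose2[OF mollifier_grad(2) that] by auto

lemma borel_measurable_kernels:
  assumes "X \<in> borel_measurable N"
  shows "(\<lambda>n. \<Phi> (X n)) \<in> borel_measurable N" "(\<lambda>n. G (X n)) \<in> borel_measurable N"
  using measurable_compose[OF assms borel_measurable_continuous_onI[OF mollifier_continuous]]
    measurable_compose[OF assms borel_measurable_continuous_onI[OF mollifier_grad(2)]] by auto

lemma borel_measurable_matrix_vector_mult:
  fixes A :: "'b \<Rightarrow> real ^ 'n ^ 'n"
  assumes "A \<in> borel_measurable N" "v \<in> borel_measurable N"
  shows "(\<lambda>n. A n *v v n) \<in> borel_measurable N"
  by (rule borel_measurable_continuous_Pair[OF assms]) (intro continuous_intros)

lemma bundle_projections_measurable: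
  fixes V :: "((real ^ 'n) \<times> (real ^ 'n ^ 'n)) measure"
  assumes "sets V = sets (grassmann_borel d)"
  shows "fst \<in> borel_measurable V" "snd \<in> borel_measurable V"
  by (rule borel_measurable_continuous_on_bundle[OF assms], intro continuous_intros)+

lemma smoothed_mass_eq:
  fixes V :: "((real ^ 'n) \<times> (real ^ 'n ^ 'n)) measure"
  assumes "sets V = sets (grassmann_borel d)"
  shows "smoothed_mass \<psi> \<epsilon> V y = (\<integral>(x, S). \<Phi> (x - y) \<partial>V)"
  unfolding smoothed_mass_def
  by (rule integral_mass[OF assms]) (intro borel_measurable_kernels borel_measurable_diff borel_measurable_const measurable_ident_sets, simp)

lemma smoothed_mass_nonneg: "0 \<le> smoothed_mass \<psi> \<epsilon> V y"
  unfolding smoothed_mass_def by (rule Bochner_Integration.integral_nonneg) (rule mollifier_nonneg)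

lemma norm_smoothed_first_variation_le:
  assumes V: "bounded_varifold d R m V" and m: "m \<ge> 0"
  shows "norm (smoothed_first_variation \<psi> \<epsilon> V y) \<le> \<kappa> * m"
  unfolding smoothed_first_variation_def
proof (rule bounded_varifold_integral_le[OF V m])
  fix x :: "real ^ 'n" and S :: "real ^ 'n ^ 'n" assume "S \<in> grassmannian d"
  then have "norm (S *v G (x - y)) \<le> norm (G (x - y))" using norm_is_proj_le grassmannianD(1) by blast
  then show "norm (case (x, S) of (x, S) \<Rightarrow> S *v G (x - y)) \<le> \<kappa>" using \<kappa>(3)[of "x - y"] by simp
qed (rule \<kappa>(1))

text \<open>The kernel vanishes outside the unit ball, so smoothing enlarges the support by at most
  1.\<close>

lemma smoothed_first_variation_support:
  assumes V: "bounded_varifold d R m V" and y: "norm y > R + 1"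
  shows "smoothed_first_variation \<psi> \<epsilon> V y = 0"
proof -
  have "AE p in V. (case p of (x, S) \<Rightarrow> S *v G (x - y)) = 0"
    using bounded_varifold_AE[OF V]
  proof eventually_elim
    case (elim p)
    obtain x S where p: "p = (x, S)" by (cases p)
    have "norm x \<le> R" using elim p by simp
    then have "norm (x - y) > 1" using y norm_triangle_ineq2[of y x] by (simp add: norm_minus_commute)
    then have "G (x - y) = 0" by (intro mollifier_grad_support) simp
    then show ?case by (simp add: p)
  qed
  then show ?thesis unfolding smoothed_first_variation_def by (rule integral_eq_zero_AE)
qed

text \<open>The smoothed mass is nonnegative, so the denominator stays above
  \<open>\<epsilon>\<close>.\<close>

lemma norm_h_tilde_le:
  assumes V: "bounded_varifold d R m V" and m: "m \<ge> 0"
  shows "norm (ht V y) \<le> \<kappa> * m / \<epsilon>"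
proof -
  let ?\<mu> = "smoothed_mass \<psi> \<epsilon> V y"
  have "0 < ?\<mu> + \<epsilon>" "\<epsilon> \<le> ?\<mu> + \<epsilon>" using smoothed_mass_nonneg[of V y] eps by simp_all
  then have "norm (ht V y) = norm (smoothed_first_variation \<psi> \<epsilon> V y) / (?\<mu> + \<epsilon>)"
    unfolding h_tilde_def by simp
  also have "\<dots> \<le> (\<kappa> * m) / \<epsilon>"
    by (rule frac_le) (use \<kappa>(1) m eps norm_smoothed_first_variation_le[OF V m] \<open>\<epsilon> \<le> ?\<mu> + \<epsilon>\<close> in simp_all)
  finally show ?thesis .
qed

lemma h_tilde_support:
  assumes "bounded_varifold d R m V" "y \<notin> cball 0 (R + 1)"
  shows "ht V y = 0"
  using smoothed_first_variation_support[OF assms(1), of y] assms(2) by (simp add: h_tilde_def)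

lemma h_tilde_measurable:
  fixes V :: "((real ^ 'n) \<times> (real ^ 'n ^ 'n)) measure"
  assumes V: "bounded_varifold d R m V"
  shows "ht V \<in> borel_measurable lborel"
proof -
  interpret V: finite_measure V by (rule bounded_varifold_finite[OF V])
  note sV = bounded_varifold_sets[OF V]
  note pr = bundle_projections_measurable[OF sV]
  \<comment> \<open>Measurability in \<open>y\<close> comes from joint measurability on the product,
    by integrating out the varifold variable.\<close>
  let ?N = "lborel \<Otimes>\<^sub>M V"
  have X: "(\<lambda>n. fst (snd n) - fst n) \<in> borel_measurable ?N"
    by (intro borel_measurable_diff measurable_compose[OF measurable_snd pr(1)]) simp
  have S: "(\<lambda>n. snd (snd n)) \<in> borel_measurable ?N"
    by (rule measurable_compose[OF measurable_snd pr(2)])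
  have "(\<lambda>y. \<integral>p. \<Phi> (fst p - y) \<partial>V) \<in> borel_measurable lborel"
    by (rule V.borel_measurable_lebesgue_integral)
       (use borel_measurable_kernels(1)[OF X] in \<open>simp add: split_beta'\<close>)
  moreover have "(\<lambda>y. \<integral>p. snd p *v G (fst p - y) \<partial>V) \<in> borel_measurable lborel"
    by (rule V.borel_measurable_lebesgue_integral)
       (use borel_measurable_matrix_vector_mult[OF S borel_measurable_kernels(2)[OF X]] in \<open>simp add: split_beta'\<close>)
  ultimately have "(\<lambda>y. - ((1 / (smoothed_mass \<psi> \<epsilon> V y + \<epsilon>)) *\<^sub>R smoothed_first_variation \<psi> \<epsilon> V y)) \<in> borel_measurable lborel"
    unfolding smoothed_mass_eq[OF sV] smoothed_first_variation_def split_beta'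
    by (intro borel_measurable_uminus borel_measurable_scaleR borel_measurable_divide borel_measurable_add borel_measurable_const)
  then show ?thesis unfolding h_tilde_def[abs_def] .
qed

lemma integrable_indicator_cball: "integrable lborel (\<lambda>y :: real ^ 'n. C * indicator (cball a r) y :: real)"
  using emeasure_bounded_finite[OF bounded_cball, of a r]
  by (intro integrable_mult_right integrable_real_indicator) (simp_all add: less_top)

lemma h_tilde_integrable:
  assumes V: "bounded_varifold d R m V" and m: "m \<ge> 0"
  shows "integrable lborel (ht V)"
proof (rule Bochner_Integration.integrable_bound)
  show "integrable lborel (\<lambda>y :: real ^ 'n. (\<kappa> * m / \<epsilon>) * indicator (cball 0 (R + 1)) y :: real)"
    by (rule integrable_indicator_cball)
  show "ht V \<in> borel_measurable lborel" by (rule h_tilde_measurable[OF V])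
  show "AE y in lborel. norm (ht V y) \<le> norm ((\<kappa> * m / \<epsilon>) * indicator (cball 0 (R + 1)) y :: real)"
  proof (rule AE_I2)
    fix y show "norm (ht V y) \<le> norm ((\<kappa> * m / \<epsilon>) * indicator (cball 0 (R + 1)) y :: real)"
    proof (cases "y \<in> cball 0 (R + 1)")
      case True
      then show ?thesis using order_trans[OF norm_h_tilde_le[OF V m, of y] abs_ge_self] by simp
    next
      case False
      then show ?thesis using h_tilde_support[OF V] by simp
    qed
  qed
qed

text \<open>The bound of the kernel, times that of the unmollified field, times the volume of the
  unit ball around \<open>x\<close> in which the kernel lives. Since \<open>\<kappa>\<close> also
  bounds the gradient, the same number serves for \<open>h\<close> and for its derivative.\<close>

definition "hbound m = \<kappa> * (\<kappa> * m / \<epsilon>) * unit_ball_vol (real CARD('n))"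

lemma hbound_nonneg: "m \<ge> 0 \<Longrightarrow> hbound m \<ge> 0"
  unfolding hbound_def using \<kappa>(1) eps by (intro mult_nonneg_nonneg divide_nonneg_pos) auto

lemma norm_convolution_le:
  fixes w :: "real ^ 'n \<Rightarrow> 'b::{banach, second_countable_topology}"
  assumes g: "\<And>z. \<bar>g z\<bar> \<le> C" "\<And>z. z \<notin> cball 0 1 \<Longrightarrow> g z = 0" and w: "\<And>y. norm (w y) \<le> W"
    and C: "C \<ge> 0" and W: "W \<ge> 0" and int: "integrable lborel (\<lambda>y. g (x - y) *\<^sub>R w y)"
  shows "norm (\<integral>y. g (x - y) *\<^sub>R w y \<partial>lborel) \<le> C * W * unit_ball_vol (real CARD('n))"
proof -
  have "norm (\<integral>y. g (x - y) *\<^sub>R w y \<partial>lborel) \<le> (\<integral>y. C * W * indicator (cball x 1) y \<partial>lborel)"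
  proof (rule Bochner_Integration.integral_norm_bound_integral[OF int integrable_indicator_cball])
    fix y
    show "norm (g (x - y) *\<^sub>R w y) \<le> C * W * indicator (cball x 1) y"
    proof (cases "y \<in> cball x 1")
      case True
      then show ?thesis using mult_mono[OF g(1)[of "x - y"] w[of y] C norm_ge_zero] by simp
    next
      case False
      then have "x - y \<notin> cball 0 1" by (simp add: dist_norm norm_minus_commute)
      then show ?thesis using g(2) False by simp
    qed
  qed
  also have "\<dots> = C * W * measure lborel (cball x 1)" by simp
  also have "measure lborel (cball x 1) = unit_ball_vol (real CARD('n))"
    using content_cball[of 1 x] by simp
  finally show ?thesis .
qed

lemma h_eq: "h V = (\<lambda>x. \<integral>y. \<Phi> (x - y) *\<^sub>R ht V y \<partial>lborel)"
  by (rule ext) (rule approx_mean_curvature_def)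

context
  fixes d :: nat and R m :: real and V :: "((real ^ 'n) \<times> (real ^ 'n ^ 'n)) measure"
  assumes V: "bounded_varifold d R m V" and m: "m \<ge> 0"
begin

lemma h_has_derivative: "(h V has_derivative (\<lambda>v. \<integral>y. (v \<bullet> G (x - y)) *\<^sub>R ht V y \<partial>lborel)) (at x)"
  unfolding h_eq by (rule has_derivative_convolution[OF h_tilde_integrable[OF V m]])

lemma h_continuous: "continuous_on UNIV (h V)"
  by (intro continuous_at_imp_continuous_on ballI has_derivative_continuous[OF h_has_derivative])

lemma jacobian_h: "jacobian (h V) (at x) *v v = (\<integral>y. (v \<bullet> G (x - y)) *\<^sub>R ht V y \<partial>lborel)"
proof -
  let ?D = "\<lambda>v. \<integral>y. (v \<bullet> G (x - y)) *\<^sub>R ht V y \<partial>lborel"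
  have "(h V has_derivative (\<lambda>v. jacobian (h V) (at x) *v v)) (at x)"
    using jacobian_works[of "h V" "at x"] differentiableI[OF h_has_derivative] by blast
  from has_derivative_unique[OF this h_has_derivative] show ?thesis by (rule fun_cong)
qed

lemma h_has_derivative_jacobian: "(h V has_derivative (\<lambda>v. jacobian (h V) (at x) *v v)) (at x)"
  unfolding jacobian_h by (rule h_has_derivative)

lemma integrable_grad_h_tilde: "integrable lborel (\<lambda>y. (v \<bullet> G (x - y)) *\<^sub>R ht V y)"
  by (rule continuous_on_convolution(1)[OF uniformly_continuous_grad_inner grad_inner_bound h_tilde_integrable[OF V m]])

lemma integrable_mollifier_h_tilde: "integrable lborel (\<lambda>y. \<Phi> (x - y) *\<^sub>R ht V y)"
  by (rule continuous_on_convolution(1)[OF mollifier_uniform \<kappa>(2) h_tilde_integrable[OF V m]])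

lemma continuous_on_jacobian_h: "continuous_on UNIV (\<lambda>x. jacobian (h V) (at x))"
proof -
  have "jacobian (h V) (at x) = (\<chi> i j. (\<integral>y. (axis j 1 \<bullet> G (x - y)) *\<^sub>R ht V y \<partial>lborel) $ i)" for x
    unfolding jacobian_h[symmetric] by (simp add: matrix_vector_mult_basis column_def vec_eq_iff)
  moreover have "continuous_on UNIV (\<lambda>x. \<integral>y. (axis j 1 \<bullet> G (x - y)) *\<^sub>R ht V y \<partial>lborel)" for j
    by (rule continuous_on_convolution(2)[OF uniformly_continuous_grad_inner grad_inner_bound h_tilde_integrable[OF V m]])
  ultimately show ?thesis by (simp only:) (intro continuous_on_vec_lambda continuous_on_component)
qed

lemma norm_h_le: "norm (h V x) \<le> hbound m"
  unfolding h_eq hbound_def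
  by (rule norm_convolution_le[OF \<kappa>(2) mollifier_support norm_h_tilde_le[OF V m] \<kappa>(1) _ integrable_mollifier_h_tilde])
     (assumption | intro divide_nonneg_pos mult_nonneg_nonneg \<kappa>(1) m eps)+

lemma norm_jacobian_h_le: "norm (jacobian (h V) (at x) *v v) \<le> hbound m * norm v"
proof -
  have "norm (\<integral>y. (v \<bullet> G (x - y)) *\<^sub>R ht V y \<partial>lborel) \<le> (norm v * \<kappa>) * (\<kappa> * m / \<epsilon>) * unit_ball_vol (real CARD('n))"
    by (rule norm_convolution_le[OF grad_inner_bound _ norm_h_tilde_le[OF V m] _ _ integrable_grad_h_tilde])
       (use \<kappa>(1) m eps mollifier_grad_support in simp_all)
  then show ?thesis unfolding jacobian_h hbound_def by (simp add: mult_ac)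
qed

text \<open>For fixed \<open>y\<close> the derivative of the integrand is a rank-one matrix, with
  column factor \<open>ht V y\<close> and row factor the gradient of the kernel. By symmetry of
  \<open>S\<close>, the trace of its product with \<open>S\<close> is the inner product on the
  right. The trace is a finite sum of bounded linear functionals and so commutes with the
  integral.\<close>

lemma div_along_h:
  assumes S: "is_proj S"
  shows "div_along S (h V) x = (\<integral>y. (S *v G (x - y)) \<bullet> ht V y \<partial>lborel)"
proof -
  have bl: "bounded_linear (\<lambda>w. (S *v w) $ k)" for k
    by (rule bounded_linear_compose[OF bounded_linear_vec_nth matrix_vector_mul_bounded_linear])
  have int: "integrable lborel (\<lambda>y. (S *v ((axis k 1 \<bullet> G (x - y)) *\<^sub>R ht V y)) $ k)" for k
    by (rule integrable_bounded_linear[OF bl integrable_grad_h_tilde])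
  have "div_along S (h V) x = (\<Sum>k\<in>UNIV. (S *v (\<integral>y. (axis k 1 \<bullet> G (x - y)) *\<^sub>R ht V y \<partial>lborel)) $ k)"
    unfolding div_along_def trace_mult_row jacobian_h ..
  also have "\<dots> = (\<Sum>k\<in>UNIV. \<integral>y. (S *v ((axis k 1 \<bullet> G (x - y)) *\<^sub>R ht V y)) $ k \<partial>lborel)"
    by (intro sum.cong refl integral_bounded_linear[OF bl integrable_grad_h_tilde, symmetric])
  also have "\<dots> = (\<integral>y. (\<Sum>k\<in>UNIV. (S *v ((axis k 1 \<bullet> G (x - y)) *\<^sub>R ht V y)) $ k) \<partial>lborel)"
    by (rule Bochner_Integration.integral_sum[OF int, symmetric])
  also have "\<dots> = (\<integral>y. (S *v G (x - y)) \<bullet> ht V y \<partial>lborel)"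
  proof (rule Bochner_Integration.integral_cong[OF refl])
    fix y
    have "(\<Sum>k\<in>UNIV. (S *v ((axis k 1 \<bullet> G (x - y)) *\<^sub>R ht V y)) $ k) = G (x - y) \<bullet> (S *v ht V y)"
      by (simp add: inner_vec_def[of "G (x - y)"] inner_axis' inner_real_def linear_scale[OF matrix_vector_mul_linear])
    then show "(\<Sum>k\<in>UNIV. (S *v ((axis k 1 \<bullet> G (x - y)) *\<^sub>R ht V y)) $ k) = (S *v G (x - y)) \<bullet> ht V y"
      using is_proj_inner[OF S] by simp
  qed
  finally show ?thesis .
qed

end

text \<open>The vector paired with \<open>ht V y\<close> once the integral over the varifold is
  taken first; \<open>q\<close> later becomes the spatial gradient of the weight
  \<open>\<phi>\<close>. For \<open>\<phi>\<close> equal to 1 and \<open>q\<close> equal to 0 it is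
  the smoothed first variation.\<close>

definition dual :: "(real ^ 'n \<Rightarrow> real) \<Rightarrow> (real ^ 'n \<Rightarrow> real ^ 'n) \<Rightarrow>
    ((real ^ 'n) \<times> (real ^ 'n ^ 'n)) measure \<Rightarrow> real ^ 'n \<Rightarrow> real ^ 'n" where
  "dual \<phi> q V y = (\<integral>(x, S). \<phi> x *\<^sub>R (S *v G (x - y)) + \<Phi> (x - y) *\<^sub>R q x \<partial>V)"

lemma continuous_on_dual_integrand:
  assumes \<phi>: "continuous_on UNIV \<phi>" and q: "continuous_on UNIV q"
  shows "continuous_on (grassmann_bundle d) (\<lambda>(x, S). \<phi> x *\<^sub>R (S *v G (x - y)) + \<Phi> (x - y) *\<^sub>R q x)"
proof -
  have "continuous_on (grassmann_bundle d) (\<lambda>p. \<phi> (fst p))" "continuous_on (grassmann_bundle d) (\<lambda>p. q (fst p))"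
    by (rule continuous_on_compose2[OF \<phi>] continuous_on_compose2[OF q]; auto intro!: continuous_intros)+
  then show ?thesis
    unfolding split_beta' by (intro continuous_intros continuous_on_translates)
qed

lemma dual_integrand_le:
  assumes "S \<in> grassmannian d" "\<bar>\<phi> x\<bar> \<le> C1" "norm (q x) \<le> C2"
  shows "norm (\<phi> x *\<^sub>R (S *v G (x - y)) + \<Phi> (x - y) *\<^sub>R q x) \<le> C1 * \<kappa> + \<kappa> * C2"
proof -
  have SG: "norm (S *v G (x - y)) \<le> \<kappa>"
    by (rule order_trans[OF norm_is_proj_le[OF grassmannianD(1)[OF assms(1)]] \<kappa>(3)])
  have C1: "C1 \<ge> 0" using assms(2) abs_ge_zero order_trans by blast
  have "norm (\<phi> x *\<^sub>R (S *v G (x - y)) + \<Phi> (x - y) *\<^sub>R q x) \<le> \<bar>\<phi> x\<bar> * norm (S *v G (x - y)) + \<bar>\<Phi> (x - y)\<bar> * norm (q x)"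
    by (rule order_trans[OF norm_triangle_ineq]) simp
  also have "\<dots> \<le> C1 * \<kappa> + \<kappa> * C2"
    by (intro add_mono mult_mono assms(2,3) SG \<kappa>(1,2) C1) simp_all
  finally show ?thesis .
qed

lemma first_variation_dual:
  fixes V :: "((real ^ 'n) \<times> (real ^ 'n ^ 'n)) measure"
  assumes V: "bounded_varifold d R m V" and m: "m \<ge> 0"
    and \<phi>: "continuous_on UNIV \<phi>" and q: "continuous_on UNIV q"
  shows "(\<integral>(x, S). \<phi> x * div_along S (h V) x + q x \<bullet> h V x \<partial>V) = (\<integral>y. ht V y \<bullet> dual \<phi> q V y \<partial>lborel)"
proof -
  interpret V: finite_measure V by (rule bounded_varifold_finite[OF V])
  interpret P: pair_sigma_finite V lborel ..
  note sV = bounded_varifold_sets[OF V]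
  note pr = bundle_projections_measurable[OF sV]
  note hti = h_tilde_integrable[OF V m] and htm = h_tilde_measurable[OF V]
  define I where "I = (\<integral>y. norm (ht V y) \<partial>lborel)"
  have I: "I \<ge> 0" unfolding I_def by (rule Bochner_Integration.integral_nonneg) simp
  define u where "u p y = (\<phi> (fst p) *\<^sub>R (snd p *v G (fst p - y)) + \<Phi> (fst p - y) *\<^sub>R q (fst p)) \<bullet> ht V y" for p y
  have um: "(\<lambda>(p, y). u p y) \<in> borel_measurable (V \<Otimes>\<^sub>M lborel)"
  proof -
    let ?N = "V \<Otimes>\<^sub>M lborel"
    have x: "(\<lambda>n. fst (fst n)) \<in> borel_measurable ?N" by (rule measurable_compose[OF measurable_fst pr(1)])
    have S: "(\<lambda>n. snd (fst n)) \<in> borel_measurable ?N" by (rule measurable_compose[OF measurable_fst pr(2)])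
    have X: "(\<lambda>n. fst (fst n) - snd n) \<in> borel_measurable ?N"
      by (intro borel_measurable_diff x) simp
    note c = measurable_compose[OF x borel_measurable_continuous_onI[OF \<phi>]]
      measurable_compose[OF x borel_measurable_continuous_onI[OF q]]
      measurable_compose[OF measurable_snd htm]
    show ?thesis
      unfolding u_def split_beta'
      by (intro borel_measurable_inner borel_measurable_add borel_measurable_scaleR c S
          borel_measurable_matrix_vector_mult borel_measurable_kernels X)
  qed
  obtain C1 where C1: "C1 \<ge> 0" "\<And>x. norm x \<le> R \<Longrightarrow> \<bar>\<phi> x\<bar> \<le> C1"
    using continuous_on_cball_bounded[OF \<phi>, of 0 R] by auto
  obtain C2 where C2: "C2 \<ge> 0" "\<And>x. norm x \<le> R \<Longrightarrow> norm (q x) \<le> C2"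
    using continuous_on_cball_bounded[OF q, of 0 R] by auto
  \<comment> \<open>\<open>K\<close> bounds the vector that is paired with \<open>ht V y\<close>, so
    \<open>K * norm (ht V y)\<close> is a majorant that is integrable for the product of the finite
    measure \<open>V\<close> and Lebesgue measure.\<close>
  define K where "K = C1 * \<kappa> + \<kappa> * C2"
  have K: "K \<ge> 0" unfolding K_def using C1(1) C2(1) \<kappa>(1) by simp
  have ub: "norm (u (x, S) y) \<le> K * norm (ht V y)" if "norm x \<le> R" "S \<in> grassmannian d" for x S y
  proof -
    have "norm (\<phi> x *\<^sub>R (S *v G (x - y)) + \<Phi> (x - y) *\<^sub>R q x) * norm (ht V y) \<le> K * norm (ht V y)"
      unfolding K_def by (rule mult_right_mono[OF dual_integrand_le[of S d \<phi> x C1 q C2]]) (use that C1 C2 in simp_all)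
    then show ?thesis unfolding u_def fst_conv snd_conv
      by (rule order_trans[OF Cauchy_Schwarz_ineq2[folded real_norm_def]])
  qed
  \<comment> \<open>The quantifier over \<open>y\<close> stands inside, so the exceptional set does
    not depend on \<open>y\<close>.\<close>
  have AEb: "AE p in V. \<forall>y. norm (u p y) \<le> K * norm (ht V y)"
    using bounded_varifold_AE[OF V]
  proof eventually_elim
    case (elim p)
    obtain x S where p: "p = (x, S)" by (cases p)
    show ?case using elim ub unfolding p by blast
  qed
  have iu: "integrable lborel (u p)" if "p \<in> space V" "\<forall>y. norm (u p y) \<le> K * norm (ht V y)" for p
  proof (rule Bochner_Integration.integrable_bound)
    show "integrable lborel (\<lambda>y. K * norm (ht V y))" using hti by simp
    show "u p \<in> borel_measurable lborel"
      using measurable_Pair2[OF um that(1)] by simp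
    show "AE y in lborel. norm (u p y) \<le> norm (K * norm (ht V y))"
      by (rule AE_I2) (use that(2) in \<open>auto intro: order_trans[OF _ abs_ge_self]\<close>)
  qed
  have int: "integrable (V \<Otimes>\<^sub>M lborel) (\<lambda>(p, y). u p y)"
  proof (rule P.Fubini_integrable[OF um])
    show "AE p in V. integrable lborel (\<lambda>y. case (p, y) of (p, y) \<Rightarrow> u p y)"
      using AEb AE_space by eventually_elim (simp add: iu)
    have nm: "(\<lambda>p. \<integral>y. norm (u p y) \<partial>lborel) \<in> borel_measurable V"
      by (rule lborel.borel_measurable_lebesgue_integral) (use measurable_compose[OF um borel_measurable_norm] in \<open>simp add: split_beta'\<close>)
    have "integrable V (\<lambda>p. \<integral>y. norm (u p y) \<partial>lborel)"
    proof (rule V.integrable_const_bound[OF _ nm, of "K * I"])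
      show "AE p in V. norm (\<integral>y. norm (u p y) \<partial>lborel) \<le> K * I"
        using AEb AE_space
      proof eventually_elim
        case (elim p)
        have "norm (\<integral>y. norm (u p y) \<partial>lborel) \<le> (\<integral>y. K * norm (ht V y) \<partial>lborel)"
          by (rule Bochner_Integration.integral_norm_bound_integral) (use iu[of p] elim hti in auto)
        then show ?case unfolding I_def by simp
      qed
    qed
    then show "integrable V (\<lambda>p. \<integral>y. norm (case (p, y) of (p, y) \<Rightarrow> u p y) \<partial>lborel)" by simp
  qed
  have inner: "(\<integral>p. u p y \<partial>V) = ht V y \<bullet> dual \<phi> q V y" for y
  proof -
    have "(\<integral>p. u p y \<partial>V) = (\<integral>p. (case p of (x, S) \<Rightarrow> \<phi> x *\<^sub>R (S *v G (x - y)) + \<Phi> (x - y) *\<^sub>R q x) \<bullet> ht V y \<partial>V)"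
      by (rule Bochner_Integration.integral_cong) (auto simp: u_def)
    also have "\<dots> = (\<integral>(x, S). \<phi> x *\<^sub>R (S *v G (x - y)) + \<Phi> (x - y) *\<^sub>R q x \<partial>V) \<bullet> ht V y"
      by (rule integral_inner_left) (rule bounded_varifold_integrable_continuous[OF V continuous_on_dual_integrand[OF \<phi> q]])
    finally show ?thesis by (simp add: dual_def inner_commute)
  qed
  have outer: "(\<integral>y. u (x, S) y \<partial>lborel) = \<phi> x * div_along S (h V) x + q x \<bullet> h V x" if S: "S \<in> grassmannian d" for x S
  proof -
    have P: "is_proj S" by (rule grassmannianD(1)[OF S])
    have i1: "integrable lborel (\<lambda>y. (S *v G (x - y)) \<bullet> ht V y)"
    proof -
      have "(S *v G (x - y)) \<bullet> ht V y = (\<Sum>k\<in>UNIV. (S *v ((axis k 1 \<bullet> G (x - y)) *\<^sub>R ht V y)) $ k)" for y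
        using is_proj_inner[OF P, of "G (x - y)"]
        by (simp add: inner_vec_def[of "G (x - y)"] inner_axis' inner_real_def linear_scale[OF matrix_vector_mul_linear])
      moreover have "integrable lborel (\<lambda>y. (S *v ((axis k 1 \<bullet> G (x - y)) *\<^sub>R ht V y)) $ k)" for k
        by (rule integrable_bounded_linear[OF bounded_linear_compose[OF bounded_linear_vec_nth matrix_vector_mul_bounded_linear] integrable_grad_h_tilde[OF V m]])
      ultimately show ?thesis by simp
    qed
    have i2: "integrable lborel (\<lambda>y. \<Phi> (x - y) *\<^sub>R ht V y)" by (rule integrable_mollifier_h_tilde[OF V m])
    have "(\<integral>y. u (x, S) y \<partial>lborel) = (\<integral>y. \<phi> x * ((S *v G (x - y)) \<bullet> ht V y) + q x \<bullet> (\<Phi> (x - y) *\<^sub>R ht V y) \<partial>lborel)"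
      by (rule Bochner_Integration.integral_cong[OF refl]) (simp add: u_def inner_add_left)
    also have "\<dots> = \<phi> x * (\<integral>y. (S *v G (x - y)) \<bullet> ht V y \<partial>lborel) + q x \<bullet> (\<integral>y. \<Phi> (x - y) *\<^sub>R ht V y \<partial>lborel)"
      using i1 i2 by (subst Bochner_Integration.integral_add) (simp_all del: inner_scaleR_right)
    also have "(\<integral>y. \<Phi> (x - y) *\<^sub>R ht V y \<partial>lborel) = h V x" by (simp only: h_eq)
    also note div_along_h[OF V m P, of x, symmetric]
    finally show ?thesis .
  qed
  have "(\<integral>(x, S). \<phi> x * div_along S (h V) x + q x \<bullet> h V x \<partial>V) = (\<integral>p. (\<integral>y. u p y \<partial>lborel) \<partial>V)"
    by (rule Bochner_Integration.integral_cong[OF refl])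
       (use outer bounded_varifold_space[OF V] in auto)
  also have "\<dots> = (\<integral>y. (\<integral>p. u p y \<partial>V) \<partial>lborel)"
    by (rule P.Fubini_integral[OF int, symmetric])
  finally show ?thesis unfolding inner .
qed

text \<open>With weight 1, \<open>dual\<close> is the smoothed first variation, of which
  \<open>ht\<close> is a nonpositive multiple at each point. Hence the mass has no first-order
  growth along a step.\<close>

lemma dissipation:
  assumes V: "bounded_varifold d R m V" and m: "m \<ge> 0"
  shows "(\<integral>(x, S). div_along S (h V) x \<partial>V) \<le> 0"
proof -
  have "(\<integral>(x, S). div_along S (h V) x \<partial>V) = (\<integral>(x, S). 1 * div_along S (h V) x + 0 \<bullet> h V x \<partial>V)" by simp
  also have "\<dots> = (\<integral>y. ht V y \<bullet> dual (\<lambda>_. 1) (\<lambda>_. 0) V y \<partial>lborel)"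
    by (rule first_variation_dual[OF V m]) (intro continuous_intros)+
  also have "\<dots> = - (\<integral>y. - (ht V y \<bullet> dual (\<lambda>_. 1) (\<lambda>_. 0) V y) \<partial>lborel)" by simp
  also have "\<dots> \<le> 0"
  proof -
    have "0 \<le> - (ht V y \<bullet> dual (\<lambda>_. 1) (\<lambda>_. 0) V y)" for y
    proof -
      have "dual (\<lambda>_. 1) (\<lambda>_. 0) V y = smoothed_first_variation \<psi> \<epsilon> V y"
        by (simp add: dual_def smoothed_first_variation_def)
      moreover have "0 \<le> 1 / (smoothed_mass \<psi> \<epsilon> V y + \<epsilon>)"
        using smoothed_mass_nonneg[of V y] eps by simp
      ultimately show ?thesis by (simp add: h_tilde_def)
    qed
    then have "0 \<le> (\<integral>y. - (ht V y \<bullet> dual (\<lambda>_. 1) (\<lambda>_. 0) V y) \<partial>lborel)"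
      by (intro Bochner_Integration.integral_nonneg)
    then show ?thesis by linarith
  qed
  finally show ?thesis .
qed

end

section \<open>One step of the scheme\<close>

lemma abs_trace_le:
  assumes S: "S \<in> grassmannian d" and A: "\<And>v. norm (A *v v) \<le> c * norm v"
  shows "\<bar>trace (S ** A)\<bar> \<le> real d * c"
proof -
  obtain s where s: "orthonormal_basis_of d (subspace_of S) s" using some_orthonormal_basis[OF S] by blast
  have "\<bar>s i \<bullet> (A *v s i)\<bar> \<le> c" if "i < d" for i
  proof -
    have "norm (s i) = 1" using orthonormal_basis_ofD(1)[OF s that that] by (simp add: norm_eq_1)
    then show ?thesis using Cauchy_Schwarz_ineq2[of "s i" "A *v s i"] A[of "s i"] by simp
  qed
  then have "\<bar>\<Sum>i<d. s i \<bullet> (A *v s i)\<bar> \<le> (\<Sum>i<d. c)"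
    by (intro order_trans[OF sum_abs] sum_mono) simp
  then show ?thesis by (simp add: trace_is_proj_mult[OF grassmannianD(1)[OF S] s])
qed

context mcf_kernel
begin

definition step_matrix :: "real \<Rightarrow> ((real ^ 'n) \<times> (real ^ 'n ^ 'n)) measure \<Rightarrow> real ^ 'n \<Rightarrow> real ^ 'n ^ 'n" where
  "step_matrix \<tau> V x = mat 1 + \<tau> *\<^sub>R jacobian (h V) (at x)"

definition step_density :: "nat \<Rightarrow> real \<Rightarrow> ((real ^ 'n) \<times> (real ^ 'n ^ 'n)) measure \<Rightarrow> real ^ 'n \<Rightarrow> real ^ 'n ^ 'n \<Rightarrow> real" where
  "step_density d \<tau> V x S = plane_jacobian d (step_matrix \<tau> V x) S"

definition step_plane :: "real \<Rightarrow> ((real ^ 'n) \<times> (real ^ 'n ^ 'n)) measure \<Rightarrow> real ^ 'n \<Rightarrow> real ^ 'n ^ 'n \<Rightarrow> real ^ 'n ^ 'n" where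
  "step_plane \<tau> V x S = image_plane (step_matrix \<tau> V x) S"

lemma step_matrix_mult: "step_matrix \<tau> V x *v v = v + \<tau> *\<^sub>R (jacobian (h V) (at x) *v v)"
  by (simp add: step_matrix_def matrix_vector_mult_add_rdistrib scaleR_matrix_vector_assoc)

lemma jacobian_step:
  assumes V: "bounded_varifold d R m V" and m: "m \<ge> 0"
  shows "jacobian (\<lambda>x. x + \<tau> *\<^sub>R h V x) (at x) = step_matrix \<tau> V x"
proof -
  let ?f = "\<lambda>x. x + \<tau> *\<^sub>R h V x"
  have d: "(?f has_derivative (\<lambda>v. v + \<tau> *\<^sub>R (jacobian (h V) (at x) *v v))) (at x)"
    by (intro has_derivative_add has_derivative_ident has_derivative_scaleR_right h_has_derivative_jacobian[OF V m])
  have "(?f has_derivative (\<lambda>v. jacobian ?f (at x) *v v)) (at x)"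
    using jacobian_works[of ?f "at x"] differentiableI[OF d] by blast
  from has_derivative_unique[OF this d] have "jacobian ?f (at x) *v v = step_matrix \<tau> V x *v v" for v
    unfolding step_matrix_mult by (rule fun_cong)
  then show ?thesis by (subst matrix_eq) simp
qed

text \<open>Fixes the order of quantifiers: \<open>K\<close> and \<open>\<tau>0\<close> depend on
  the mass bound \<open>m\<close> and not on the varifold or the radius of its support, so that the
  same constants work at every step. The actual mass bound \<open>m0\<close> is kept separate from
  \<open>m\<close> because it grows slowly from step to step.\<close>

definition step_consts :: "nat \<Rightarrow> real \<Rightarrow> real \<Rightarrow> real \<Rightarrow> bool" where
  "step_consts d m K \<tau>0 \<longleftrightarrow> 0 \<le> K \<and> 0 < \<tau>0 \<and> (\<forall>V R m0 \<tau> x S. bounded_varifold d R m0 V \<longrightarrow> 0 \<le> m0 \<longrightarrow> m0 \<le> m \<longrightarrow> 0 \<le> \<tau> \<longrightarrow> \<tau> \<le> \<tau>0 \<longrightarrow>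
    (\<forall>u. norm u \<le> 2 * norm (step_matrix \<tau> V x *v u)) \<and> (S \<in> grassmannian d \<longrightarrow>
     \<bar>step_density d \<tau> V x S - 1 - \<tau> * div_along S (h V) x\<bar> \<le> K * \<tau>\<^sup>2 \<and>
     \<bar>step_density d \<tau> V x S - 1\<bar> \<le> K * \<tau> \<and> 0 \<le> step_density d \<tau> V x S \<and>
     norm (step_plane \<tau> V x S - S) \<le> K * \<tau>))"

lemma step_consts_exist:
  assumes m: "m \<ge> 0"
  shows "\<exists>K \<tau>0. step_consts d m K \<tau>0"
proof -
  define c where "c = hbound m"
  have c: "c \<ge> 0" unfolding c_def by (rule hbound_nonneg[OF m])
  obtain K1 \<tau>1 where K1: "K1 \<ge> 0" "\<tau>1 > 0" and exp: "\<And>(A :: real ^ 'n ^ 'n) S \<tau>. (\<forall>v. norm (A *v v) \<le> c * norm v) \<Longrightarrow> S \<in> grassmannian d \<Longrightarrow>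
    0 \<le> \<tau> \<Longrightarrow> \<tau> \<le> \<tau>1 \<Longrightarrow> \<bar>plane_jacobian d (mat 1 + \<tau> *\<^sub>R A) S - 1 - \<tau> * trace (S ** A)\<bar> \<le> K1 * \<tau>\<^sup>2"
    using plane_jacobian_expansion[OF c, of d] by metis
  define n where "n = real CARD('n) * real CARD('n)"
  \<comment> \<open>The three summands are the quadratic error of the Jacobian, the bound for the
    divergence along a plane, and the rotation of the plane; the last is
    \<open>image_plane_diff\<close> with \<open>k = 2\<close> and
    \<open>\<eta> = \<tau> * c\<close>.\<close>
  define K where "K = K1 + real d * c + n * (4 * c)"
  have n: "n \<ge> 0" by (simp add: n_def)
  have K: "K \<ge> 0" "K1 \<le> K" "K1 + real d * c \<le> K" "n * (4 * c) \<le> K"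
    unfolding K_def using K1(1) c n by simp_all
  \<comment> \<open>The four thresholds ensure, in this order: validity of the expansion, tau^2
    \<le> tau, the lower bound with factor 2 through c tau \<le> 1/2, and nonnegativity of the
    density through K tau \<le> 1.\<close>
  define \<tau>0 where "\<tau>0 = min (min \<tau>1 1) (min (1 / (2 * (c + 1))) (1 / (K + 1)))"
  have \<tau>0: "\<tau>0 > 0" "\<tau>0 \<le> \<tau>1" "\<tau>0 \<le> 1" "\<tau>0 \<le> 1 / (2 * (c + 1))" "\<tau>0 \<le> 1 / (K + 1)"
    unfolding \<tau>0_def using K1(2) c K(1) by simp_all
  have c12: "c * \<tau>0 \<le> 1 / 2"
  proof -
    have "c * \<tau>0 \<le> c * (1 / (2 * (c + 1)))" by (rule mult_left_mono[OF \<tau>0(4) c])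
    also have "\<dots> \<le> 1 / 2" using c by (simp add: divide_simps)
    finally show ?thesis .
  qed
  have K1': "K * \<tau>0 \<le> 1"
  proof -
    have "K * \<tau>0 \<le> K * (1 / (K + 1))" by (rule mult_left_mono[OF \<tau>0(5) K(1)])
    also have "\<dots> \<le> 1" using K(1) by (simp add: divide_simps)
    finally show ?thesis .
  qed
  show ?thesis
    unfolding step_consts_def
  proof (rule exI[of _ K], rule exI[of _ \<tau>0], rule conjI[OF K(1)], rule conjI[OF \<tau>0(1)], intro allI impI)
    fix V :: "((real ^ 'n) \<times> (real ^ 'n ^ 'n)) measure" and R m0 \<tau> :: real and x :: "real ^ 'n" and S :: "real ^ 'n ^ 'n"
    assume V0: "bounded_varifold d R m0 V" and "0 \<le> m0" and "m0 \<le> m" and \<tau>: "0 \<le> \<tau>" "\<tau> \<le> \<tau>0"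
    have V: "bounded_varifold d R m V" by (rule bounded_varifold_mono[OF V0 order_refl \<open>m0 \<le> m\<close>])
    let ?A = "jacobian (h V) (at x)"
    have A: "norm (?A *v v) \<le> c * norm v" for v unfolding c_def by (rule norm_jacobian_h_le[OF V m])
    have low: "norm u \<le> 2 * norm (step_matrix \<tau> V x *v u)" for u
    proof -
      have "norm (\<tau> *\<^sub>R (?A *v u)) \<le> \<tau> * (c * norm u)"
        using \<tau>(1) A by (simp add: mult_left_mono)
      also have "\<dots> = (c * \<tau>) * norm u" by simp
      also have "\<dots> \<le> 1 / 2 * norm u"
        using mult_left_mono[OF \<tau>(2) c] c12 by (intro mult_right_mono) simp_all
      finally have "norm (\<tau> *\<^sub>R (?A *v u)) \<le> 1 / 2 * norm u" .
      moreover have "norm u \<le> norm (u + \<tau> *\<^sub>R (?A *v u)) + norm (\<tau> *\<^sub>R (?A *v u))"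
        using norm_triangle_ineq4[of "u + \<tau> *\<^sub>R (?A *v u)" "\<tau> *\<^sub>R (?A *v u)"] by simp
      ultimately show ?thesis unfolding step_matrix_mult by linarith
    qed
    have "\<bar>step_density d \<tau> V x S - 1 - \<tau> * div_along S (h V) x\<bar> \<le> K * \<tau>\<^sup>2 \<and>
     \<bar>step_density d \<tau> V x S - 1\<bar> \<le> K * \<tau> \<and> 0 \<le> step_density d \<tau> V x S \<and>
     norm (step_plane \<tau> V x S - S) \<le> K * \<tau>" if S: "S \<in> grassmannian d"
    proof -
    have \<tau>1: "\<tau> \<le> \<tau>1" using \<tau> \<tau>0(2) by linarith
    have e1: "\<bar>step_density d \<tau> V x S - 1 - \<tau> * div_along S (h V) x\<bar> \<le> K1 * \<tau>\<^sup>2"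
      unfolding step_density_def step_matrix_def div_along_def
      by (rule exp[OF _ S \<tau>(1) \<tau>1]) (rule allI, rule A)
    have \<tau>2: "\<tau>\<^sup>2 \<le> \<tau>" using \<tau> \<tau>0(3) by (simp add: power2_eq_square mult_left_le)
    have tr: "\<bar>div_along S (h V) x\<bar> \<le> real d * c"
      unfolding div_along_def by (rule abs_trace_le[OF S A])
    have "\<bar>\<tau> * div_along S (h V) x\<bar> \<le> \<tau> * (real d * c)"
      unfolding abs_mult using \<tau> tr by (intro mult_mono) simp_all
    moreover have "K1 * \<tau>\<^sup>2 \<le> K1 * \<tau>" using \<tau>2 K1(1) by (rule mult_left_mono)
    ultimately have "\<bar>step_density d \<tau> V x S - 1\<bar> \<le> K1 * \<tau> + \<tau> * (real d * c)"
      using e1 by linarith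
    also have "\<dots> = (K1 + real d * c) * \<tau>" by (simp add: algebra_simps)
    also have "\<dots> \<le> K * \<tau>" using K(3) \<tau>(1) by (rule mult_right_mono)
    finally have e2: "\<bar>step_density d \<tau> V x S - 1\<bar> \<le> K * \<tau>" .
    have "K * \<tau> \<le> 1" using mult_left_mono[OF \<tau>(2) K(1)] K1' by linarith
    then have e3: "0 \<le> step_density d \<tau> V x S" using e2 by linarith
    have P: "is_proj S" by (rule grassmannianD(1)[OF S])
    have "norm (image_plane (step_matrix \<tau> V x) S - image_plane (mat 1) S) \<le> real CARD('n) * real CARD('n) * (2 * 2 * (\<tau> * c))"
    proof (rule image_plane_diff[OF low _ P P])
      fix u :: "real ^ 'n"
      show "norm u \<le> 2 * norm (mat 1 *v u)" by simp
      have "norm ((step_matrix \<tau> V x ** S) *v u - (mat 1 ** S) *v u) = \<tau> * norm (?A *v (S *v u))"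
        using \<tau>(1) by (simp add: matrix_vector_mul_assoc[symmetric] step_matrix_mult)
      also have "\<dots> \<le> \<tau> * (c * norm (S *v u))" using \<tau>(1) A by (intro mult_left_mono)
      also have "\<dots> \<le> \<tau> * (c * norm u)" using \<tau>(1) c norm_is_proj_le[OF P] by (intro mult_left_mono)
      finally show "norm ((step_matrix \<tau> V x ** S) *v u - (mat 1 ** S) *v u) \<le> \<tau> * c * norm u" by simp
    qed (use \<tau>(1) c in simp_all)
    then have "norm (step_plane \<tau> V x S - S) \<le> (n * (4 * c)) * \<tau>"
      unfolding step_plane_def image_plane_id[OF P] n_def by (simp add: mult_ac)
    also have "\<dots> \<le> K * \<tau>" using K(4) \<tau>(1) by (rule mult_right_mono)
    finally have e4: "norm (step_plane \<tau> V x S - S) \<le> K * \<tau>" .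
    have "K1 * \<tau>\<^sup>2 \<le> K * \<tau>\<^sup>2" using K(2) by (rule mult_right_mono) simp
    then show ?thesis using e1 e2 e3 e4 by (intro conjI) linarith+
    qed
    then show "(\<forall>u. norm u \<le> 2 * norm (step_matrix \<tau> V x *v u)) \<and> (S \<in> grassmannian d \<longrightarrow> \<bar>step_density d \<tau> V x S - 1 - \<tau> * div_along S (h V) x\<bar> \<le> K * \<tau>\<^sup>2 \<and>
     \<bar>step_density d \<tau> V x S - 1\<bar> \<le> K * \<tau> \<and> 0 \<le> step_density d \<tau> V x S \<and>
     norm (step_plane \<tau> V x S - S) \<le> K * \<tau>)"
      using low by blast
  qed
qed

context
  fixes d :: nat and m K \<tau>0 R m0 \<tau> :: real and V :: "((real ^ 'n) \<times> (real ^ 'n ^ 'n)) measure"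
  assumes sc: "step_consts d m K \<tau>0" and V: "bounded_varifold d R m0 V" and m0: "0 \<le> m0" "m0 \<le> m" and \<tau>: "0 \<le> \<tau>" "\<tau> \<le> \<tau>0"
begin

lemma step_bounds:
  assumes "S \<in> grassmannian d"
  shows "\<bar>step_density d \<tau> V x S - 1 - \<tau> * div_along S (h V) x\<bar> \<le> K * \<tau>\<^sup>2"
    "\<bar>step_density d \<tau> V x S - 1\<bar> \<le> K * \<tau>" "0 \<le> step_density d \<tau> V x S"
    "norm (step_plane \<tau> V x S - S) \<le> K * \<tau>"
  using sc V m0 \<tau> assms unfolding step_consts_def by blast+

lemma step_matrix_lower: "norm u \<le> 2 * norm (step_matrix \<tau> V x *v u)"
  using sc V m0 \<tau> unfolding step_consts_def by blast

lemma step_K: "K \<ge> 0" using sc by (simp add: step_consts_def)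

lemma norm_h_le_m: "norm (h V x) \<le> hbound m"
  by (rule norm_h_le[OF bounded_varifold_mono[OF V order_refl m0(2)] order_trans[OF m0]])

lemma plane_map_step: "plane_map d (\<lambda>x. x + \<tau> *\<^sub>R h V x) (step_matrix \<tau> V) 2"
proof
  show "norm u \<le> 2 * norm (step_matrix \<tau> V x *v u)" for x u by (rule step_matrix_lower)
  show "jacobian (\<lambda>x. x + \<tau> *\<^sub>R h V x) (at x) = step_matrix \<tau> V x" for x by (rule jacobian_step[OF V m0(1)])
  show "continuous_on UNIV (\<lambda>x. x + \<tau> *\<^sub>R h V x)" by (intro continuous_intros h_continuous[OF V m0(1)])
  show "continuous_on UNIV (step_matrix \<tau> V)"
    unfolding step_matrix_def[abs_def] by (intro continuous_intros continuous_on_jacobian_h[OF V m0(1)])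
  show "0 \<le> plane_jacobian d (step_matrix \<tau> V x) S" if "S \<in> grassmannian d" for x S
    using step_bounds(3)[OF that] by (simp add: step_density_def)
qed simp

interpretation plane_map d "\<lambda>x. x + \<tau> *\<^sub>R h V x" "step_matrix \<tau> V" 2
  by (rule plane_map_step)

lemma step_plane_grassmannian: "S \<in> grassmannian d \<Longrightarrow> step_plane \<tau> V x S \<in> grassmannian d"
  unfolding step_plane_def by (rule lift_grassmannian)

lemma continuous_on_step_density: "continuous_on (grassmann_bundle d) (\<lambda>(x, S). step_density d \<tau> V x S)"
  unfolding step_density_def by (rule continuous_on_J)

lemma continuous_on_step_map: "continuous_on (grassmann_bundle d) (\<lambda>(x, S). (x + \<tau> *\<^sub>R h V x, step_plane \<tau> V x S))"
  unfolding step_plane_def by (rule continuous_on_lift)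

lemma integral_flow_step:
  fixes q :: "(real ^ 'n) \<times> (real ^ 'n ^ 'n) \<Rightarrow> real"
  assumes q: "continuous_on (grassmann_bundle d) q"
  shows "(\<integral>p. q p \<partial>flow_step d \<psi> \<epsilon> \<tau> V) =
    (\<integral>(x, S). step_density d \<tau> V x S * q (x + \<tau> *\<^sub>R h V x, step_plane \<tau> V x S) \<partial>V)"
    "continuous_on (grassmann_bundle d) (\<lambda>(x, S). step_density d \<tau> V x S * q (x + \<tau> *\<^sub>R h V x, step_plane \<tau> V x S))"
proof -
  show "(\<integral>p. q p \<partial>flow_step d \<psi> \<epsilon> \<tau> V) =
    (\<integral>(x, S). step_density d \<tau> V x S * q (x + \<tau> *\<^sub>R h V x, step_plane \<tau> V x S) \<partial>V)"
    unfolding flow_step_def step_density_def step_plane_def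
    by (subst integral_push_forward[OF bounded_varifold_sets[OF V] borel_measurable_continuous_on_bundle[OF refl q]])
       (simp add: split_beta')
  have "continuous_on (grassmann_bundle d) (\<lambda>p. q ((\<lambda>(x, S). (x + \<tau> *\<^sub>R h V x, step_plane \<tau> V x S)) p))"
    by (rule continuous_on_compose2[OF q continuous_on_step_map]) (auto intro: step_plane_grassmannian)
  from continuous_on_mult[OF continuous_on_step_density this]
  show "continuous_on (grassmann_bundle d) (\<lambda>(x, S). step_density d \<tau> V x S * q (x + \<tau> *\<^sub>R h V x, step_plane \<tau> V x S))"
    by (simp add: split_beta')
qed

text \<open>The new mass is the integral of the Jacobian, whose linear term is nonpositive by
  \<open>dissipation\<close>, so only the quadratic error remains. The bound starts from
  \<open>m0\<close>, not from \<open>m\<close>, so that the gains can be added up over many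
  steps.\<close>

lemma bounded_varifold_flow_step:
  "bounded_varifold d (R + \<tau> * hbound m) (m0 + K * m * \<tau>\<^sup>2) (flow_step d \<psi> \<epsilon> \<tau> V)"
  unfolding flow_step_def
proof (rule bounded_varifold_push_forward[OF V])
  fix x :: "real ^ 'n" assume x: "norm x \<le> R"
  have "norm (\<tau> *\<^sub>R h V x) \<le> \<tau> * hbound m" using \<tau>(1) norm_h_le_m by (simp add: mult_left_mono)
  then show "norm (x + \<tau> *\<^sub>R h V x) \<le> R + \<tau> * hbound m"
    using x norm_triangle_ineq[of x "\<tau> *\<^sub>R h V x"] by linarith
next
  interpret V: finite_measure V by (rule bounded_varifold_finite[OF V])
  let ?J = "\<lambda>(x, S). plane_jacobian d (step_matrix \<tau> V x) S"
  let ?D = "\<lambda>(x, S). div_along S (h V) x"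
  have intJ: "integrable V ?J" by (rule bounded_varifold_integrable_continuous[OF V continuous_on_J])
  have "continuous_on (grassmann_bundle d) ?D"
    unfolding div_along_def split_beta'
    by (intro continuous_intros continuous_on_compose2[OF continuous_on_jacobian_h[OF V m0(1)]]) auto
  then have intD: "integrable V ?D" by (rule bounded_varifold_integrable_continuous[OF V])
  have K2: "0 \<le> K * \<tau>\<^sup>2" using step_K by simp
  have "(\<integral>p. ?J p \<partial>V) \<le> (\<integral>p. 1 + \<tau> * ?D p + K * \<tau>\<^sup>2 \<partial>V)"
  proof (rule integral_mono_AE[OF intJ])
    show "integrable V (\<lambda>p. 1 + \<tau> * ?D p + K * \<tau>\<^sup>2)" using intD by simp
    show "AE p in V. ?J p \<le> 1 + \<tau> * ?D p + K * \<tau>\<^sup>2"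
      using bounded_varifold_AE[OF V]
    proof eventually_elim
      case (elim p)
      obtain x S where p: "p = (x, S)" by (cases p)
      have "S \<in> grassmannian d" using elim p by simp
      from step_bounds(1)[OF this, of x] show ?case unfolding p step_density_def by simp
    qed
  qed
  also have "\<dots> = measure V (space V) + \<tau> * (\<integral>p. ?D p \<partial>V) + K * \<tau>\<^sup>2 * measure V (space V)"
    using intD by (simp add: mult.commute)
  also have "\<dots> \<le> m0 + 0 + K * \<tau>\<^sup>2 * m"
  proof (intro add_mono)
    show mV: "measure V (space V) \<le> m0" by (rule bounded_varifold_measure[OF V m0(1)])
    show "\<tau> * (\<integral>p. ?D p \<partial>V) \<le> 0" using dissipation[OF V m0(1)] \<tau>(1) by (simp add: mult_nonneg_nonpos)
    show "K * \<tau>\<^sup>2 * measure V (space V) \<le> K * \<tau>\<^sup>2 * m" using mV m0(2) K2 by (intro mult_left_mono) linarith+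
  qed
  finally show "(\<integral>p. ?J p \<partial>V) \<le> m0 + K * m * \<tau>\<^sup>2" by (simp add: mult_ac)
qed

end

end

section \<open>Uniform subdivisions\<close>

definition uniform_subdivision :: "nat \<Rightarrow> real list" where
  "uniform_subdivision N = map (\<lambda>i. real i / real N) [0..<Suc N]"

lemma nth_uniform_subdivision: "i \<le> N \<Longrightarrow> uniform_subdivision N ! i = real i / real N"
  unfolding uniform_subdivision_def by (simp add: nth_map_upt del: upt_Suc)

lemma length_uniform_subdivision: "length (uniform_subdivision N) = Suc N"
  by (simp add: uniform_subdivision_def del: upt_Suc)

lemma subdivision_uniform:
  assumes "N \<ge> 1" shows "subdivision (uniform_subdivision N)"
proof -
  let ?u = "uniform_subdivision N"
  have ne: "?u \<noteq> []" using length_uniform_subdivision[of N] by auto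
  have "hd ?u = 0" using ne nth_uniform_subdivision[of 0 N] by (simp add: hd_conv_nth)
  moreover have "last ?u = 1"
    using ne assms nth_uniform_subdivision[of N N] by (simp add: last_conv_nth length_uniform_subdivision)
  moreover have "sorted_wrt (<) ?u"
    unfolding sorted_wrt_iff_nth_less length_uniform_subdivision
  proof (intro allI impI)
    fix i j assume "i < j" "j < Suc N"
    then show "?u ! i < ?u ! j" using assms by (simp add: nth_uniform_subdivision divide_strict_right_mono)
  qed
  ultimately show ?thesis using ne by (simp add: subdivision_def)
qed

lemma mesh_uniform: assumes "N \<ge> 1" shows "mesh (uniform_subdivision N) = 1 / real N"
proof -
  let ?u = "uniform_subdivision N"
  have step: "?u ! Suc i - ?u ! i = 1 / real N" if "Suc i < length ?u" for i
    using that by (simp add: nth_uniform_subdivision length_uniform_subdivision diff_divide_distrib[symmetric])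
  have "{?u ! Suc i - ?u ! i | i. Suc i < length ?u} = {1 / real N}"
  proof (intro equalityI subsetI)
    fix r assume "r \<in> {1 / real N}"
    moreover have "Suc 0 < length ?u" using assms by (simp add: length_uniform_subdivision)
    ultimately show "r \<in> {?u ! Suc i - ?u ! i | i. Suc i < length ?u}" using step[of 0] by force
  next
    fix r assume "r \<in> {?u ! Suc i - ?u ! i | i. Suc i < length ?u}"
    then show "r \<in> {1 / real N}" using step by blast
  qed
  then show ?thesis by (simp add: mesh_def)
qed

text \<open>Truncated subtraction makes the index at \<open>t = 0\<close> equal to \<open>0\<close>.\<close>

definition left_index :: "nat \<Rightarrow> real \<Rightarrow> nat" where
  "left_index N t = nat \<lceil>real N * t\<rceil> - 1"

lemma left_index_0: "left_index N 0 = 0" by (simp add: left_index_def)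

text \<open>The ceiling assigns a node to the interval on its left, in agreement with the least
  index used in \<open>discrete_flow\<close>.\<close>

lemma left_index_bounds:
  assumes N: "N \<ge> 1" and t: "0 < t" "t \<le> 1"
  shows "nat \<lceil>real N * t\<rceil> = Suc (left_index N t)" "left_index N t < N"
    "real (left_index N t) / real N < t" "t \<le> real (Suc (left_index N t)) / real N"
proof -
  let ?c = "nat \<lceil>real N * t\<rceil>"
  have Nt: "0 < real N * t" "real N * t \<le> real N" using N t by (auto simp: mult_left_le)
  have pos: "\<lceil>real N * t\<rceil> > 0" using Nt by simp
  have c: "real N * t \<le> real ?c" "real ?c < real N * t + 1"
    using pos ceiling_correct[of "real N * t"] by auto
  show eq: "?c = Suc (left_index N t)" using pos by (simp add: left_index_def)
  have "?c \<le> N" using Nt(2) by (simp add: ceiling_le_iff nat_le_iff)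
  then show "left_index N t < N" using eq by simp
  have "real (left_index N t) = real ?c - 1" using eq by simp
  then show "real (left_index N t) / real N < t" using c(2) N by (simp add: divide_less_eq mult.commute)
  show "t \<le> real (Suc (left_index N t)) / real N" using c(1) N unfolding eq by (simp add: le_divide_eq mult.commute)
qed

lemma left_index_unit:
  assumes N: "N \<ge> 1" and t: "0 \<le> t" "t \<le> 1"
  shows "left_index N t < N" "real (left_index N t) / real N \<le> t" "t - real (left_index N t) / real N \<le> 1 / real N"
proof -
  have "left_index N t < N \<and> real (left_index N t) / real N \<le> t \<and> t - real (left_index N t) / real N \<le> 1 / real N"
  proof (cases "t = 0")
    case True then show ?thesis using N by (simp add: left_index_0)
  next
    case False
    then have "t > 0" using t by simp
    from left_index_bounds[OF N this t(2)] show ?thesis by (simp add: add_divide_distrib)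
  qed
  then show "left_index N t < N" "real (left_index N t) / real N \<le> t" "t - real (left_index N t) / real N \<le> 1 / real N"
    by blast+
qed

lemma left_index_mono: "s \<le> t \<Longrightarrow> left_index N s \<le> left_index N t"
  unfolding left_index_def by (intro diff_le_mono nat_mono ceiling_mono mult_left_mono) auto

lemma discrete_flow_uniform:
  assumes N: "N \<ge> 1" and t: "0 < t" "t \<le> 1"
  shows "discrete_flow d \<psi> \<epsilon> V\<^sub>0 (uniform_subdivision N) t =
    flow_step d \<psi> \<epsilon> (t - real (left_index N t) / real N) (discrete_flow_node d \<psi> \<epsilon> V\<^sub>0 (uniform_subdivision N) (left_index N t))"
proof -
  note b = left_index_bounds[OF N t]
  have "(LEAST k. t \<le> uniform_subdivision N ! k) = Suc (left_index N t)"
  proof (rule Least_equality)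
    show "t \<le> uniform_subdivision N ! Suc (left_index N t)"
      using b(2,4) by (simp add: nth_uniform_subdivision)
    fix k assume k: "t \<le> uniform_subdivision N ! k"
    show "Suc (left_index N t) \<le> k"
    \<comment> \<open>The least index is taken over all naturals, and entries beyond the list are
      unspecified; such indices exceed the claimed minimum anyway.\<close>
    proof (cases "k \<le> N")
      case True
      then have "t \<le> real k / real N" using k by (simp add: nth_uniform_subdivision)
      then have "real N * t \<le> real k" using N by (simp add: le_divide_eq mult.commute)
      then have "nat \<lceil>real N * t\<rceil> \<le> k" by (simp add: ceiling_le_iff nat_le_iff)
      then show ?thesis using b(1) by simp
    next
      case False then show ?thesis using b(2) by simp
    qed
  qed
  then show ?thesis using b(2) by (simp add: discrete_flow_def nth_uniform_subdivision)
qed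

lemma discrete_flow_0: "discrete_flow d \<psi> \<epsilon> V\<^sub>0 (uniform_subdivision N) 0 = V\<^sub>0"
proof -
  have "(LEAST k. 0 \<le> uniform_subdivision N ! k) = 0"
    by (rule Least_eq_0) (simp add: nth_uniform_subdivision)
  then show ?thesis by (simp add: discrete_flow_def)
qed

section \<open>Mass and support bounds along the uniform scheme\<close>

locale mcf_scheme = mcf_kernel \<psi> \<epsilon> for \<psi> :: "real ^ 'n \<Rightarrow> real" and \<epsilon> :: real +
  fixes d :: nat and M R0 K \<tau>0 :: real and V\<^sub>0 :: "((real ^ 'n) \<times> (real ^ 'n ^ 'n)) measure"
  assumes M: "M \<ge> 0" and V0: "bounded_varifold d R0 M V\<^sub>0" and sc: "step_consts d (M + 1) K \<tau>0"
begin

abbreviation "node N i \<equiv> discrete_flow_node d \<psi> \<epsilon> V\<^sub>0 (uniform_subdivision N) i"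

text \<open>The last condition says that N steps, each gaining at most \<open>K * (M + 1)\<close> /
  N^2, add at most 1 to the mass.\<close>

definition "fine_enough N \<longleftrightarrow> N \<ge> 1 \<and> 1 / real N \<le> \<tau>0 \<and> K * (M + 1) * (1 / real N) \<le> 1"

text \<open>The radius reached from \<open>R0\<close> when points move with speed at most
  \<open>hbound (M + 1)\<close> for a total time of at most 1.\<close>

definition "R1 = R0 + hbound (M + 1)"

lemma hb: "hbound (M + 1) \<ge> 0" using M by (intro hbound_nonneg) simp

lemma K_nonneg: "K \<ge> 0" and \<tau>0_pos: "\<tau>0 > 0" using sc by (simp_all add: step_consts_def)

lemma fine_enough_eventually: "\<exists>N0. \<forall>N\<ge>N0. fine_enough N"
proof -
  have "(\<lambda>N. 1 / real N) \<longlonglongrightarrow> 0" by (rule lim_1_over_n)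
  then have e1: "\<forall>\<^sub>F N in sequentially. 1 / real N < \<tau>0" using \<tau>0_pos by (rule order_tendstoD(2))
  have "(\<lambda>N. K * (M + 1) * (1 / real N)) \<longlonglongrightarrow> K * (M + 1) * 0" by (intro tendsto_mult_left lim_1_over_n)
  then have e2: "\<forall>\<^sub>F N in sequentially. K * (M + 1) * (1 / real N) < 1" by (rule order_tendstoD(2)) simp
  have e3: "\<forall>\<^sub>F N in sequentially. N \<ge> (1::nat)" by (rule eventually_ge_at_top)
  have "\<forall>\<^sub>F N in sequentially. fine_enough N"
    using e1 e2 e3 by eventually_elim (simp add: fine_enough_def)
  then show ?thesis by (simp add: eventually_sequentially)
qed

lemma node_Suc: "i < N \<Longrightarrow> node N (Suc i) = flow_step d \<psi> \<epsilon> (1 / real N) (node N i)"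
  by (simp add: nth_uniform_subdivision diff_divide_distrib[symmetric])

lemma node_mass_le:
  assumes N: "fine_enough N" and i: "i \<le> N"
  shows "0 \<le> M + real i / real N * (K * (M + 1) / real N)" "M + real i / real N * (K * (M + 1) / real N) \<le> M + 1"
proof -
  have N1: "real N > 0" using N by (simp add: fine_enough_def)
  have q: "0 \<le> real i / real N" "real i / real N \<le> 1" using N1 i by simp_all
  have r: "0 \<le> K * (M + 1) / real N" "K * (M + 1) / real N \<le> 1"
    using N K_nonneg M N1 by (simp_all add: fine_enough_def)
  have "real i / real N * (K * (M + 1) / real N) \<le> 1 * 1" by (rule mult_mono[OF q(2) r(2)]) (use r in simp_all)
  moreover have "0 \<le> real i / real N * (K * (M + 1) / real N)" by (rule mult_nonneg_nonneg[OF q(1) r(1)])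
  ultimately show "0 \<le> M + real i / real N * (K * (M + 1) / real N)" "M + real i / real N * (K * (M + 1) / real N) \<le> M + 1"
    using M by linarith+
qed

text \<open>The accumulated bounds have to form the induction hypothesis: a step adds to the mass
  bound, so the plain bound \<open>M + 1\<close> would not reproduce itself. That the accumulated
  bound never exceeds \<open>M + 1\<close> keeps the step constants applicable.\<close>

lemma node_bounded_precise:
  assumes N: "fine_enough N"
  shows "i \<le> N \<Longrightarrow> bounded_varifold d (R0 + real i / real N * hbound (M + 1)) (M + real i / real N * (K * (M + 1) / real N)) (node N i)"
proof (induction i)
  case 0
  show ?case using V0 by simp
next
  case (Suc i)
  then have i: "i \<le> N" "i < N" by simp_all
  have IH: "bounded_varifold d (R0 + real i / real N * hbound (M + 1)) (M + real i / real N * (K * (M + 1) / real N)) (node N i)"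
    by (rule Suc.IH[OF i(1)])
  have \<tau>: "0 \<le> 1 / real N" "1 / real N \<le> \<tau>0" using N by (simp_all add: fine_enough_def)
  have "bounded_varifold d (R0 + real i / real N * hbound (M + 1) + 1 / real N * hbound (M + 1))
      (M + real i / real N * (K * (M + 1) / real N) + K * (M + 1) * (1 / real N)\<^sup>2) (node N (Suc i))"
    unfolding node_Suc[OF i(2)] by (rule bounded_varifold_flow_step[OF sc IH node_mass_le[OF N i(1)] \<tau>])
  then show ?case by (simp add: add_divide_distrib algebra_simps power2_eq_square)
qed

lemma node_bounded:
  assumes N: "fine_enough N" and i: "i \<le> N"
  shows "bounded_varifold d R1 (M + 1) (node N i)"
proof (rule bounded_varifold_mono[OF node_bounded_precise[OF N i] _ node_mass_le(2)[OF N i]])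
  have "real i / real N \<le> 1" using i by (cases "N = 0") simp_all
  then have "real i / real N * hbound (M + 1) \<le> 1 * hbound (M + 1)" by (rule mult_right_mono[OF _ hb])
  then show "R0 + real i / real N * hbound (M + 1) \<le> R1" unfolding R1_def by simp
qed

text \<open>A partial step adds less than a full one, so its bounds lie below those of the following
  node.\<close>

lemma node_step_bounded:
  assumes N: "fine_enough N" and i: "i < N" and \<tau>: "0 \<le> \<tau>" "\<tau> \<le> 1 / real N"
  shows "bounded_varifold d R1 (M + 1) (flow_step d \<psi> \<epsilon> \<tau> (node N i))"
proof -
  have i': "i \<le> N" and Si: "Suc i \<le> N" using i by simp_all
  have N1: "real N > 0" using i by simp
  have \<tau>0: "\<tau> \<le> \<tau>0" using N \<tau> by (simp add: fine_enough_def)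
  note B = bounded_varifold_flow_step[OF sc node_bounded_precise[OF N i'] node_mass_le[OF N i'] \<tau>(1) \<tau>0]
  show ?thesis
  proof (rule bounded_varifold_mono[OF B])
    have "real (Suc i) / real N \<le> 1" using N1 Si by simp
    then have *: "real i / real N + 1 / real N \<le> 1" by (simp add: add_divide_distrib add.commute)
    have "real i / real N + \<tau> \<le> 1" using * \<tau>(2) by linarith
    then have "(real i / real N + \<tau>) * hbound (M + 1) \<le> 1 * hbound (M + 1)" by (rule mult_right_mono[OF _ hb])
    then show "R0 + real i / real N * hbound (M + 1) + \<tau> * hbound (M + 1) \<le> R1"
      unfolding R1_def by (simp add: distrib_right)
    have "\<tau>\<^sup>2 \<le> (1 / real N)\<^sup>2" by (rule power_mono[OF \<tau>(2,1)])
    then have "K * (M + 1) * \<tau>\<^sup>2 \<le> K * (M + 1) * (1 / real N)\<^sup>2"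
      using K_nonneg M by (intro mult_left_mono) simp_all
    then have "M + real i / real N * (K * (M + 1) / real N) + K * (M + 1) * \<tau>\<^sup>2 \<le>
        M + real (Suc i) / real N * (K * (M + 1) / real N)"
      by (simp add: add_divide_distrib algebra_simps power2_eq_square)
    also have "\<dots> \<le> M + 1" by (rule node_mass_le(2)[OF N Si])
    finally show "M + real i / real N * (K * (M + 1) / real N) + K * (M + 1) * \<tau>\<^sup>2 \<le> M + 1" .
  qed
qed

lemma discrete_flow_bounded:
  assumes N: "fine_enough N" and t: "0 \<le> t" "t \<le> 1"
  shows "bounded_varifold d R1 (M + 1) (discrete_flow d \<psi> \<epsilon> V\<^sub>0 (uniform_subdivision N) t)"
proof (cases "t = 0")
  case True
  then show ?thesis using node_bounded[OF N, of 0] by (simp add: discrete_flow_0)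
next
  case False
  then have t0: "t > 0" using t by simp
  have N1: "N \<ge> 1" using N by (simp add: fine_enough_def)
  note b = left_index_unit[OF N1 t]
  show ?thesis
    unfolding discrete_flow_uniform[OF N1 t0 t(2)]
    by (rule node_step_bounded[OF N b(1) _ b(3)]) (use b(2) in simp)
qed

end

section \<open>Weak limits\<close>

definition cutoff :: "real \<Rightarrow> real ^ 'n \<Rightarrow> real" where
  "cutoff r x = max 0 (min 1 (r + 1 - norm x))"

lemma cutoff_bounds: "0 \<le> cutoff r x" "cutoff r x \<le> 1"
  by (simp_all add: cutoff_def)

lemma cutoff_inside: "norm x \<le> r \<Longrightarrow> cutoff r x = 1"
  by (simp add: cutoff_def)

lemma cutoff_outside: "norm x \<ge> r + 1 \<Longrightarrow> cutoff r x = 0"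
  by (simp add: cutoff_def)

lemma compact_cball_bundle: "compact (cball (0 :: real ^ 'n) r \<times> (grassmannian d :: (real ^ 'n ^ 'n) set))"
  by (intro compact_Times compact_cball compact_grassmannian)

lemma test_functionI:
  fixes g :: "(real ^ 'n) \<times> (real ^ 'n ^ 'n) \<Rightarrow> real"
  assumes g: "continuous_on (grassmann_bundle d) g" and z: "\<And>x S. norm x > r \<Longrightarrow> g (x, S) = 0"
  shows "test_function d g"
  unfolding test_function_def
proof (intro conjI exI[of _ "cball 0 r \<times> grassmannian d"] g compact_cball_bundle ballI)
  fix p :: "(real ^ 'n) \<times> (real ^ 'n ^ 'n)"
  assume p: "p \<in> grassmann_bundle d - cball 0 r \<times> grassmannian d"
  obtain x S where "p = (x, S)" by (cases p)
  then show "g p = 0" using p z by auto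
qed auto

lemma continuous_on_cutoff: "continuous_on (grassmann_bundle d) (\<lambda>(x :: real ^ 'n, S :: real ^ 'n ^ 'n). cutoff r x)"
  unfolding cutoff_def split_beta' by (intro continuous_intros)

lemma test_function_cutoff:
  fixes g :: "(real ^ 'n) \<times> (real ^ 'n ^ 'n) \<Rightarrow> real"
  assumes g: "continuous_on (grassmann_bundle d) g"
  shows "test_function d (\<lambda>(x, S). cutoff r x * g (x, S))"
proof (rule test_functionI)
  show "continuous_on (grassmann_bundle d) (\<lambda>(x, S). cutoff r x * g (x, S))"
    using continuous_on_mult[OF continuous_on_cutoff[of d r] g] by (simp add: split_beta')
  show "(\<lambda>(x, S). cutoff r x * g (x, S)) (x, S) = 0" if "norm x > r + 1" for x S
    using that cutoff_outside[of r x] by simp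
qed

text \<open>A priori the limit is finite only on compact sets, and the constant 1 is not a test
  function. A cutoff bounds the mass of each compact cylinder by \<open>m\<close>, and the cylinders
  exhaust the bundle.\<close>

lemma weak_limit_mass:
  fixes V :: "((real ^ 'n) \<times> (real ^ 'n ^ 'n)) measure"
  assumes W: "\<And>j. bounded_varifold d R m (W j)" and lim: "weak_star_limit d W V"
    and V: "V \<in> varifolds d" and m: "m \<ge> 0"
  shows "emeasure V (space V) \<le> ennreal m"
proof -
  have sV: "sets V = sets (grassmann_borel d)" using V by (simp add: varifolds_def)
  have spV: "space V = UNIV \<times> grassmannian d"
    using sets_eq_imp_space_eq[OF sV] space_grassmann_borel by metis
  define C where "C r = cball (0 :: real ^ 'n) r \<times> (grassmannian d :: (real ^ 'n ^ 'n) set)" for r :: real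
  have compC: "compact (C r)" "C r \<subseteq> grassmann_bundle d" for r
    unfolding C_def by (rule compact_cball_bundle) auto
  have finC: "emeasure V (C r) < \<infinity>" for r using V compC[of r] by (simp add: varifolds_def)
  have mC: "C r \<in> sets V" for r
  proof -
    have "C r \<inter> (UNIV \<times> grassmannian d) \<in> sets (grassmann_borel d)"
      unfolding sets_restrict_space using borel_compact[OF compC(1)[of r]] by blast
    moreover have "C r \<inter> (UNIV \<times> grassmannian d) = C r" using compC(2) by blast
    ultimately show ?thesis using sV by simp
  qed
  have le: "emeasure V (C r) \<le> ennreal m" for r
  proof -
    let ?\<chi> = "\<lambda>(x :: real ^ 'n, S :: real ^ 'n ^ 'n). cutoff r x"
    have meas: "?\<chi> \<in> borel_measurable V" by (rule borel_measurable_continuous_on_bundle[OF sV continuous_on_cutoff])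
    have ind: "integrable V (indicator (C r') :: _ \<Rightarrow> real)" for r'
      using mC finC by (intro integrable_real_indicator) auto
    have int: "integrable V ?\<chi>"
    proof (rule Bochner_Integration.integrable_bound[OF ind[of "r + 1"] meas], rule AE_I2)
      fix p assume "p \<in> space V"
      then obtain x S where p: "p = (x, S)" "S \<in> grassmannian d" using spV by auto
      show "norm (?\<chi> p) \<le> norm (indicator (C (r + 1)) p :: real)"
      proof (cases "norm x \<le> r + 1")
        case True then show ?thesis using cutoff_bounds[of r x] p by (simp add: C_def)
      next
        case False then show ?thesis using cutoff_outside[of r x] p by simp
      qed
    qed
    have "test_function d (\<lambda>(x :: real ^ 'n, S :: real ^ 'n ^ 'n). cutoff r x * 1)"
      using test_function_cutoff[of d "\<lambda>_. 1" r] by (simp add: split_beta')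
    then have tf: "test_function d ?\<chi>" by simp
    then have "(\<lambda>j. \<integral>p. ?\<chi> p \<partial>W j) \<longlonglongrightarrow> (\<integral>p. ?\<chi> p \<partial>V)" using lim unfolding weak_star_limit_def by blast
    moreover have "(\<integral>p. ?\<chi> p \<partial>W j) \<le> m" for j
    proof -
      have "norm (\<integral>p. ?\<chi> p \<partial>W j) \<le> 1 * m"
        by (rule bounded_varifold_integral_le[OF W m]) (simp_all add: abs_of_nonneg[OF cutoff_bounds(1)] cutoff_bounds(2))
      then show ?thesis by simp
    qed
    ultimately have "(\<integral>p. ?\<chi> p \<partial>V) \<le> m" by (intro LIMSEQ_le_const2) auto
    moreover have "measure V (C r) \<le> (\<integral>p. ?\<chi> p \<partial>V)"
    proof -
      have "measure V (C r) = (\<integral>p. indicator (C r) p \<partial>V)"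
        using mC[of r] sets.sets_into_space[OF mC[of r]] by (simp add: Int_absorb2)
      also have "\<dots> \<le> (\<integral>p. ?\<chi> p \<partial>V)"
      proof (rule integral_mono[OF ind int])
        fix p assume "p \<in> space V"
        obtain x S where p: "p = (x, S)" by (cases p)
        show "indicator (C r) p \<le> ?\<chi> p"
          using cutoff_bounds[of r x] cutoff_inside[of x r] by (auto simp: indicator_def C_def p)
      qed
      finally show ?thesis .
    qed
    ultimately have "measure V (C r) \<le> m" by linarith
    moreover have "emeasure V (C r) = ennreal (measure V (C r))"
      using finC[of r] by (intro emeasure_eq_ennreal_measure) auto
    ultimately show ?thesis by (simp add: ennreal_leI)
  qed
  have "(\<Union>k. C (real k)) = space V"
  proof (intro equalityI subsetI)
    fix p assume "p \<in> space V"
    then obtain x S where p: "p = (x, S)" "S \<in> grassmannian d" using spV by auto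
    obtain k where "norm x \<le> real k" using real_arch_simple by blast
    then show "p \<in> (\<Union>k. C (real k))" using p by (auto simp: C_def)
  qed (auto simp: C_def spV)
  moreover have "(SUP k. emeasure V (C (real k))) = emeasure V (\<Union>k. C (real k))"
  proof (rule SUP_emeasure_incseq)
    show "range (\<lambda>k. C (real k)) \<subseteq> sets V" using mC by auto
    show "incseq (\<lambda>k. C (real k))" unfolding incseq_def C_def by (auto intro: order_trans)
  qed
  moreover have "(SUP k. emeasure V (C (real k))) \<le> ennreal m" by (rule SUP_least) (rule le)
  ultimately show ?thesis by simp
qed

lemma weak_limit_bounded:
  fixes V :: "((real ^ 'n) \<times> (real ^ 'n ^ 'n)) measure"
  assumes W: "\<And>j. bounded_varifold d R m (W j)" and lim: "weak_star_limit d W V"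
    and V: "V \<in> varifolds d" and m: "m \<ge> 0"
  shows "bounded_varifold d R m V"
proof -
  have sV: "sets V = sets (grassmann_borel d)" using V by (simp add: varifolds_def)
  have mass: "emeasure V (space V) \<le> ennreal m" by (rule weak_limit_mass[OF W lim V m])
  interpret V: finite_measure V using mass by (intro finite_measureI) (auto simp: top_unique)
  have "AE p in V. norm (fst p) \<le> R \<or> real k \<le> norm (fst p)" for k :: nat
  proof -
    \<comment> \<open>This continuous function is positive exactly for R < |x| < k and has compact
      support. Its integral vanishes for every approximation, hence for the limit, so the shell is a
      null set; the shells for all \<open>k\<close> cover the outside of the ball.\<close>
    let ?g = "\<lambda>p :: (real ^ 'n) \<times> (real ^ 'n ^ 'n). max 0 (min (norm (fst p) - R) (real k - norm (fst p)))"
    have cg: "continuous_on (grassmann_bundle d) ?g" by (intro continuous_intros)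
    have tf: "test_function d ?g" by (rule test_functionI[OF cg, of "real k"]) simp
    have "(\<integral>p. ?g p \<partial>W j) = 0" for j
    proof (rule integral_eq_zero_AE)
      show "AE p in W j. ?g p = 0" using bounded_varifold_AE[OF W[of j]] by eventually_elim auto
    qed
    then have "(\<lambda>j. \<integral>p. ?g p \<partial>W j) \<longlonglongrightarrow> 0" by simp
    moreover have "(\<lambda>j. \<integral>p. ?g p \<partial>W j) \<longlonglongrightarrow> (\<integral>p. ?g p \<partial>V)"
      using lim tf unfolding weak_star_limit_def by blast
    ultimately have z: "(\<integral>p. ?g p \<partial>V) = 0" by (rule LIMSEQ_unique[symmetric])
    have int: "integrable V ?g"
    proof (rule V.integrable_const_bound[OF _ borel_measurable_continuous_on_bundle[OF sV cg], of "max 0 (real k)"])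
      show "AE p in V. norm (?g p) \<le> max 0 (real k)"
      proof (rule AE_I2)
        fix p :: "(real ^ 'n) \<times> (real ^ 'n ^ 'n)"
        have "0 \<le> norm (fst p)" by simp
        then have "min (norm (fst p) - R) (real k - norm (fst p)) \<le> real k" by linarith
        then show "norm (?g p) \<le> max 0 (real k)" by (simp add: max.coboundedI2)
      qed
    qed
    have "AE p in V. ?g p = 0"
      using integral_nonneg_eq_0_iff_AE[OF int] z by simp
    then show ?thesis by eventually_elim (auto simp: max_def min_def split: if_splits)
  qed
  then have "AE p in V. \<forall>k. norm (fst p) \<le> R \<or> real k \<le> norm (fst p)"
    by (intro AE_all_countable[THEN iffD2] allI)
  then have "AE p in V. norm (fst p) \<le> R"
  proof eventually_elim
    case (elim p)
    obtain k where "norm (fst p) < real k" using reals_Archimedean2 by blast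
    then show ?case using elim[rule_format, of k] by simp
  qed
  then show ?thesis using sV mass by (simp add: bounded_varifold_def)
qed

text \<open>Stronger than convergence against bounded functions: all continuous functions are
  allowed, which makes sense because the supports stay in a common ball.\<close>

definition narrow_limit ::
  "nat \<Rightarrow> (nat \<Rightarrow> ((real ^ 'n) \<times> (real ^ 'n ^ 'n)) measure) \<Rightarrow> ((real ^ 'n) \<times> (real ^ 'n ^ 'n)) measure \<Rightarrow> bool" where
  "narrow_limit d W V \<longleftrightarrow> (\<forall>g :: _ \<Rightarrow> real. continuous_on (grassmann_bundle d) g \<longrightarrow>
     (\<lambda>j. \<integral>p. g p \<partial>W j) \<longlonglongrightarrow> (\<integral>p. g p \<partial>V))"

lemma integral_cutoff:
  fixes g :: "(real ^ 'n) \<times> (real ^ 'n ^ 'n) \<Rightarrow> real"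
  assumes V: "bounded_varifold d R m V" and g: "continuous_on (grassmann_bundle d) g"
  shows "(\<integral>(x, S). cutoff R x * g (x, S) \<partial>V) = (\<integral>p. g p \<partial>V)"
proof -
  note gm = borel_measurable_continuous_on_bundle[OF bounded_varifold_sets[OF V] g]
  have c: "(\<lambda>(x, S). cutoff R x) \<in> borel_measurable V"
    by (rule borel_measurable_continuous_on_bundle[OF bounded_varifold_sets[OF V] continuous_on_cutoff])
  have cm: "(\<lambda>(x, S). cutoff R x * g (x, S)) \<in> borel_measurable V"
    using borel_measurable_times[OF c gm] by (simp add: split_beta')
  show ?thesis
  proof (rule integral_cong_AE[OF cm gm])
    show "AE p in V. (case p of (x, S) \<Rightarrow> cutoff R x * g (x, S)) = g p"
      using bounded_varifold_AE[OF V] by eventually_elim (auto simp: cutoff_inside)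
  qed
qed

text \<open>The cutoff equals 1 on the common ball, so truncating a function changes neither the
  integrals of the approximations nor that of the limit.\<close>

lemma weak_limit_narrow:
  fixes V :: "((real ^ 'n) \<times> (real ^ 'n ^ 'n)) measure"
  assumes W: "\<And>j. bounded_varifold d R m (W j)" and V: "bounded_varifold d R m V"
    and lim: "weak_star_limit d W V"
  shows "narrow_limit d W V"
  unfolding narrow_limit_def
proof (intro allI impI)
  fix g :: "(real ^ 'n) \<times> (real ^ 'n ^ 'n) \<Rightarrow> real" assume g: "continuous_on (grassmann_bundle d) g"
  have "(\<lambda>j. \<integral>(x, S). cutoff R x * g (x, S) \<partial>W j) \<longlonglongrightarrow> (\<integral>(x, S). cutoff R x * g (x, S) \<partial>V)"
    using lim test_function_cutoff[OF g, of R] unfolding weak_star_limit_def by blast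
  then show "(\<lambda>j. \<integral>p. g p \<partial>W j) \<longlonglongrightarrow> (\<integral>p. g p \<partial>V)"
    unfolding integral_cutoff[OF W g] integral_cutoff[OF V g] .
qed

lemma narrow_limit_vec:
  fixes g :: "(real ^ 'n) \<times> (real ^ 'n ^ 'n) \<Rightarrow> 'b::euclidean_space"
  assumes W: "\<And>j. bounded_varifold d R m (W j)" and V: "bounded_varifold d R m V"
    and lim: "narrow_limit d W V" and g: "continuous_on (grassmann_bundle d) g"
  shows "(\<lambda>j. \<integral>p. g p \<partial>W j) \<longlonglongrightarrow> (\<integral>p. g p \<partial>V)"
proof (subst tendsto_componentwise_iff, intro ballI)
  fix b :: 'b assume "b \<in> Basis"
  have c: "continuous_on (grassmann_bundle d) (\<lambda>p. g p \<bullet> b)" by (intro continuous_intros g)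
  have "(\<integral>p. g p \<bullet> b \<partial>U) = (\<integral>p. g p \<partial>U) \<bullet> b" if "bounded_varifold d R m U" for U
    by (rule integral_inner_left) (rule bounded_varifold_integrable_continuous[OF that g])
  from this[OF W] this[OF V] have [simp]: "(\<integral>p. g p \<bullet> b \<partial>W j) = (\<integral>p. g p \<partial>W j) \<bullet> b" "(\<integral>p. g p \<bullet> b \<partial>V) = (\<integral>p. g p \<partial>V) \<bullet> b" for j
    by blast+
  show "(\<lambda>j. (\<integral>p. g p \<partial>W j) \<bullet> b) \<longlonglongrightarrow> (\<integral>p. g p \<partial>V) \<bullet> b"
    using lim[unfolded narrow_limit_def, rule_format, OF c] by simp
qed

text \<open>Allows the integrand to vary with \<open>j\<close>: its uniform error on the common
  support, times the common mass bound, tends to 0.\<close>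

lemma narrow_limit_uniform:
  fixes g :: "(real ^ 'n) \<times> (real ^ 'n ^ 'n) \<Rightarrow> 'b::euclidean_space"
  assumes W: "\<And>j. bounded_varifold d R m (W j)" and V: "bounded_varifold d R m V" and m: "m \<ge> 0"
    and lim: "narrow_limit d W V" and g: "continuous_on (grassmann_bundle d) g"
    and gj: "\<And>j. continuous_on (grassmann_bundle d) (gj j)"
    and unif: "\<And>e. e > 0 \<Longrightarrow> \<forall>\<^sub>F j in sequentially. \<forall>x S. norm x \<le> R \<longrightarrow> S \<in> grassmannian d \<longrightarrow> norm (gj j (x, S) - g (x, S)) \<le> e"
  shows "(\<lambda>j. \<integral>p. gj j p \<partial>W j) \<longlonglongrightarrow> (\<integral>p. g p \<partial>V)"
proof -
  have "(\<lambda>j. (\<integral>p. gj j p \<partial>W j) - (\<integral>p. g p \<partial>W j)) \<longlonglongrightarrow> 0"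
  proof (rule tendstoI)
    fix e :: real assume e: "e > 0"
    define e' where "e' = e / (m + 1)"
    have e': "e' > 0" "e' * m < e"
    proof -
      show "e' > 0" using e m by (simp add: e'_def)
      have "e' * m < e' * (m + 1)" using \<open>e' > 0\<close> by simp
      also have "\<dots> = e" using m by (simp add: e'_def)
      finally show "e' * m < e" .
    qed
    show "\<forall>\<^sub>F j in sequentially. dist ((\<integral>p. gj j p \<partial>W j) - (\<integral>p. g p \<partial>W j)) 0 < e"
      using unif[OF e'(1)]
    proof eventually_elim
      case (elim j)
      have "(\<integral>p. gj j p \<partial>W j) - (\<integral>p. g p \<partial>W j) = (\<integral>p. gj j p - g p \<partial>W j)"
        by (rule Bochner_Integration.integral_diff[symmetric])
           (rule bounded_varifold_integrable_continuous[OF W gj] bounded_varifold_integrable_continuous[OF W g])+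
      also have "norm \<dots> \<le> e' * m"
        by (rule bounded_varifold_integral_le[OF W m]) (use elim e'(1) in auto)
      finally show ?case using e'(2) by simp
    qed
  qed
  from tendsto_add[OF this narrow_limit_vec[OF W V lim g]] show ?thesis by simp
qed

section \<open>Convergence along the scheme\<close>

context mcf_kernel
begin

text \<open>A short step hardly changes the integral of a fixed function, with a modulus common to
  all varifolds within the bounds. This allows the flow at a time between two nodes to be exchanged
  with the node on the left.\<close>

lemma flow_step_close:
  fixes g :: "(real ^ 'n) \<times> (real ^ 'n ^ 'n) \<Rightarrow> real"
  assumes sc: "step_consts d m K \<tau>0" and m: "m \<ge> 0" and g: "continuous_on (grassmann_bundle d) g" and e: "e > 0"
  shows "\<exists>\<delta>>0. \<forall>V \<tau>. bounded_varifold d R m V \<longrightarrow> 0 \<le> \<tau> \<longrightarrow> \<tau> \<le> \<delta> \<longrightarrow> \<tau> \<le> \<tau>0 \<longrightarrow>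
    \<bar>(\<integral>p. g p \<partial>flow_step d \<psi> \<epsilon> \<tau> V) - (\<integral>p. g p \<partial>V)\<bar> \<le> e"
proof -
  define b where "b = hbound m"
  have b: "b \<ge> 0" unfolding b_def by (rule hbound_nonneg[OF m])
  have K: "K \<ge> 0" using sc by (simp add: step_consts_def)
  define e' where "e' = e / (2 * (m + 1))"
  have e': "e' > 0" "2 * e' * m \<le> e"
  proof -
    show pos: "e' > 0" using e m by (simp add: e'_def)
    have "2 * e' * m \<le> 2 * e' * (m + 1)" using pos by simp
    also have "\<dots> = e" using m by (simp add: e'_def field_simps)
    finally show "2 * e' * m \<le> e" .
  qed
  let ?C = "cball (0 :: real ^ 'n) (R + b) \<times> (grassmannian d :: (real ^ 'n ^ 'n) set)"
  have "uniformly_continuous_on ?C g"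
    by (rule compact_uniformly_continuous[OF continuous_on_subset[OF g] compact_cball_bundle]) auto
  then obtain \<delta>1 where \<delta>1: "\<delta>1 > 0" "\<And>p p'. p \<in> ?C \<Longrightarrow> p' \<in> ?C \<Longrightarrow> dist p' p < \<delta>1 \<Longrightarrow> dist (g p') (g p) < e'"
    using e'(1) by (rule uniformly_continuous_onE) blast
  obtain B where B: "B \<ge> 0" "\<And>x S. norm x \<le> R + b \<Longrightarrow> S \<in> grassmannian d \<Longrightarrow> norm (g (x, S)) \<le> B"
    using continuous_on_bundle_bounded[OF g, of "R + b"] by blast
  \<comment> \<open>The bound 1 keeps moved points in the ball of radius R + b. The second term
    makes the displacement in the bundle, at most (b + K) tau, smaller than
    \<open>\<delta>1\<close>. The third makes the effect of the density, at most K tau B, no larger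
    than \<open>e'\<close>.\<close>
  define \<delta> where "\<delta> = min 1 (min (\<delta>1 / (2 * (b + K + 1))) (e' / (K * B + 1)))"
  have bK: "b + K + 1 > 0" "K * B + 1 > 0" using b K B(1) by (simp_all add: add_nonneg_pos)
  have \<delta>: "\<delta> > 0" "\<delta> \<le> 1" "\<delta> \<le> \<delta>1 / (2 * (b + K + 1))" "\<delta> \<le> e' / (K * B + 1)"
    unfolding \<delta>_def using \<delta>1(1) e'(1) bK by simp_all
  show ?thesis
  proof (rule exI[of _ \<delta>], rule conjI[OF \<delta>(1)], intro allI impI)
    fix V :: "((real ^ 'n) \<times> (real ^ 'n ^ 'n)) measure" and \<tau>
    assume V: "bounded_varifold d R m V" and \<tau>: "0 \<le> \<tau>" "\<tau> \<le> \<delta>" "\<tau> \<le> \<tau>0"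
    note st = sc V m order_refl \<tau>(1) \<tau>(3)
    let ?q = "\<lambda>(x, S). step_density d \<tau> V x S * g (x + \<tau> *\<^sub>R h V x, step_plane \<tau> V x S)"
    have pt: "\<bar>step_density d \<tau> V x S * g (x + \<tau> *\<^sub>R h V x, step_plane \<tau> V x S) - g (x, S)\<bar> \<le> 2 * e'"
      if x: "norm x \<le> R" and S: "S \<in> grassmannian d" for x S
    proof -
      let ?x = "x + \<tau> *\<^sub>R h V x" and ?S = "step_plane \<tau> V x S" and ?J = "step_density d \<tau> V x S"
      have dx: "norm (\<tau> *\<^sub>R h V x) \<le> \<tau> * b"
        unfolding b_def using \<tau>(1) norm_h_le[OF V m] by (simp add: mult_left_mono)
      have "\<tau> * b \<le> 1 * b" using \<tau>(2) \<delta>(2) b by (intro mult_right_mono) linarith+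
      then have nx: "norm ?x \<le> R + b" "norm x \<le> R + b"
        using norm_triangle_ineq[of x "\<tau> *\<^sub>R h V x"] dx x b by linarith+
      have GS: "?S \<in> grassmannian d" by (rule step_plane_grassmannian[OF st S])
      have "dist (?x, ?S) (x, S) \<le> dist ?x x + dist ?S S"
        unfolding dist_Pair_Pair by (rule order_trans[OF sqrt_sum_squares_le_sum]) simp_all
      also have "\<dots> \<le> \<tau> * b + K * \<tau>"
        using dx step_bounds(4)[OF st S, of x] by (intro add_mono) (simp_all add: dist_norm)
      also have "\<dots> \<le> \<tau> * (b + K + 1)" using \<tau>(1) by (simp add: algebra_simps)
      also have "\<dots> \<le> \<delta>1 / (2 * (b + K + 1)) * (b + K + 1)"
        using \<tau>(2) \<delta>(3) bK by (intro mult_right_mono) linarith+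
      also have "\<dots> = \<delta>1 / 2" using bK(1) by (simp add: field_simps)
      also have "\<dots> < \<delta>1" using \<delta>1(1) by simp
      finally have "dist (g (?x, ?S)) (g (x, S)) < e'"
        by (intro \<delta>1(2)) (use nx GS S in auto)
      then have g1: "\<bar>g (?x, ?S) - g (x, S)\<bar> \<le> e'" by (simp add: dist_real_def)
      have "\<bar>(?J - 1) * g (?x, ?S)\<bar> \<le> (K * \<tau>) * B"
        unfolding abs_mult
        by (intro mult_mono step_bounds(2)[OF st S] B(2)[OF nx(1) GS, unfolded real_norm_def]) (use K \<tau>(1) in simp_all)
      also have "\<dots> \<le> \<tau> * (K * B + 1)" using \<tau>(1) by (simp add: algebra_simps)
      also have "\<dots> \<le> e' / (K * B + 1) * (K * B + 1)"
        using \<tau>(2) \<delta>(4) bK by (intro mult_right_mono) linarith+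
      also have "\<dots> = e'" using bK(2) by simp
      finally have g2: "\<bar>(?J - 1) * g (?x, ?S)\<bar> \<le> e'" .
      have "?J * g (?x, ?S) - g (x, S) = (?J - 1) * g (?x, ?S) + (g (?x, ?S) - g (x, S))"
        by (simp add: algebra_simps)
      then show ?thesis using g1 g2 by linarith
    qed
    have "(\<integral>p. g p \<partial>flow_step d \<psi> \<epsilon> \<tau> V) - (\<integral>p. g p \<partial>V) = (\<integral>p. ?q p - g p \<partial>V)"
      unfolding integral_flow_step(1)[OF st g]
      by (rule Bochner_Integration.integral_diff[symmetric])
         (rule bounded_varifold_integrable_continuous[OF V] integral_flow_step(2)[OF st g] g)+
    also have "norm \<dots> \<le> 2 * e' * m"
      by (rule bounded_varifold_integral_le[OF V m]) (use pt e'(1) in auto)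
    finally show "\<bar>(\<integral>p. g p \<partial>flow_step d \<psi> \<epsilon> \<tau> V) - (\<integral>p. g p \<partial>V)\<bar> \<le> e" using e'(2) by simp
  qed
qed

lemma h_tilde_tendsto:
  assumes W: "\<And>j. bounded_varifold d R m (W j)" and V: "bounded_varifold d R m V" and lim: "narrow_limit d W V"
  shows "(\<lambda>j. ht (W j) y) \<longlonglongrightarrow> ht V y"
proof -
  have "continuous_on (grassmann_bundle d) (\<lambda>(x :: real ^ 'n, S :: real ^ 'n ^ 'n). \<Phi> (x - y))"
    unfolding split_beta' by (intro continuous_on_translates continuous_intros)
  from narrow_limit_vec[OF W V lim this]
  have 1: "(\<lambda>j. smoothed_mass \<psi> \<epsilon> (W j) y) \<longlonglongrightarrow> smoothed_mass \<psi> \<epsilon> V y"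
    unfolding smoothed_mass_eq[OF bounded_varifold_sets[OF W]] smoothed_mass_eq[OF bounded_varifold_sets[OF V]] .
  have "continuous_on (grassmann_bundle d) (\<lambda>(x :: real ^ 'n, S :: real ^ 'n ^ 'n). S *v G (x - y))"
    unfolding split_beta' by (intro continuous_intros continuous_on_translates)
  from narrow_limit_vec[OF W V lim this]
  have 2: "(\<lambda>j. smoothed_first_variation \<psi> \<epsilon> (W j) y) \<longlonglongrightarrow> smoothed_first_variation \<psi> \<epsilon> V y"
    unfolding smoothed_first_variation_def .
  have "smoothed_mass \<psi> \<epsilon> V y + \<epsilon> \<noteq> 0" using smoothed_mass_nonneg[of V y] eps by linarith
  then show ?thesis unfolding h_tilde_def by (intro tendsto_intros 1 2)
qed

lemma dual_measurable:
  assumes V: "bounded_varifold d R m V" and \<phi>: "continuous_on UNIV \<phi>" and q: "continuous_on UNIV q"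
  shows "dual \<phi> q V \<in> borel_measurable lborel"
proof -
  interpret V: finite_measure V by (rule bounded_varifold_finite[OF V])
  note pr = bundle_projections_measurable[OF bounded_varifold_sets[OF V]]
  let ?N = "lborel \<Otimes>\<^sub>M V"
  have x: "(\<lambda>n. fst (snd n)) \<in> borel_measurable ?N" by (rule measurable_compose[OF measurable_snd pr(1)])
  have S: "(\<lambda>n. snd (snd n)) \<in> borel_measurable ?N" by (rule measurable_compose[OF measurable_snd pr(2)])
  have X: "(\<lambda>n. fst (snd n) - fst n) \<in> borel_measurable ?N" by (intro borel_measurable_diff x) simp
  note c = measurable_compose[OF x borel_measurable_continuous_onI[OF \<phi>]]
      measurable_compose[OF x borel_measurable_continuous_onI[OF q]]
  have "(\<lambda>n. \<phi> (fst (snd n)) *\<^sub>R (snd (snd n) *v G (fst (snd n) - fst n)) + \<Phi> (fst (snd n) - fst n) *\<^sub>R q (fst (snd n))) \<in> borel_measurable ?N"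
    by (intro borel_measurable_add borel_measurable_scaleR c S borel_measurable_matrix_vector_mult borel_measurable_kernels X)
  then have "(\<lambda>y. \<integral>p. \<phi> (fst p) *\<^sub>R (snd p *v G (fst p - y)) + \<Phi> (fst p - y) *\<^sub>R q (fst p) \<partial>V) \<in> borel_measurable lborel"
    by (intro V.borel_measurable_lebesgue_integral) (simp add: split_beta')
  then show ?thesis unfolding dual_def[abs_def] split_beta' .
qed

text \<open>The weighted first variation in the direction of the approximate mean curvature, written
  as one integral with \<open>q\<close> in place of the gradient of \<open>\<phi>\<close>. With
  \<open>\<phi>\<close> and \<open>q\<close> independent, each can be approximated uniformly on its
  own.\<close>

definition action :: "(real ^ 'n \<Rightarrow> real) \<Rightarrow> (real ^ 'n \<Rightarrow> real ^ 'n) \<Rightarrow> ((real ^ 'n) \<times> (real ^ 'n ^ 'n)) measure \<Rightarrow> real" where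
  "action \<phi> q V = (\<integral>(x, S). \<phi> x * div_along S (h V) x + q x \<bullet> h V x \<partial>V)"

text \<open>The measure, the field \<open>h\<close> and the weights all vary with \<open>j\<close>.
  Written through \<open>dual\<close>, the integral asks only for convergence at each fixed
  \<open>y\<close>, and no convergence of \<open>h\<close> or of its derivative has to be
  established.\<close>

lemma action_tendsto:
  assumes W: "\<And>j. bounded_varifold d R m (W j)" and V: "bounded_varifold d R m V" and m: "m \<ge> 0"
    and lim: "narrow_limit d W V"
    and \<phi>: "continuous_on UNIV \<phi>" and q: "continuous_on UNIV q"
    and \<phi>j: "\<And>j. continuous_on UNIV (\<phi>j j)" and qj: "\<And>j. continuous_on UNIV (qj j)"
    and \<phi>u: "\<And>e. e > 0 \<Longrightarrow> \<forall>\<^sub>F j in sequentially. \<forall>x. norm x \<le> R \<longrightarrow> \<bar>\<phi>j j x - \<phi> x\<bar> \<le> e"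
    and qu: "\<And>e. e > 0 \<Longrightarrow> \<forall>\<^sub>F j in sequentially. \<forall>x. norm x \<le> R \<longrightarrow> norm (qj j x - q x) \<le> e"
    and \<phi>b: "\<And>j x. norm x \<le> R \<Longrightarrow> \<bar>\<phi>j j x\<bar> \<le> C" and qb: "\<And>j x. norm x \<le> R \<Longrightarrow> norm (qj j x) \<le> C" and C: "C \<ge> 0"
  shows "(\<lambda>j. action (\<phi>j j) (qj j) (W j)) \<longlonglongrightarrow> action \<phi> q V"
proof -
  have dual_lim: "(\<lambda>j. dual (\<phi>j j) (qj j) (W j) y) \<longlonglongrightarrow> dual \<phi> q V y" for y
    unfolding dual_def
  proof (rule narrow_limit_uniform[OF W V m lim continuous_on_dual_integrand[OF \<phi> q] continuous_on_dual_integrand[OF \<phi>j qj]])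
    fix e :: real assume e: "e > 0"
    define e' where "e' = e / (2 * \<kappa> + 1)"
    have e': "e' > 0" "e' * \<kappa> + \<kappa> * e' \<le> e"
    proof -
      have k: "2 * \<kappa> + 1 > 0" using \<kappa>(1) by linarith
      show pos: "e' > 0" using e k by (simp add: e'_def)
      have "e' * \<kappa> + \<kappa> * e' \<le> e' * (2 * \<kappa> + 1)" using pos by (simp add: algebra_simps)
      also have "\<dots> = e" using k by (simp add: e'_def)
      finally show "e' * \<kappa> + \<kappa> * e' \<le> e" .
    qed
    show "\<forall>\<^sub>F j in sequentially. \<forall>x S. norm x \<le> R \<longrightarrow> S \<in> grassmannian d \<longrightarrow>
      norm ((case (x, S) of (x, S) \<Rightarrow> \<phi>j j x *\<^sub>R (S *v G (x - y)) + \<Phi> (x - y) *\<^sub>R qj j x) -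
        (case (x, S) of (x, S) \<Rightarrow> \<phi> x *\<^sub>R (S *v G (x - y)) + \<Phi> (x - y) *\<^sub>R q x)) \<le> e"
      using \<phi>u[OF e'(1)] qu[OF e'(1)]
    proof eventually_elim
      case (elim j)
      show ?case
      proof (intro allI impI)
        fix x :: "real ^ 'n" and S :: "real ^ 'n ^ 'n" assume x: "norm x \<le> R" and S: "S \<in> grassmannian d"
        have "norm ((\<phi>j j x - \<phi> x) *\<^sub>R (S *v G (x - y)) + \<Phi> (x - y) *\<^sub>R (qj j x - q x)) \<le> e' * \<kappa> + \<kappa> * e'"
          by (rule dual_integrand_le[OF S, of "\<lambda>x. \<phi>j j x - \<phi> x" x e' "\<lambda>x. qj j x - q x" e']) (use elim x in blast)+
        also have "\<dots> \<le> e" by (rule e'(2))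
        finally show "norm ((case (x, S) of (x, S) \<Rightarrow> \<phi>j j x *\<^sub>R (S *v G (x - y)) + \<Phi> (x - y) *\<^sub>R qj j x) -
          (case (x, S) of (x, S) \<Rightarrow> \<phi> x *\<^sub>R (S *v G (x - y)) + \<Phi> (x - y) *\<^sub>R q x)) \<le> e"
          by (simp add: scaleR_left_diff_distrib scaleR_diff_right algebra_simps)
      qed
    qed
  qed
  \<comment> \<open>The bound of the unmollified field times that of the dual vector. The field
    vanishes outside the ball of radius R + 1, so \<open>D\<close> times its indicator is an
    integrable majorant.\<close>
  define D where "D = (\<kappa> * m / \<epsilon>) * ((C * \<kappa> + \<kappa> * C) * m)"
  have Db: "norm (ht (W j) y \<bullet> dual (\<phi>j j) (qj j) (W j) y) \<le> D * indicator (cball 0 (R + 1)) y" for j y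
  proof (cases "y \<in> cball 0 (R + 1)")
    case True
    have "norm (dual (\<phi>j j) (qj j) (W j) y) \<le> (C * \<kappa> + \<kappa> * C) * m"
      unfolding dual_def
    proof (rule bounded_varifold_integral_le[OF W m])
      fix x :: "real ^ 'n" and S :: "real ^ 'n ^ 'n" assume x: "norm x \<le> R" and S: "S \<in> grassmannian d"
      show "norm (case (x, S) of (x, S) \<Rightarrow> \<phi>j j x *\<^sub>R (S *v G (x - y)) + \<Phi> (x - y) *\<^sub>R qj j x) \<le> C * \<kappa> + \<kappa> * C"
        unfolding split_conv
        by (rule dual_integrand_le[OF S, of "\<phi>j j" x C "qj j" C]) (rule \<phi>b[OF x] qb[OF x])+
    qed (use C \<kappa>(1) in simp)
    then have "norm (ht (W j) y) * norm (dual (\<phi>j j) (qj j) (W j) y) \<le> D"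
      unfolding D_def using norm_h_tilde_le[OF W m] \<kappa>(1) m eps by (intro mult_mono) simp_all
    then show ?thesis using True order_trans[OF Cauchy_Schwarz_ineq2] by simp
  next
    case False
    then show ?thesis using h_tilde_support[OF W] by simp
  qed
  have "(\<lambda>j. \<integral>y. ht (W j) y \<bullet> dual (\<phi>j j) (qj j) (W j) y \<partial>lborel) \<longlonglongrightarrow> (\<integral>y. ht V y \<bullet> dual \<phi> q V y \<partial>lborel)"
  proof (rule integral_dominated_convergence[where w = "\<lambda>y. D * indicator (cball 0 (R + 1)) y"])
    show "(\<lambda>y. ht V y \<bullet> dual \<phi> q V y) \<in> borel_measurable lborel"
      by (intro borel_measurable_inner h_tilde_measurable[OF V] dual_measurable[OF V \<phi> q])
    show "(\<lambda>y. ht (W j) y \<bullet> dual (\<phi>j j) (qj j) (W j) y) \<in> borel_measurable lborel" for j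
      by (intro borel_measurable_inner h_tilde_measurable[OF W] dual_measurable[OF W \<phi>j qj])
    show "integrable lborel (\<lambda>y :: real ^ 'n. D * indicator (cball 0 (R + 1)) y :: real)" by (rule integrable_indicator_cball)
    show "AE y in lborel. (\<lambda>j. ht (W j) y \<bullet> dual (\<phi>j j) (qj j) (W j) y) \<longlonglongrightarrow> ht V y \<bullet> dual \<phi> q V y"
      by (rule AE_I2) (intro tendsto_inner h_tilde_tendsto[OF W V lim] dual_lim)
    show "AE y in lborel. norm (ht (W j) y \<bullet> dual (\<phi>j j) (qj j) (W j) y) \<le> D * indicator (cball 0 (R + 1)) y" for j
      by (rule AE_I2) (rule Db)
  qed
  then show ?thesis
    unfolding action_def first_variation_dual[OF W m \<phi>j qj] first_variation_dual[OF V m \<phi> q] .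
qed

lemma continuous_on_action_integrand:
  assumes V: "bounded_varifold d R m V" and m: "m \<ge> 0" and \<phi>: "continuous_on UNIV \<phi>" and q: "continuous_on UNIV q"
  shows "continuous_on (grassmann_bundle d) (\<lambda>(x, S). \<phi> x * div_along S (h V) x)"
    "continuous_on (grassmann_bundle d) (\<lambda>(x, S :: real ^ 'n ^ 'n). q x \<bullet> h V x)"
proof -
  have "continuous_on (grassmann_bundle d) (\<lambda>p. \<phi> (fst p))" "continuous_on (grassmann_bundle d) (\<lambda>p. q (fst p))"
    "continuous_on (grassmann_bundle d) (\<lambda>p. h V (fst p))" "continuous_on (grassmann_bundle d) (\<lambda>p. jacobian (h V) (at (fst p)))"
    by (rule continuous_on_compose2[OF \<phi>] continuous_on_compose2[OF q] continuous_on_compose2[OF h_continuous[OF V m]]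
        continuous_on_compose2[OF continuous_on_jacobian_h[OF V m]]; auto intro!: continuous_intros)+
  then show "continuous_on (grassmann_bundle d) (\<lambda>(x, S). \<phi> x * div_along S (h V) x)"
    "continuous_on (grassmann_bundle d) (\<lambda>(x, S :: real ^ 'n ^ 'n). q x \<bullet> h V x)"
    unfolding split_beta' div_along_def by (intro continuous_intros; simp)+
qed

end

context mcf_scheme
begin

text \<open>The hypothesis concerns the discrete flow at \<open>t\<close>, whereas Riemann sums are
  made of nodes. The two differ by one partial step of length at most 1/N, which disappears in the
  limit.\<close>

lemma node_narrow_limit:
  assumes N: "\<And>j. fine_enough (N j)" "filterlim N at_top sequentially" and t: "0 \<le> t" "t \<le> 1"
    and V: "V \<in> varifolds d"
    and lim: "weak_star_limit d (\<lambda>j. discrete_flow d \<psi> \<epsilon> V\<^sub>0 (uniform_subdivision (N j)) t) V"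
  shows "bounded_varifold d R1 (M + 1) V" "narrow_limit d (\<lambda>j. node (N j) (left_index (N j) t)) V"
proof -
  let ?S = "\<lambda>j. discrete_flow d \<psi> \<epsilon> V\<^sub>0 (uniform_subdivision (N j)) t"
  let ?W = "\<lambda>j. node (N j) (left_index (N j) t)"
  have m: "M + 1 \<ge> 0" using M by simp
  have Sb: "bounded_varifold d R1 (M + 1) (?S j)" for j by (rule discrete_flow_bounded[OF N(1) t])
  show Vb: "bounded_varifold d R1 (M + 1) V" by (rule weak_limit_bounded[OF Sb lim V m])
  have nl: "narrow_limit d ?S V" by (rule weak_limit_narrow[OF Sb Vb lim])
  have N1: "N j \<ge> 1" for j using N(1)[of j] by (simp add: fine_enough_def)
  show "narrow_limit d ?W V"
  \<comment> \<open>At time 0 the discrete flow is the initial varifold and not the result of a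
    step, and so is the node with left index 0.\<close>
  proof (cases "t = 0")
    case True
    then show ?thesis using nl by (simp add: discrete_flow_0 left_index_0)
  next
    case False
    then have t0: "t > 0" using t by simp
    show ?thesis
      unfolding narrow_limit_def
    proof (intro allI impI)
      fix g :: "(real ^ 'n) \<times> (real ^ 'n ^ 'n) \<Rightarrow> real" assume g: "continuous_on (grassmann_bundle d) g"
      have "(\<lambda>j. (\<integral>p. g p \<partial>?S j) - (\<integral>p. g p \<partial>?W j)) \<longlonglongrightarrow> 0"
      proof (rule tendstoI)
        fix e :: real assume e: "e > 0"
        obtain \<delta> where \<delta>: "\<delta> > 0" "\<And>V \<tau>. bounded_varifold d R1 (M + 1) V \<Longrightarrow> 0 \<le> \<tau> \<Longrightarrow> \<tau> \<le> \<delta> \<Longrightarrow> \<tau> \<le> \<tau>0 \<Longrightarrow>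
          \<bar>(\<integral>p. g p \<partial>flow_step d \<psi> \<epsilon> \<tau> V) - (\<integral>p. g p \<partial>V)\<bar> \<le> e / 2"
          using flow_step_close[OF sc m g, of "e / 2" R1] e by auto
        have "(\<lambda>j. 1 / real (N j)) \<longlonglongrightarrow> 0"
          by (rule filterlim_compose[OF lim_1_over_n N(2)])
        then have "\<forall>\<^sub>F j in sequentially. 1 / real (N j) < \<delta>" using \<delta>(1) by (rule order_tendstoD(2))
        then show "\<forall>\<^sub>F j in sequentially. dist ((\<integral>p. g p \<partial>?S j) - (\<integral>p. g p \<partial>?W j)) 0 < e"
        proof eventually_elim
          case (elim j)
          note b = left_index_unit[OF N1 t, of j]
          have \<tau>: "0 \<le> t - real (left_index (N j) t) / real (N j)" "t - real (left_index (N j) t) / real (N j) \<le> \<delta>"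
            "t - real (left_index (N j) t) / real (N j) \<le> \<tau>0"
            using b(2,3) elim N(1)[of j] by (simp_all add: fine_enough_def)
          have "\<bar>(\<integral>p. g p \<partial>?S j) - (\<integral>p. g p \<partial>?W j)\<bar> \<le> e / 2"
            unfolding discrete_flow_uniform[OF N1 t0 t(2)]
            by (rule \<delta>(2)[OF node_bounded[OF N(1)] \<tau>]) (use b(1) in simp)
          then show ?case using e by (simp add: dist_real_def)
        qed
      qed
      moreover have "(\<lambda>j. \<integral>p. g p \<partial>?S j) \<longlonglongrightarrow> (\<integral>p. g p \<partial>V)" using nl g unfolding narrow_limit_def by blast
      ultimately have "(\<lambda>j. (\<integral>p. g p \<partial>?S j) - ((\<integral>p. g p \<partial>?S j) - (\<integral>p. g p \<partial>?W j))) \<longlonglongrightarrow> (\<integral>p. g p \<partial>V) - 0"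
        by (intro tendsto_diff)
      then show "(\<lambda>j. \<integral>p. g p \<partial>?W j) \<longlonglongrightarrow> (\<integral>p. g p \<partial>V)" by simp
    qed
  qed
qed

end

section \<open>Weight functions and Riemann sums\<close>

locale C1_weight =
  fixes \<phi> :: "real \<times> (real ^ 'n) \<Rightarrow> real" and \<phi>' :: "real \<times> (real ^ 'n) \<Rightarrow> (real \<times> (real ^ 'n)) \<Rightarrow>\<^sub>L real"
  assumes cont': "continuous_on ({0..1} \<times> UNIV) \<phi>'"
    and deriv: "\<And>p. p \<in> {0..1} \<times> UNIV \<Longrightarrow> (\<phi> has_derivative blinfun_apply (\<phi>' p)) (at p within {0..1} \<times> UNIV)"
begin

definition "pt t x = blinfun_apply (\<phi>' (t, x)) (1, 0)"
definition px :: "real \<Rightarrow> real ^ 'n \<Rightarrow> real ^ 'n" where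
  "px t x = (\<Sum>i\<in>UNIV. blinfun_apply (\<phi>' (t, x)) (0, axis i 1) *\<^sub>R axis i 1)"

lemma derivative_split: "blinfun_apply (\<phi>' (t, x)) (s, v) = s * pt t x + v \<bullet> px t x"
proof -
  have lin: "linear (\<lambda>v. blinfun_apply (\<phi>' (t, x)) (0, v))"
  proof (rule linearI)
    show "blinfun_apply (\<phi>' (t, x)) (0, u + v) = blinfun_apply (\<phi>' (t, x)) (0, u) + blinfun_apply (\<phi>' (t, x)) (0, v)" for u v
      using blinfun.add_right[of "\<phi>' (t, x)" "(0, u)" "(0, v)"] by simp
    show "blinfun_apply (\<phi>' (t, x)) (0, r *\<^sub>R u) = r *\<^sub>R blinfun_apply (\<phi>' (t, x)) (0, u)" for r u
      using blinfun.scaleR_right[of "\<phi>' (t, x)" r "(0, u)"] by simp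
  qed
  have "blinfun_apply (\<phi>' (t, x)) (s, v) = blinfun_apply (\<phi>' (t, x)) (s *\<^sub>R (1, 0) + (0, v))" by simp
  also have "\<dots> = s * pt t x + blinfun_apply (\<phi>' (t, x)) (0, v)"
    unfolding blinfun.add_right blinfun.scaleR_right pt_def by simp
  also have "blinfun_apply (\<phi>' (t, x)) (0, v) = v \<bullet> px t x"
    unfolding px_def by (rule linear_eq_inner_axis[OF lin])
  finally show ?thesis .
qed

lemma continuous_weight: "continuous_on ({0..1} \<times> UNIV) \<phi>"
  by (rule has_derivative_continuous_on[OF deriv])

lemma continuous_pt: "continuous_on ({0..1} \<times> UNIV) (\<lambda>(t, x). pt t x)"
  unfolding pt_def split_beta' by (simp, intro continuous_intros cont')

lemma continuous_px: "continuous_on ({0..1} \<times> UNIV) (\<lambda>(t, x). px t x)"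
proof -
  have eq: "(\<lambda>(t, x). px t x) = (\<lambda>p. \<Sum>i\<in>UNIV. blinfun_apply (\<phi>' p) (0, axis i 1) *\<^sub>R axis i 1)"
    by (auto simp: px_def)
  show ?thesis unfolding eq by (intro continuous_intros cont')
qed

lemma continuous_slice:
  assumes g: "continuous_on ({0..1} \<times> UNIV) (\<lambda>(t, x :: real ^ 'n). g t x)" and t: "t \<in> {0..1}"
  shows "continuous_on UNIV (g t)"
proof -
  have "continuous_on UNIV (\<lambda>x. (\<lambda>(t, x). g t x) (t, x))"
    by (rule continuous_on_compose2[OF g]) (use t in \<open>auto intro!: continuous_intros\<close>)
  then show ?thesis by simp
qed

lemma continuous_weight': "continuous_on ({0..1} \<times> UNIV) (\<lambda>(t, x). \<phi> (t, x))"
  using continuous_weight by simp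

text \<open>A space slice at a time in \<open>{0..1}\<close> lies entirely in the strip, so the
  derivative within the strip restricts to a full derivative in \<open>x\<close>, also at the two
  end times.\<close>

lemma grad_slice:
  assumes t: "t \<in> {0..1}" shows "grad (\<lambda>x. \<phi> (t, x)) x = px t x"
proof -
  have inner: "((\<lambda>x. (t, x)) has_derivative (\<lambda>v. (0, v))) (at x)"
    by (intro has_derivative_Pair has_derivative_const has_derivative_ident)
  have "(\<phi> has_derivative blinfun_apply (\<phi>' (t, x))) (at (t, x) within {0..1} \<times> UNIV)"
    by (rule deriv) (use t in simp)
  then have "(\<phi> has_derivative blinfun_apply (\<phi>' (t, x))) (at (t, x) within range (\<lambda>x. (t, x)))"
    by (rule has_derivative_subset) (use t in auto)
  from has_derivative_in_compose[OF inner this]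
  have "((\<lambda>x. \<phi> (t, x)) has_derivative (\<lambda>v. blinfun_apply (\<phi>' (t, x)) (0, v))) (at x)" .
  then show ?thesis
    by (intro grad_eqI) (simp add: derivative_split)
qed

text \<open>Relative to a nondegenerate interval the derivative is unique, even when it is one-sided
  at an endpoint.\<close>

lemma vector_derivative_slice:
  assumes t: "t \<in> {0..1}" shows "vector_derivative (\<lambda>s. \<phi> (s, x)) (at t within {0..1}) = pt t x"
proof -
  have inner: "((\<lambda>s. (s, x)) has_derivative (\<lambda>s. (s, 0))) (at t within {0..1})"
    by (intro has_derivative_Pair has_derivative_const has_derivative_ident)
  have "(\<phi> has_derivative blinfun_apply (\<phi>' (t, x))) (at (t, x) within {0..1} \<times> UNIV)"
    by (rule deriv) (use t in simp)
  then have "(\<phi> has_derivative blinfun_apply (\<phi>' (t, x))) (at (t, x) within (\<lambda>s. (s, x)) ` {0..1})"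
    by (rule has_derivative_subset) auto
  from has_derivative_in_compose[OF inner this]
  have "((\<lambda>s. \<phi> (s, x)) has_vector_derivative pt t x) (at t within {0..1})"
    unfolding has_vector_derivative_def by (simp add: derivative_split)
  then show ?thesis
    using vector_derivative_within_cbox[of 0 1 t] t by simp
qed

lemma compact_bound:
  fixes g :: "real \<Rightarrow> real ^ 'n \<Rightarrow> 'b::real_normed_vector"
  assumes g: "continuous_on ({0..1} \<times> UNIV) (\<lambda>(t, x). g t x)"
  shows "\<exists>C\<ge>0. \<forall>t\<in>{0..1}. \<forall>x. norm x \<le> R \<longrightarrow> norm (g t x) \<le> C"
proof -
  have "compact ((\<lambda>(t, x). g t x) ` ({0..1} \<times> cball 0 R))"
    by (intro compact_continuous_image continuous_on_subset[OF g] compact_Times compact_Icc compact_cball) auto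
  then obtain C where C: "\<forall>y\<in>(\<lambda>(t, x). g t x) ` ({0..1} \<times> cball 0 R). norm y \<le> C"
    using compact_imp_bounded bounded_iff by metis
  have "norm (g t x) \<le> max C 0" if "t \<in> {0..1}" "norm x \<le> R" for t x
  proof -
    have "g t x \<in> (\<lambda>(t, x). g t x) ` ({0..1} \<times> cball 0 R)"
      by (rule image_eqI[where x = "(t, x)"]) (use that in auto)
    then have "norm (g t x) \<le> C" using C by blast
    then show ?thesis by simp
  qed
  then show ?thesis by (intro exI[of _ "max C 0"]) simp
qed

lemma slice_tendsto_uniform:
  fixes g :: "real \<Rightarrow> real ^ 'n \<Rightarrow> 'b::real_normed_vector"
  assumes g: "continuous_on ({0..1} \<times> UNIV) (\<lambda>(t, x). g t x)" and t: "t \<in> {0..1}"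
    and s: "\<And>j. s j \<in> {0..1}" "s \<longlonglongrightarrow> t" and e: "e > 0"
  shows "\<forall>\<^sub>F j in sequentially. \<forall>x. norm x \<le> R \<longrightarrow> norm (g (s j) x - g t x) \<le> e"
proof -
  have "uniformly_continuous_on ({0..1} \<times> cball 0 R) (\<lambda>(t, x). g t x)"
    by (rule compact_uniformly_continuous[OF continuous_on_subset[OF g]]) (auto intro!: compact_Times)
  then obtain \<delta> where \<delta>: "\<delta> > 0" "\<And>p p'. p \<in> {0..1} \<times> cball 0 R \<Longrightarrow> p' \<in> {0..1} \<times> cball 0 R \<Longrightarrow> dist p' p < \<delta> \<Longrightarrow>
      dist ((\<lambda>(t, x). g t x) p') ((\<lambda>(t, x). g t x) p) < e"
    using e by (rule uniformly_continuous_onE) blast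
  have "\<forall>\<^sub>F j in sequentially. dist (s j) t < \<delta>" using s(2) \<delta>(1) by (rule tendstoD)
  then show ?thesis
  proof eventually_elim
    case (elim j)
    show ?case
    proof (intro allI impI)
      fix x :: "real ^ 'n" assume x: "norm x \<le> R"
      have "dist ((\<lambda>(t, x). g t x) (s j, x)) ((\<lambda>(t, x). g t x) (t, x)) < e"
        by (rule \<delta>(2)) (use s(1) t x elim in \<open>simp_all add: dist_Pair_Pair\<close>)
      then show "norm (g (s j) x - g t x) \<le> e" by (simp add: dist_norm)
    qed
  qed
qed

text \<open>The first-order Taylor formula for displacements of speed at most \<open>B\<close>.
  Uniformity in \<open>t\<close> and \<open>x\<close> comes from the uniform continuity of the
  derivative on a compact set.\<close>

lemma uniform_expansion:
  assumes B: "B \<ge> 0" and e: "e > 0"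
  shows "\<exists>\<delta>>0. \<forall>t \<tau> x v. 0 \<le> t \<longrightarrow> 0 \<le> \<tau> \<longrightarrow> \<tau> \<le> \<delta> \<longrightarrow> t + \<tau> \<le> 1 \<longrightarrow> norm x \<le> R \<longrightarrow> norm v \<le> B * \<tau> \<longrightarrow>
    \<bar>\<phi> (t + \<tau>, x + v) - \<phi> (t, x) - (\<tau> * pt t x + v \<bullet> px t x)\<bar> \<le> e * \<tau>"
proof -
  let ?C = "{0..1} \<times> cball (0 :: real ^ 'n) (R + B)"
  define e' where "e' = e / (1 + B)"
  have e': "e' > 0" "(1 + B) * e' = e" using e B by (simp_all add: e'_def)
  have "uniformly_continuous_on ?C \<phi>'"
    by (rule compact_uniformly_continuous[OF continuous_on_subset[OF cont']]) (auto intro!: compact_Times)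
  then obtain \<delta>1 where \<delta>1: "\<delta>1 > 0" "\<And>p p'. p \<in> ?C \<Longrightarrow> p' \<in> ?C \<Longrightarrow> dist p' p < \<delta>1 \<Longrightarrow> dist (\<phi>' p') (\<phi>' p) < e'"
    using e'(1) by (rule uniformly_continuous_onE) blast
  \<comment> \<open>The bound 1 keeps x + v in the ball of radius R + B; the other term makes the
    length of the increment, at most (1 + B) tau, smaller than \<open>\<delta>1\<close>.\<close>
  define \<delta> where "\<delta> = min 1 (\<delta>1 / (2 * (1 + B)))"
  have \<delta>: "\<delta> > 0" "\<delta> \<le> 1" "\<delta> \<le> \<delta>1 / (2 * (1 + B))" using \<delta>1(1) B by (simp_all add: \<delta>_def)
  show ?thesis
  proof (rule exI[of _ \<delta>], rule conjI[OF \<delta>(1)], intro allI impI)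
    fix t \<tau> :: real and x v :: "real ^ 'n"
    assume t: "0 \<le> t" "t + \<tau> \<le> 1" and \<tau>: "0 \<le> \<tau>" "\<tau> \<le> \<delta>" and x: "norm x \<le> R" and v: "norm v \<le> B * \<tau>"
    define r where "r = (1 + B) * \<tau>"
    have "B * \<tau> \<le> B * 1" using \<tau> \<delta>(2) B by (intro mult_left_mono) linarith+
    then have vB: "norm v \<le> B" using v by linarith
    have r: "r < \<delta>1"
    proof -
      have "r \<le> (1 + B) * (\<delta>1 / (2 * (1 + B)))" unfolding r_def using \<tau>(2) \<delta>(3) B by (intro mult_left_mono) linarith+
      also have "\<dots> = \<delta>1 / 2" using B by (simp add: field_simps)
      finally show ?thesis using \<delta>1(1) by linarith
    qed
    have nv: "norm (\<tau>, v) \<le> r"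
    proof -
      have "norm (\<tau>, v) \<le> norm \<tau> + norm v" unfolding norm_Pair by (rule sqrt_sum_squares_le_sum) simp_all
      also have "\<dots> \<le> r" using v \<tau>(1) by (simp add: r_def algebra_simps)
      finally show ?thesis .
    qed
    \<comment> \<open>This set contains the segment between the two points, and on it the derivative
      varies by at most \<open>e'\<close>.\<close>
    let ?S = "?C \<inter> cball (t, x) r"
    have tx: "(t, x) \<in> ?S" using t \<tau>(1) x B by (simp add: r_def)
    have "norm (\<phi> (t + \<tau>, x + v) - \<phi> (t, x) - blinfun_apply (\<phi>' (t, x)) ((t + \<tau>, x + v) - (t, x)))
        \<le> norm ((t + \<tau>, x + v) - (t, x)) * e'"
    proof (rule differentiable_bound_linearization[where S = ?S and f' = "\<lambda>p. blinfun_apply (\<phi>' p)", OF _ _ _ tx])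
      fix u :: real assume u: "u \<in> {0..1}"
      have "u * \<tau> \<le> \<tau>" using u \<tau>(1) by (simp add: mult_left_le_one_le)
      moreover have "0 \<le> u * \<tau>" using u \<tau>(1) by simp
      moreover have uv: "norm (u *\<^sub>R v) \<le> norm v" using u by (simp add: mult_left_le_one_le)
      moreover have "norm (- x - u *\<^sub>R v) \<le> R + B"
        using norm_triangle_ineq4[of "- x" "u *\<^sub>R v"] x uv vB unfolding norm_minus_cancel by linarith
      moreover have "norm (u *\<^sub>R (\<tau>, v)) \<le> r"
      proof -
        have "norm (u *\<^sub>R (\<tau>, v)) \<le> norm (\<tau>, v)" unfolding norm_scaleR using u by (intro mult_left_le_one_le) auto
        then show ?thesis using nv by linarith
      qed
      ultimately show "(t, x) + u *\<^sub>R ((t + \<tau>, x + v) - (t, x)) \<in> ?S"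
        using t by (simp add: dist_norm norm_Pair)
    next
      fix p assume p: "p \<in> ?S"
      then have p1: "p \<in> {0..1} \<times> UNIV" by auto
      show "(\<phi> has_derivative blinfun_apply (\<phi>' p)) (at p within ?S)"
        by (rule has_derivative_subset[OF deriv[OF p1]]) auto
      have "dist p (t, x) < \<delta>1" using p r by (simp add: dist_commute)
      then have "norm (\<phi>' p - \<phi>' (t, x)) \<le> e'"
        using \<delta>1(2)[of "(t, x)" p] p tx by (simp add: dist_norm)
      then show "onorm (blinfun_apply (\<phi>' p) - blinfun_apply (\<phi>' (t, x))) \<le> e'"
        by (simp add: norm_blinfun.rep_eq minus_blinfun.rep_eq fun_diff_def)
    qed
    also have "\<dots> \<le> r * e'" using nv e'(1) by (intro mult_right_mono) simp_all
    also have "\<dots> = e * \<tau>" using e'(2) by (simp add: r_def mult_ac)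
    finally show "\<bar>\<phi> (t + \<tau>, x + v) - \<phi> (t, x) - (\<tau> * pt t x + v \<bullet> px t x)\<bar> \<le> e * \<tau>"
      by (simp add: derivative_split)
  qed
qed

end

section \<open>Riemann sums over the uniform subdivision\<close>

lemma left_index_unique:
  assumes N: "N \<ge> 1" and t: "0 < t" "t \<le> 1"
  shows "t \<in> {real i / real N<..real (Suc i) / real N} \<longleftrightarrow> i = left_index N t"
proof
  assume "i = left_index N t"
  then show "t \<in> {real i / real N<..real (Suc i) / real N}" using left_index_bounds[OF N t] by simp
next
  assume a: "t \<in> {real i / real N<..real (Suc i) / real N}"
  have N0: "real N > 0" using N by simp
  have "real i < real N * t" "real N * t \<le> real (Suc i)"
    using a N0 by (simp_all add: divide_less_eq le_divide_eq mult.commute)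
  then have "\<lceil>real N * t\<rceil> = int i + 1" by (intro ceiling_unique) simp_all
  then have "nat \<lceil>real N * t\<rceil> = Suc i" by simp
  then show "i = left_index N t" using left_index_bounds(1)[OF N t] by simp
qed

lemma left_index_tendsto:
  assumes N: "\<And>j. N j \<ge> 1" "filterlim N at_top sequentially" and t: "0 \<le> t" "t \<le> 1"
  shows "(\<lambda>j. real (left_index (N j) t) / real (N j)) \<longlonglongrightarrow> t"
proof -
  have l: "(\<lambda>j. 1 / real (N j)) \<longlonglongrightarrow> 0" by (rule filterlim_compose[OF lim_1_over_n N(2)])
  have "(\<lambda>j. t - real (left_index (N j) t) / real (N j)) \<longlonglongrightarrow> 0"
  proof (rule tendsto_sandwich[OF _ _ tendsto_const l])
    show "\<forall>\<^sub>F j in sequentially. 0 \<le> t - real (left_index (N j) t) / real (N j)"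
      using left_index_unit(2)[OF N(1) t] by (intro always_eventually allI) simp
    show "\<forall>\<^sub>F j in sequentially. t - real (left_index (N j) t) / real (N j) \<le> 1 / real (N j)"
      using left_index_unit(3)[OF N(1) t] by (intro always_eventually allI)
  qed
  from tendsto_diff[OF tendsto_const[of t] this] show ?thesis by simp
qed

lemma left_index_eventually_less:
  assumes N: "\<And>j. N j \<ge> 1" "filterlim N at_top sequentially" and st: "0 \<le> s" "s < t" "t \<le> 1"
  shows "\<forall>\<^sub>F j in sequentially. left_index (N j) s < left_index (N j) t"
proof -
  have "(\<lambda>j. real (left_index (N j) t) / real (N j)) \<longlonglongrightarrow> t" by (rule left_index_tendsto[OF N]) (use st in auto)
  then have "\<forall>\<^sub>F j in sequentially. s < real (left_index (N j) t) / real (N j)" using st(2) by (rule order_tendstoD(1))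
  then show ?thesis
  proof eventually_elim
    case (elim j)
    have "real (left_index (N j) s) / real (N j) \<le> s" by (rule left_index_unit(2)[OF N(1)]) (use st in auto)
    then have "real (left_index (N j) s) / real (N j) < real (left_index (N j) t) / real (N j)" using elim by linarith
    then show ?case using N(1)[of j] by (simp add: divide_less_cancel)
  qed
qed

text \<open>The sum is the integral of a step function with value \<open>e j i\<close> on the i-th
  interval, so dominated convergence applies. Measurability of \<open>E\<close> is obtained on the
  way, as that of a pointwise limit.\<close>

lemma riemann_sum_limit:
  fixes e :: "nat \<Rightarrow> nat \<Rightarrow> real"
  assumes N: "\<And>j. N j \<ge> 1" "filterlim N at_top sequentially" and ab: "0 \<le> a" "a \<le> b" "b \<le> 1"
    and conv: "\<And>t. 0 \<le> t \<Longrightarrow> t \<le> 1 \<Longrightarrow> (\<lambda>j. e j (left_index (N j) t)) \<longlonglongrightarrow> E t"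
    and bound: "\<And>j i. i < N j \<Longrightarrow> \<bar>e j i\<bar> \<le> C" and C: "C \<ge> 0"
  shows "set_integrable lborel {a..b} E"
    "(\<lambda>j. \<Sum>i\<in>{left_index (N j) a..<left_index (N j) b}. e j i / real (N j)) \<longlonglongrightarrow> (LINT t:{a..b}|lborel. E t)"
proof -
  \<comment> \<open>The intervals are open on the left, so that each \<open>t\<close> in (0, 1] lies
    in exactly one of them, the one numbered by \<open>left_index\<close>.\<close>
  define s where "s j t = (\<Sum>i\<in>{left_index (N j) a..<left_index (N j) b}.
      indicator {real i / real (N j)<..real (Suc i) / real (N j)} t * e j i)" for j t
  have kN: "left_index (N j) b < N j" for j by (rule left_index_unit(1)[OF N(1)]) (use ab in auto)
  have s_out: "s j t = 0" if "t \<le> 0 \<or> t > 1" for j t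
    unfolding s_def
  proof (rule sum.neutral, intro ballI)
    fix i assume i: "i \<in> {left_index (N j) a..<left_index (N j) b}"
    then have "real (Suc i) / real (N j) \<le> 1" "0 \<le> real i / real (N j)" using kN[of j] by simp_all
    then have "t \<notin> {real i / real (N j)<..real (Suc i) / real (N j)}"
      using that unfolding greaterThanAtMost_iff by (elim disjE) linarith+
    then show "indicator {real i / real (N j)<..real (Suc i) / real (N j)} t * e j i = 0" by simp
  qed
  have s_in: "s j t = (if left_index (N j) a \<le> left_index (N j) t \<and> left_index (N j) t < left_index (N j) b then e j (left_index (N j) t) else 0)"
    if t: "0 < t" "t \<le> 1" for j t
  proof -
    have "s j t = (\<Sum>i\<in>{left_index (N j) a..<left_index (N j) b}. if i = left_index (N j) t then e j (left_index (N j) t) else 0)"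
      unfolding s_def using left_index_unique[OF N(1) t] by (intro sum.cong) (simp_all add: indicator_def)
    then show ?thesis by (simp add: sum.delta)
  qed
  have sm: "s j \<in> borel_measurable lborel" for j
    unfolding s_def by (intro borel_measurable_sum borel_measurable_times borel_measurable_const borel_measurable_indicator) simp
  have sb: "norm (s j t) \<le> C * indicator {0..1} t" for j t
  proof (cases "0 < t \<and> t \<le> 1")
    case True
    then have "left_index (N j) t < N j" by (intro left_index_unit(1)[OF N(1)]) auto
    then show ?thesis using True C bound s_in[of t j] by simp
  next
    case False
    then have "s j t = 0" by (intro s_out) auto
    then show ?thesis using C by simp
  qed
  have lim_in: "(\<lambda>j. s j t) \<longlonglongrightarrow> E t" if t: "a < t" "t < b" for t
  proof -
    have t1: "0 < t" "t \<le> 1" using t ab by auto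
    have "\<forall>\<^sub>F j in sequentially. left_index (N j) t < left_index (N j) b"
      by (rule left_index_eventually_less[OF N]) (use t ab in auto)
    then have "\<forall>\<^sub>F j in sequentially. e j (left_index (N j) t) = s j t"
    proof eventually_elim
      case (elim j)
      have "left_index (N j) a \<le> left_index (N j) t" by (rule left_index_mono) (use t in simp)
      then show ?case using s_in[OF t1] elim by simp
    qed
    then show ?thesis using Lim_transform_eventually[OF conv] t1 by (auto intro: Lim_transform_eventually[OF conv])
  qed
  have lim_out: "(\<lambda>j. s j t) \<longlonglongrightarrow> 0" if t: "t < a \<or> b < t" for t
  proof (cases "0 < t \<and> t \<le> 1")
    case False
    then have "s j t = 0" for j by (intro s_out) auto
    then show ?thesis by simp
  next
    case True
    have "\<forall>\<^sub>F j in sequentially. s j t = 0"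
    proof (cases "t < a")
      case ta: True
      have "\<forall>\<^sub>F j in sequentially. left_index (N j) t < left_index (N j) a"
        by (rule left_index_eventually_less[OF N]) (use ta True ab in auto)
      then show ?thesis by eventually_elim (use True s_in in auto)
    next
      case False
      then have "b < t" using t by simp
      then have l: "left_index (N j) b \<le> left_index (N j) t" for j by (intro left_index_mono) simp
      have "s j t = 0" for j using True s_in[of t j] l[of j] by simp
      then show ?thesis by simp
    qed
    then show ?thesis by (rule tendsto_eventually)
  qed
  \<comment> \<open>At the endpoints the step functions need not converge to \<open>E\<close>; for
    instance they vanish at \<open>b\<close>. Measurability is therefore shown on the open interval,
    and the two endpoint values are added separately.\<close>
  have "(\<lambda>t. indicator {a<..<b} t * E t) \<in> borel_measurable lborel"
  proof (rule borel_measurable_LIMSEQ_real[where u = "\<lambda>j t. indicator {a<..<b} t * s j t"])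
    show "(\<lambda>j. indicator {a<..<b} t * s j t) \<longlonglongrightarrow> indicator {a<..<b} t * E t" for t
    proof (cases "t \<in> {a<..<b}")
      case True
      then show ?thesis using lim_in by simp
    qed simp
    show "(\<lambda>t. indicator {a<..<b} t * s j t) \<in> borel_measurable lborel" for j
      by (intro borel_measurable_times sm borel_measurable_indicator) simp
  qed
  \<comment> \<open>The condition \<open>a \<noteq> b\<close> prevents the endpoint from being
    counted twice when the interval is a single point.\<close>
  then have "(\<lambda>t. (if t = a then E a else 0) + (if t = b \<and> a \<noteq> b then E b else 0) + indicator {a<..<b} t * E t) \<in> borel_measurable lborel"
    by (intro borel_measurable_add) simp_all
  also have "(\<lambda>t. (if t = a then E a else 0) + (if t = b \<and> a \<noteq> b then E b else 0) + indicator {a<..<b} t * E t) = (\<lambda>t. indicator {a..b} t * E t)"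
    using ab by (auto simp: indicator_def fun_eq_iff)
  finally have Em: "(\<lambda>t. indicator {a..b} t * E t) \<in> borel_measurable lborel" .
  have int: "integrable lborel (\<lambda>t :: real. C * indicator {0..1} t)"
    by (intro integrable_mult_right integrable_real_indicator) simp_all
  have AE: "AE t in lborel. (\<lambda>j. s j t) \<longlonglongrightarrow> indicator {a..b} t * E t"
    using AE_lborel_singleton[of a] AE_lborel_singleton[of b]
  proof eventually_elim
    case (elim t)
    consider "a < t" "t < b" | "t < a \<or> b < t" using elim by linarith
    then show ?case
    proof cases
      case 1 then show ?thesis using lim_in by simp
    next
      case 2
      then have "t \<notin> {a..b}" by auto
      then show ?thesis using lim_out[OF 2] by simp
    qed
  qed
  note dc = Em sm int AE AE_I2[OF sb]
  show "set_integrable lborel {a..b} E"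
    unfolding set_integrable_def using integrable_dominated_convergence[OF dc] by simp
  have "(\<lambda>j. \<integral>t. s j t \<partial>lborel) \<longlonglongrightarrow> (\<integral>t. indicator {a..b} t * E t \<partial>lborel)"
    by (rule integral_dominated_convergence[OF dc])
  moreover have "(\<integral>t. s j t \<partial>lborel) = (\<Sum>i\<in>{left_index (N j) a..<left_index (N j) b}. e j i / real (N j))" for j
  proof -
    have m: "measure lborel {real i / real (N j)<..(1 + real i) / real (N j)} = 1 / real (N j)" for i
      by (simp add: divide_right_mono diff_divide_distrib[symmetric])
    have "(\<integral>t. s j t \<partial>lborel) = (\<Sum>i\<in>{left_index (N j) a..<left_index (N j) b}.
        \<integral>t. indicator {real i / real (N j)<..real (Suc i) / real (N j)} t * e j i \<partial>lborel)"
      unfolding s_def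
      by (rule Bochner_Integration.integral_sum, rule integrable_mult_left, rule integrable_real_indicator)
         (simp_all add: divide_right_mono)
    also have "\<dots> = (\<Sum>i\<in>{left_index (N j) a..<left_index (N j) b}. e j i / real (N j))"
      by (rule sum.cong[OF refl]) (simp add: m)
    finally show ?thesis .
  qed
  ultimately show "(\<lambda>j. \<Sum>i\<in>{left_index (N j) a..<left_index (N j) b}. e j i / real (N j)) \<longlonglongrightarrow> (LINT t:{a..b}|lborel. E t)"
    unfolding set_lebesgue_integral_def by simp
qed

section \<open>The limiting identity\<close>

text \<open>The complement of the support is a union of possibly uncountably many open null sets.
  Second countability reduces it to a countable union, so almost every point lies in the bounded
  support.\<close>

lemma compact_support_bounded_varifold:
  fixes V :: "((real ^ 'n) \<times> (real ^ 'n ^ 'n)) measure"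
  assumes V: "V \<in> varifolds d" and supp: "compact (measure_support V)" and mass: "emeasure (mass V) UNIV \<le> ennreal M"
  shows "\<exists>R. bounded_varifold d R M V"
proof -
  have sV: "sets V = sets (grassmann_borel d)" using V by (simp add: varifolds_def)
  have spV: "space V = UNIV \<times> grassmannian d"
    using sets_eq_imp_space_eq[OF sV] space_grassmann_borel by metis
  have fst: "fst \<in> borel_measurable V"
    by (rule borel_measurable_continuous_on_bundle[OF sV]) (intro continuous_intros)
  have "emeasure (mass V) UNIV = emeasure V (fst -` UNIV \<inter> space V)"
    unfolding mass_def by (rule emeasure_distr[OF fst]) simp
  then have m: "emeasure V (space V) \<le> ennreal M" using mass by simp
  have Uset: "U \<inter> space V \<in> sets V" if "open U" for U
  proof -
    have "U \<inter> (UNIV \<times> grassmannian d) \<in> sets (grassmann_borel d)"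
      unfolding sets_restrict_space using borel_open[OF that] by blast
    then show ?thesis using sV spV by simp
  qed
  define F where "F = {U :: ((real ^ 'n) \<times> (real ^ 'n ^ 'n)) set. open U \<and> emeasure V (U \<inter> space V) = 0}"
  obtain F' where F': "F' \<subseteq> F" "countable F'" "\<Union>F' = \<Union>F"
    using Lindelof[of F] unfolding F_def by blast
  have null: "(\<Union>U\<in>F'. U \<inter> space V) \<in> null_sets V"
    using F' Uset by (intro null_sets_UN') (auto simp: F_def null_sets_def)
  have "bounded (measure_support V)" using supp by (rule compact_imp_bounded)
  then obtain R where R: "\<And>p. p \<in> measure_support V \<Longrightarrow> norm p \<le> R" unfolding bounded_iff by blast
  have "AE p in V. p \<notin> (\<Union>U\<in>F'. U \<inter> space V)" by (rule AE_not_in[OF null])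
  then have "AE p in V. norm (fst p) \<le> R"
    using AE_space
  proof eventually_elim
    case (elim p)
    have "p \<notin> \<Union>F" using elim F'(3) by blast
    then have "\<forall>U. open U \<and> p \<in> U \<longrightarrow> emeasure V (U \<inter> space V) > 0"
      unfolding F_def by (auto simp: zero_less_iff_neq_zero)
    then have "p \<in> measure_support V" using elim(2) unfolding measure_support_def by simp
    then have "norm p \<le> R" by (rule R)
    then show ?case using norm_fst_le[of "fst p" "snd p"] by simp
  qed
  then show ?thesis using sV m by (auto simp: bounded_varifold_def)
qed

section \<open>The one-step estimate, its summation and the passage to the limit\<close>

locale mcf_weight = mcf_scheme \<psi> \<epsilon> d M R0 K \<tau>0 V\<^sub>0 + C1_weight \<phi> \<phi>'
  for \<psi> :: "real ^ 'n \<Rightarrow> real" and \<epsilon> :: real and d :: nat and M R0 K \<tau>0 :: real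
    and V\<^sub>0 :: "((real ^ 'n) \<times> (real ^ 'n ^ 'n)) measure"
    and \<phi> :: "real \<times> (real ^ 'n) \<Rightarrow> real" and \<phi>' :: "real \<times> (real ^ 'n) \<Rightarrow> (real \<times> (real ^ 'n)) \<Rightarrow>\<^sub>L real"
begin

definition "weighted_mass t V = (\<integral>(x, S :: real ^ 'n ^ 'n). \<phi> (t, x) \<partial>V)"
definition "time_term t V = (\<integral>(x, S :: real ^ 'n ^ 'n). pt t x \<partial>V)"
definition "space_term t V = action (\<lambda>x. \<phi> (t, x)) (px t) V"

lemma slices:
  assumes "t \<in> {0..1}"
  shows "continuous_on UNIV (\<lambda>x. \<phi> (t, x))" "continuous_on UNIV (pt t)" "continuous_on UNIV (px t)"
  by (rule continuous_slice[OF continuous_weight' assms] continuous_slice[OF continuous_pt assms] continuous_slice[OF continuous_px assms])+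

lemma continuous_on_bundle_fst:
  assumes "continuous_on UNIV f"
  shows "continuous_on (grassmann_bundle d) (\<lambda>(x :: real ^ 'n, S :: real ^ 'n ^ 'n). f x)"
  unfolding split_beta' by (rule continuous_on_compose2[OF assms]) (auto intro!: continuous_intros)

lemma weight_bounds:
  "\<exists>B\<ge>0. \<forall>t\<in>{0..1}. \<forall>x. norm x \<le> R \<longrightarrow> \<bar>\<phi> (t, x)\<bar> \<le> B \<and> \<bar>pt t x\<bar> \<le> B \<and> norm (px t x) \<le> B"
proof -
  obtain B1 where B1: "B1 \<ge> 0" "\<forall>t\<in>{0..1}. \<forall>x. norm x \<le> R \<longrightarrow> norm (\<phi> (t, x)) \<le> B1"
    using compact_bound[OF continuous_weight', of R] by blast
  obtain B2 where B2: "B2 \<ge> 0" "\<forall>t\<in>{0..1}. \<forall>x. norm x \<le> R \<longrightarrow> norm (pt t x) \<le> B2"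
    using compact_bound[OF continuous_pt, of R] by blast
  obtain B3 where B3: "B3 \<ge> 0" "\<forall>t\<in>{0..1}. \<forall>x. norm x \<le> R \<longrightarrow> norm (px t x) \<le> B3"
    using compact_bound[OF continuous_px, of R] by blast
  show ?thesis
  proof (rule exI[of _ "B1 + B2 + B3"], intro conjI ballI allI impI)
    show "0 \<le> B1 + B2 + B3" using B1(1) B2(1) B3(1) by simp
    fix t x assume "t \<in> {0..1::real}" and "norm (x :: real ^ 'n) \<le> R"
    then have "norm (\<phi> (t, x)) \<le> B1" "norm (pt t x) \<le> B2" "norm (px t x) \<le> B3" using B1(2) B2(2) B3(2) by blast+
    then show "\<bar>\<phi> (t, x)\<bar> \<le> B1 + B2 + B3" "\<bar>pt t x\<bar> \<le> B1 + B2 + B3" "norm (px t x) \<le> B1 + B2 + B3"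
      using B1(1) B2(1) B3(1) by simp_all
  qed
qed

text \<open>The discrete form of the identity for one step. The threshold depends on
  \<open>e\<close> and the radius but not on the varifold or the time, so the errors can be
  summed.\<close>

lemma step_increment:
  assumes e: "e > 0"
  shows "\<exists>\<delta>>0. \<forall>W t \<tau>. bounded_varifold d R (M + 1) W \<longrightarrow> 0 \<le> t \<longrightarrow> 0 \<le> \<tau> \<longrightarrow> t + \<tau> \<le> 1 \<longrightarrow> \<tau> \<le> \<delta> \<longrightarrow> \<tau> \<le> \<tau>0 \<longrightarrow>
    \<bar>weighted_mass (t + \<tau>) (flow_step d \<psi> \<epsilon> \<tau> W) - weighted_mass t W - \<tau> * (space_term t W + time_term t W)\<bar> \<le> e * \<tau>"
proof -
  define m where "m = M + 1"
  have m: "m \<ge> 0" using M by (simp add: m_def)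
  define b where "b = hbound m"
  have b: "b \<ge> 0" unfolding b_def by (rule hbound_nonneg[OF m])
  note K = K_nonneg
  define e1 where "e1 = e / (2 * (m + 1))"
  have e1: "e1 > 0" "2 * e1 * m \<le> e"
  proof -
    show pos: "e1 > 0" using e m by (simp add: e1_def)
    have "2 * e1 * m \<le> 2 * e1 * (m + 1)" using pos by simp
    also have "\<dots> = e" using m by (simp add: e1_def field_simps)
    finally show "2 * e1 * m \<le> e" .
  qed
  obtain \<delta>1 where \<delta>1: "\<delta>1 > 0" "\<And>t \<tau> x v. 0 \<le> t \<Longrightarrow> 0 \<le> \<tau> \<Longrightarrow> \<tau> \<le> \<delta>1 \<Longrightarrow> t + \<tau> \<le> 1 \<Longrightarrow> norm x \<le> R \<Longrightarrow> norm v \<le> b * \<tau> \<Longrightarrow>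
    \<bar>\<phi> (t + \<tau>, x + v) - \<phi> (t, x) - (\<tau> * pt t x + v \<bullet> px t x)\<bar> \<le> e1 * \<tau>"
    using uniform_expansion[OF b e1(1), of R] by blast
  obtain B where B: "B \<ge> 0" "\<And>t x. t \<in> {0..1} \<Longrightarrow> norm x \<le> R \<Longrightarrow> \<bar>\<phi> (t, x)\<bar> \<le> B \<and> \<bar>pt t x\<bar> \<le> B \<and> norm (px t x) \<le> B"
    using weight_bounds[of R] by blast
  \<comment> \<open>\<open>L\<close> collects the coefficients of tau^2 that come from the Jacobian
    expansion and from the product of the two increments. The choice of \<open>\<delta>\<close>
    makes L tau at most \<open>e1\<close>.\<close>
  define L where "L = B * K + (e1 + B * (1 + b)) * K"
  have L: "L \<ge> 0" unfolding L_def using B(1) K e1(1) b by (intro add_nonneg_nonneg mult_nonneg_nonneg) simp_all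
  define \<delta> where "\<delta> = min \<delta>1 (e1 / (L + 1))"
  have \<delta>: "\<delta> > 0" "\<delta> \<le> \<delta>1" "\<delta> \<le> e1 / (L + 1)" using \<delta>1(1) e1(1) L by (simp_all add: \<delta>_def)
  show ?thesis
  proof (rule exI[of _ \<delta>], rule conjI[OF \<delta>(1)], intro allI impI)
    fix W :: "((real ^ 'n) \<times> (real ^ 'n ^ 'n)) measure" and t \<tau> :: real
    assume "bounded_varifold d R (M + 1) W" and t: "0 \<le> t" "t + \<tau> \<le> 1" and \<tau>: "0 \<le> \<tau>" "\<tau> \<le> \<delta>" "\<tau> \<le> \<tau>0"
    then have W: "bounded_varifold d R m W" by (simp add: m_def)
    have t01: "t \<in> {0..1}" "t + \<tau> \<in> {0..1}" using t \<tau>(1) by simp_all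
    note sl = slices[OF t01(1)]
    note st = sc[folded m_def] W m order_refl \<tau>(1) \<tau>(3)
    let ?J = "\<lambda>x S. step_density d \<tau> W x S" and ?x = "\<lambda>x. x + \<tau> *\<^sub>R h W x" and ?D = "\<lambda>x S. div_along S (h W) x"
    have pt_est: "\<bar>?J x S * \<phi> (t + \<tau>, ?x x) - \<phi> (t, x) - \<tau> * (\<phi> (t, x) * ?D x S + px t x \<bullet> h W x + pt t x)\<bar> \<le> 2 * e1 * \<tau>"
      if x: "norm x \<le> R" and S: "S \<in> grassmannian d" for x S
    proof -
      define \<Delta> where "\<Delta> = \<phi> (t + \<tau>, ?x x) - \<phi> (t, x)"
      define a where "a = pt t x + px t x \<bullet> h W x"
      have hb: "norm (h W x) \<le> b" unfolding b_def by (rule norm_h_le[OF W m])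
      have "norm (\<tau> *\<^sub>R h W x) \<le> b * \<tau>" using mult_right_mono[OF hb \<tau>(1)] \<tau>(1) by (simp add: mult.commute)
      from \<delta>1(2)[OF t(1) \<tau>(1) _ t(2) x this] \<tau>(2) \<delta>(2)
      have "\<bar>\<Delta> - (\<tau> * pt t x + (\<tau> *\<^sub>R h W x) \<bullet> px t x)\<bar> \<le> e1 * \<tau>"
        unfolding \<Delta>_def by linarith
      then have \<Delta>1: "\<bar>\<Delta> - \<tau> * a\<bar> \<le> e1 * \<tau>" unfolding a_def by (simp add: distrib_left inner_commute)
      note Bx = B(2)[OF t01(1) x]
      have "\<bar>px t x \<bullet> h W x\<bar> \<le> B * b"
        using Cauchy_Schwarz_ineq2[of "px t x" "h W x"] mult_mono[of "norm (px t x)" B "norm (h W x)" b] Bx hb B(1) by simp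
      moreover have "\<bar>pt t x\<bar> \<le> B" using Bx by blast
      ultimately have "\<bar>a\<bar> \<le> B + B * b" unfolding a_def by linarith
      then have "\<bar>a\<bar> \<le> B * (1 + b)" by (simp add: distrib_left)
      then have "\<bar>\<tau> * a\<bar> \<le> \<tau> * (B * (1 + b))" unfolding abs_mult using \<tau>(1) by (simp add: mult_left_mono)
      then have \<Delta>2: "\<bar>\<Delta>\<bar> \<le> (e1 + B * (1 + b)) * \<tau>" using \<Delta>1 unfolding distrib_right by (simp add: mult.commute[of \<tau>])
      have J1: "\<bar>?J x S - 1 - \<tau> * ?D x S\<bar> \<le> K * \<tau>\<^sup>2" and J2: "\<bar>?J x S - 1\<bar> \<le> K * \<tau>"
        by (rule step_bounds[OF st S])+
      have 1: "\<bar>\<phi> (t, x) * (?J x S - 1 - \<tau> * ?D x S)\<bar> \<le> B * (K * \<tau>\<^sup>2)"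
        unfolding abs_mult using Bx J1 B(1) by (intro mult_mono) simp_all
      have 2: "\<bar>\<Delta> * (?J x S - 1)\<bar> \<le> ((e1 + B * (1 + b)) * \<tau>) * (K * \<tau>)"
        unfolding abs_mult
      proof (rule mult_mono[OF \<Delta>2 J2])
        show "0 \<le> (e1 + B * (1 + b)) * \<tau>" using e1(1) B(1) b \<tau>(1) by (intro mult_nonneg_nonneg add_nonneg_nonneg) simp_all
      qed simp
      \<comment> \<open>A product rule with remainder: the error of the Jacobian weighted by
        \<open>\<phi>\<close>, the Taylor error of \<open>\<phi>\<close>, and the product of the two
        increments, which is quadratic in tau.\<close>
      have "?J x S * \<phi> (t + \<tau>, ?x x) - \<phi> (t, x) - \<tau> * (\<phi> (t, x) * ?D x S + px t x \<bullet> h W x + pt t x)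
        = \<phi> (t, x) * (?J x S - 1 - \<tau> * ?D x S) + (\<Delta> - \<tau> * a) + \<Delta> * (?J x S - 1)"
        unfolding \<Delta>_def a_def by (simp add: algebra_simps)
      also have "\<bar>\<dots>\<bar> \<le> B * (K * \<tau>\<^sup>2) + e1 * \<tau> + ((e1 + B * (1 + b)) * \<tau>) * (K * \<tau>)"
        using 1 2 \<Delta>1 by linarith
      also have "\<dots> = e1 * \<tau> + (L * \<tau>) * \<tau>" unfolding L_def by (simp add: algebra_simps power2_eq_square)
      also have "\<dots> \<le> e1 * \<tau> + e1 * \<tau>"
      proof (intro add_left_mono mult_right_mono \<tau>(1))
        have "L * \<tau> \<le> L * (e1 / (L + 1))" using \<tau>(2) \<delta>(3) L by (intro mult_left_mono) linarith+
        also have "\<dots> \<le> e1" using L e1(1) by (simp add: divide_simps)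
        finally show "L * \<tau> \<le> e1" .
      qed
      finally show ?thesis by (simp add: mult_ac)
    qed
    let ?g = "\<lambda>(x, S :: real ^ 'n ^ 'n). \<phi> (t + \<tau>, x)"
    have cg: "continuous_on (grassmann_bundle d) ?g" by (rule continuous_on_bundle_fst[OF slices(1)[OF t01(2)]])
    note fs = integral_flow_step[OF st cg]
    have i1: "integrable W (\<lambda>(x, S). ?J x S * \<phi> (t + \<tau>, ?x x))"
      using bounded_varifold_integrable_continuous[OF W fs(2)] by simp
    have i2: "integrable W (\<lambda>(x, S :: real ^ 'n ^ 'n). \<phi> (t, x))"
      by (rule bounded_varifold_integrable_continuous[OF W continuous_on_bundle_fst[OF sl(1)]])
    have i3: "integrable W (\<lambda>(x, S :: real ^ 'n ^ 'n). pt t x)"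
      by (rule bounded_varifold_integrable_continuous[OF W continuous_on_bundle_fst[OF sl(2)]])
    have i4: "integrable W (\<lambda>(x, S). \<phi> (t, x) * ?D x S + px t x \<bullet> h W x)"
      using Bochner_Integration.integrable_add[OF
          bounded_varifold_integrable_continuous[OF W continuous_on_action_integrand(1)[OF W m sl(1) sl(3)]]
          bounded_varifold_integrable_continuous[OF W continuous_on_action_integrand(2)[OF W m sl(1) sl(3)]]]
      by (simp add: split_beta')
    have "weighted_mass (t + \<tau>) (flow_step d \<psi> \<epsilon> \<tau> W) - weighted_mass t W - \<tau> * (space_term t W + time_term t W) =
      (\<integral>(x, S). ?J x S * \<phi> (t + \<tau>, ?x x) - \<phi> (t, x) - \<tau> * (\<phi> (t, x) * ?D x S + px t x \<bullet> h W x + pt t x) \<partial>W)"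
      using i1 i2 i3 i4 unfolding weighted_mass_def space_term_def time_term_def action_def fs(1)
      by (simp add: split_beta')
    also have "norm \<dots> \<le> (2 * e1 * \<tau>) * m"
      by (rule bounded_varifold_integral_le[OF W m]) (use pt_est e1(1) \<tau>(1) in auto)
    also have "\<dots> = (2 * e1 * m) * \<tau>" by simp
    also have "\<dots> \<le> e * \<tau>" by (rule mult_right_mono[OF e1(2) \<tau>(1)])
    finally show "\<bar>weighted_mass (t + \<tau>) (flow_step d \<psi> \<epsilon> \<tau> W) - weighted_mass t W - \<tau> * (space_term t W + time_term t W)\<bar> \<le> e * \<tau>"
      by simp
  qed
qed

text \<open>At most N steps with error e/N each give a total error of at most
  \<open>e\<close>.\<close>

lemma telescope_error:
  assumes N: "fine_enough N" and jk: "j \<le> k" "k \<le> N" and e: "e \<ge> 0"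
    and step: "\<And>W t. bounded_varifold d R1 (M + 1) W \<Longrightarrow> 0 \<le> t \<Longrightarrow> t + 1 / real N \<le> 1 \<Longrightarrow>
      \<bar>weighted_mass (t + 1 / real N) (flow_step d \<psi> \<epsilon> (1 / real N) W) - weighted_mass t W - 1 / real N * (space_term t W + time_term t W)\<bar> \<le> e * (1 / real N)"
  shows "\<bar>weighted_mass (real k / real N) (node N k) - weighted_mass (real j / real N) (node N j) -
     (\<Sum>i\<in>{j..<k}. (space_term (real i / real N) (node N i) + time_term (real i / real N) (node N i)) / real N)\<bar> \<le> e"
proof -
  let ?A = "\<lambda>k. weighted_mass (real k / real N) (node N k)"
  let ?D = "\<lambda>i. space_term (real i / real N) (node N i) + time_term (real i / real N) (node N i)"
  have N0: "real N > 0" using N by (simp add: fine_enough_def)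
  have "\<bar>?A k - ?A j -
     (\<Sum>i\<in>{j..<k}. ?D i / real N)\<bar>
     \<le> e * (real (k - j) / real N)"
    using jk
  proof (induction k rule: dec_induct)
    case base
    show ?case by simp
  next
    case (step k)
    have kN: "k < N" using step by simp
    have eq: "real (Suc k) / real N = real k / real N + 1 / real N" by (simp add: add_divide_distrib)
    have "real (Suc k) / real N \<le> 1" using N0 kN by simp
    then have "\<bar>?A (Suc k) - ?A k -
        1 / real N * ?D k\<bar> \<le> e * (1 / real N)"
      unfolding node_Suc[OF kN] eq
      by (intro assms(5) node_bounded[OF N]) (use kN in simp_all)
    moreover have "(\<Sum>i\<in>{j..<Suc k}. ?D i / real N) =
      (\<Sum>i\<in>{j..<k}. ?D i / real N) +
      1 / real N * ?D k"
      using step by (simp del: discrete_flow_node.simps)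
    moreover have "e * (real (Suc k - j) / real N) = e * (real (k - j) / real N) + e * (1 / real N)"
    proof -
      have "real (Suc k - j) = real (k - j) + 1" using step by simp
      then show ?thesis by (simp only: add_divide_distrib distrib_left)
    qed
    moreover have "\<bar>?A k - ?A j -
      (\<Sum>i\<in>{j..<k}. ?D i / real N)\<bar>
      \<le> e * (real (k - j) / real N)"
      using step by simp
    ultimately show ?case by linarith
  qed
  also have "\<dots> \<le> e * 1"
    using jk N0 e by (intro mult_left_mono) (simp_all add: divide_le_eq)
  finally show ?thesis by simp
qed

text \<open>Provides the constant majorant for dominated convergence in time.\<close>

lemma term_bounds:
  "\<exists>C\<ge>0. \<forall>t\<in>{0..1}. \<forall>W. bounded_varifold d R1 (M + 1) W \<longrightarrow> \<bar>space_term t W\<bar> \<le> C \<and> \<bar>time_term t W\<bar> \<le> C"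
proof -
  have m: "M + 1 \<ge> 0" using M by simp
  obtain B where B: "B \<ge> 0" "\<And>t x. t \<in> {0..1} \<Longrightarrow> norm x \<le> R1 \<Longrightarrow> \<bar>\<phi> (t, x)\<bar> \<le> B \<and> \<bar>pt t x\<bar> \<le> B \<and> norm (px t x) \<le> B"
    using weight_bounds[of R1] by blast
  define b where "b = hbound (M + 1)"
  have b: "b \<ge> 0" unfolding b_def by (rule hb)
  define C1 where "C1 = B * (real d * b) + B * b"
  have C1: "C1 \<ge> 0" unfolding C1_def using B(1) b by simp
  show ?thesis
  proof (rule exI[of _ "(C1 + B) * (M + 1)"], intro conjI ballI allI impI)
    show "0 \<le> (C1 + B) * (M + 1)" using C1 B(1) m by simp
    fix t :: real and W :: "((real ^ 'n) \<times> (real ^ 'n ^ 'n)) measure"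
    assume t: "t \<in> {0..1}" and W: "bounded_varifold d R1 (M + 1) W"
    have "norm (space_term t W) \<le> (C1 + B) * (M + 1)"
      unfolding space_term_def action_def
    proof (rule bounded_varifold_integral_le[OF W m])
      fix x :: "real ^ 'n" and S :: "real ^ 'n ^ 'n" assume x: "norm x \<le> R1" and S: "S \<in> grassmannian d"
      note Bx = B(2)[OF t x]
      have hb': "norm (h W x) \<le> b" unfolding b_def by (rule norm_h_le[OF W m])
      have "\<bar>div_along S (h W) x\<bar> \<le> real d * b"
        unfolding div_along_def b_def by (rule abs_trace_le[OF S norm_jacobian_h_le[OF W m]])
      then have "\<bar>\<phi> (t, x) * div_along S (h W) x\<bar> \<le> B * (real d * b)"
        unfolding abs_mult using Bx B(1) by (intro mult_mono) simp_all
      moreover have "\<bar>px t x \<bullet> h W x\<bar> \<le> B * b"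
        using Cauchy_Schwarz_ineq2[of "px t x" "h W x"] mult_mono[of "norm (px t x)" B "norm (h W x)" b] Bx hb' B(1) by simp
      ultimately have "\<bar>\<phi> (t, x) * div_along S (h W) x + px t x \<bullet> h W x\<bar> \<le> C1" unfolding C1_def by linarith
      then show "norm (case (x, S) of (x, S) \<Rightarrow> \<phi> (t, x) * div_along S (h W) x + px t x \<bullet> h W x) \<le> C1 + B"
        using B(1) by simp
    qed (use C1 B(1) in simp)
    then show "\<bar>space_term t W\<bar> \<le> (C1 + B) * (M + 1)" by simp
    have "norm (time_term t W) \<le> (C1 + B) * (M + 1)"
      unfolding time_term_def
    proof (rule bounded_varifold_integral_le[OF W m])
      fix x :: "real ^ 'n" and S :: "real ^ 'n ^ 'n" assume x: "norm x \<le> R1" and S: "S \<in> grassmannian d"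
      show "norm (case (x, S) of (x, S) \<Rightarrow> pt t x) \<le> C1 + B" using B(2)[OF t x] C1 by simp
    qed (use C1 B(1) in simp)
    then show "\<bar>time_term t W\<bar> \<le> (C1 + B) * (M + 1)" by simp
  qed
qed

text \<open>Time and varifold vary together, since the nodes belonging to \<open>t\<close> carry
  times that merely converge to \<open>t\<close>.\<close>

lemma terms_tendsto:
  assumes W: "\<And>j. bounded_varifold d R1 (M + 1) (W j)" and V: "bounded_varifold d R1 (M + 1) V" and lim: "narrow_limit d W V"
    and s: "\<And>j. s j \<in> {0..1}" "s \<longlonglongrightarrow> t" and t: "t \<in> {0..1}"
  shows "(\<lambda>j. weighted_mass (s j) (W j)) \<longlonglongrightarrow> weighted_mass t V"
    "(\<lambda>j. time_term (s j) (W j)) \<longlonglongrightarrow> time_term t V"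
    "(\<lambda>j. space_term (s j) (W j)) \<longlonglongrightarrow> space_term t V"
proof -
  have m: "M + 1 \<ge> 0" using M by simp
  note sl = slices[OF t] and slj = slices[OF s(1)]
  note u = slice_tendsto_uniform[OF continuous_weight' t s] slice_tendsto_uniform[OF continuous_pt t s]
    slice_tendsto_uniform[OF continuous_px t s]
  show "(\<lambda>j. weighted_mass (s j) (W j)) \<longlonglongrightarrow> weighted_mass t V"
    unfolding weighted_mass_def
  proof (rule narrow_limit_uniform[OF W V m lim continuous_on_bundle_fst[OF sl(1)] continuous_on_bundle_fst[OF slj(1)]])
    fix e :: real assume "e > 0"
    from u(1)[OF this, of R1] show "\<forall>\<^sub>F j in sequentially. \<forall>x S. norm x \<le> R1 \<longrightarrow> S \<in> grassmannian d \<longrightarrow>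
      norm ((case (x, S :: real ^ 'n ^ 'n) of (x, S) \<Rightarrow> \<phi> (s j, x)) - (case (x, S) of (x, S) \<Rightarrow> \<phi> (t, x))) \<le> e"
      by eventually_elim simp
  qed
  show "(\<lambda>j. time_term (s j) (W j)) \<longlonglongrightarrow> time_term t V"
    unfolding time_term_def
  proof (rule narrow_limit_uniform[OF W V m lim continuous_on_bundle_fst[OF sl(2)] continuous_on_bundle_fst[OF slj(2)]])
    fix e :: real assume "e > 0"
    from u(2)[OF this, of R1] show "\<forall>\<^sub>F j in sequentially. \<forall>x S. norm x \<le> R1 \<longrightarrow> S \<in> grassmannian d \<longrightarrow>
      norm ((case (x, S :: real ^ 'n ^ 'n) of (x, S) \<Rightarrow> pt (s j) x) - (case (x, S) of (x, S) \<Rightarrow> pt t x)) \<le> e"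
      by eventually_elim simp
  qed
  obtain B where B: "B \<ge> 0" "\<And>t x. t \<in> {0..1} \<Longrightarrow> norm x \<le> R1 \<Longrightarrow> \<bar>\<phi> (t, x)\<bar> \<le> B \<and> \<bar>pt t x\<bar> \<le> B \<and> norm (px t x) \<le> B"
    using weight_bounds[of R1] by blast
  show "(\<lambda>j. space_term (s j) (W j)) \<longlonglongrightarrow> space_term t V"
    unfolding space_term_def
  proof (rule action_tendsto[OF W V m lim sl(1) sl(3) slj(1) slj(3) _ _ _ _ B(1)])
    fix e :: real assume e: "e > 0"
    from u(1)[OF e, of R1] show "\<forall>\<^sub>F j in sequentially. \<forall>x. norm x \<le> R1 \<longrightarrow> \<bar>\<phi> (s j, x) - \<phi> (t, x)\<bar> \<le> e" by simp
    from u(3)[OF e, of R1] show "\<forall>\<^sub>F j in sequentially. \<forall>x. norm x \<le> R1 \<longrightarrow> norm (px (s j) x - px t x) \<le> e" .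
  next
    fix j and x :: "real ^ 'n" assume x: "norm x \<le> R1"
    from B(2)[OF s(1) x] show "\<bar>\<phi> (s j, x)\<bar> \<le> B" "norm (px (s j) x) \<le> B" by blast+
  qed
qed

lemma flow_identity:
  assumes N: "\<And>j. fine_enough (N j)" "filterlim N at_top sequentially"
    and V: "\<And>t. t \<in> {0..1} \<Longrightarrow> V t \<in> varifolds d"
    and lim: "\<And>t. t \<in> {0..1} \<Longrightarrow> weak_star_limit d (\<lambda>j. discrete_flow d \<psi> \<epsilon> V\<^sub>0 (uniform_subdivision (N j)) t) (V t)"
    and ab: "0 \<le> a" "a \<le> b" "b \<le> 1"
  shows "set_integrable lborel {a..b} (\<lambda>t. space_term t (V t))" "set_integrable lborel {a..b} (\<lambda>t. time_term t (V t))"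
    "weighted_mass b (V b) - weighted_mass a (V a) =
      (LINT t:{a..b}|lborel. space_term t (V t)) + (LINT t:{a..b}|lborel. time_term t (V t))"
    "\<And>t. t \<in> {0..1} \<Longrightarrow> bounded_varifold d R1 (M + 1) (V t)"
proof -
  have N1: "N j \<ge> 1" for j using N(1)[of j] by (simp add: fine_enough_def)
  show Vb: "bounded_varifold d R1 (M + 1) (V t)" if "t \<in> {0..1}" for t
    using node_narrow_limit(1)[OF N _ _ V[OF that] lim[OF that]] that by simp
  have nl: "narrow_limit d (\<lambda>j. node (N j) (left_index (N j) t)) (V t)" if "t \<in> {0..1}" for t
    using node_narrow_limit(2)[OF N _ _ V[OF that] lim[OF that]] that by simp
  let ?s = "\<lambda>j t. real (left_index (N j) t) / real (N j)"
  have s01: "?s j t \<in> {0..1}" if "t \<in> {0..1}" for j t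
    using left_index_unit(1)[OF N1, of t j] that by (simp add: divide_le_eq)
  have sl: "(\<lambda>j. ?s j t) \<longlonglongrightarrow> t" if "t \<in> {0..1}" for t
    by (rule left_index_tendsto[OF N1 N(2)]) (use that in auto)
  have nb: "bounded_varifold d R1 (M + 1) (node (N j) (left_index (N j) t))" if "t \<in> {0..1}" for j t
    by (rule node_bounded[OF N(1)]) (use left_index_unit(1)[OF N1, of t j] that in simp)
  have lims: "(\<lambda>j. weighted_mass (?s j t) (node (N j) (left_index (N j) t))) \<longlonglongrightarrow> weighted_mass t (V t)"
    "(\<lambda>j. time_term (?s j t) (node (N j) (left_index (N j) t))) \<longlonglongrightarrow> time_term t (V t)"
    "(\<lambda>j. space_term (?s j t) (node (N j) (left_index (N j) t))) \<longlonglongrightarrow> space_term t (V t)" if "t \<in> {0..1}" for t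
    by (rule terms_tendsto[OF nb[OF that] Vb[OF that] nl[OF that] s01[OF that] sl[OF that] that])+
  obtain C where C: "C \<ge> 0" "\<And>t W. t \<in> {0..1} \<Longrightarrow> bounded_varifold d R1 (M + 1) W \<Longrightarrow> \<bar>space_term t W\<bar> \<le> C \<and> \<bar>time_term t W\<bar> \<le> C"
    using term_bounds by blast
  define e1 where "e1 j i = space_term (real i / real (N j)) (node (N j) i)" for j i
  define e2 where "e2 j i = time_term (real i / real (N j)) (node (N j) i)" for j i
  have bd: "\<bar>e1 j i\<bar> \<le> C \<and> \<bar>e2 j i\<bar> \<le> C" if "i < N j" for i j
    unfolding e1_def e2_def by (rule C(2)) (use that node_bounded[OF N(1)] in \<open>simp_all add: divide_le_eq\<close>)
  have c1: "(\<lambda>j. e1 j (left_index (N j) t)) \<longlonglongrightarrow> space_term t (V t)" if "0 \<le> t" "t \<le> 1" for t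
    unfolding e1_def by (rule lims(3)) (use that in simp)
  have c2: "(\<lambda>j. e2 j (left_index (N j) t)) \<longlonglongrightarrow> time_term t (V t)" if "0 \<le> t" "t \<le> 1" for t
    unfolding e2_def by (rule lims(2)) (use that in simp)
  have b1: "\<And>j i. i < N j \<Longrightarrow> \<bar>e1 j i\<bar> \<le> C" and b2: "\<And>j i. i < N j \<Longrightarrow> \<bar>e2 j i\<bar> \<le> C" using bd by blast+
  note r1 = riemann_sum_limit[where N = N and e = e1 and E = "\<lambda>t. space_term t (V t)", OF N1 N(2) ab c1 b1 C(1)]
  note r2 = riemann_sum_limit[where N = N and e = e2 and E = "\<lambda>t. time_term t (V t)", OF N1 N(2) ab c2 b2 C(1)]
  show "set_integrable lborel {a..b} (\<lambda>t. space_term t (V t))" by (rule r1(1))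
  show "set_integrable lborel {a..b} (\<lambda>t. time_term t (V t))" by (rule r2(1))
  let ?I = "\<lambda>j. {left_index (N j) a..<left_index (N j) b}"
  have a01: "a \<in> {0..1}" and b01: "b \<in> {0..1}" using ab by auto
  \<comment> \<open>The defect of the discrete identity between the nodes to the left of
    \<open>a\<close> and of \<open>b\<close>. Its limit is computed twice: termwise it is the defect
    of the claimed identity, and by the one-step estimate it is 0.\<close>
  let ?X = "\<lambda>j. weighted_mass (?s j b) (node (N j) (left_index (N j) b)) - weighted_mass (?s j a) (node (N j) (left_index (N j) a)) -
      (\<Sum>i\<in>?I j. (e1 j i + e2 j i) / real (N j))"
  have L1: "?X \<longlonglongrightarrow>
      weighted_mass b (V b) - weighted_mass a (V a) - ((LINT t:{a..b}|lborel. space_term t (V t)) + (LINT t:{a..b}|lborel. time_term t (V t)))"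
    unfolding add_divide_distrib sum.distrib
    by (intro tendsto_diff tendsto_add lims(1)[OF a01] lims(1)[OF b01] r1(2) r2(2))
  have L2: "?X \<longlonglongrightarrow> 0"
  proof (rule tendstoI)
    fix e :: real assume e: "e > 0"
    obtain \<delta> where \<delta>: "\<delta> > 0" "\<And>W t \<tau>. bounded_varifold d R1 (M + 1) W \<Longrightarrow> 0 \<le> t \<Longrightarrow> 0 \<le> \<tau> \<Longrightarrow> t + \<tau> \<le> 1 \<Longrightarrow> \<tau> \<le> \<delta> \<Longrightarrow> \<tau> \<le> \<tau>0 \<Longrightarrow>
    \<bar>weighted_mass (t + \<tau>) (flow_step d \<psi> \<epsilon> \<tau> W) - weighted_mass t W - \<tau> * (space_term t W + time_term t W)\<bar> \<le> e / 2 * \<tau>"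
      using step_increment[of "e / 2" R1] e by auto
    have "(\<lambda>j. 1 / real (N j)) \<longlonglongrightarrow> 0" by (rule filterlim_compose[OF lim_1_over_n N(2)])
    then have "\<forall>\<^sub>F j in sequentially. 1 / real (N j) < \<delta>" using \<delta>(1) by (rule order_tendstoD(2))
    then show "\<forall>\<^sub>F j in sequentially. dist (?X j) 0 < e"
    proof eventually_elim
      case (elim j)
      have "\<bar>?X j\<bar> \<le> e / 2"
        unfolding e1_def e2_def
      proof (rule telescope_error[OF N(1)])
        show "left_index (N j) a \<le> left_index (N j) b" by (rule left_index_mono[OF ab(2)])
        show "left_index (N j) b \<le> N j" using left_index_unit(1)[OF N1, of b j] ab by simp
        show "0 \<le> e / 2" using e by simp
        fix W :: "((real ^ 'n) \<times> (real ^ 'n ^ 'n)) measure" and t :: real assume W: "bounded_varifold d R1 (M + 1) W" and t: "0 \<le> t" "t + 1 / real (N j) \<le> 1"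
        show "\<bar>weighted_mass (t + 1 / real (N j)) (flow_step d \<psi> \<epsilon> (1 / real (N j)) W) - weighted_mass t W - 1 / real (N j) * (space_term t W + time_term t W)\<bar>
          \<le> e / 2 * (1 / real (N j))"
          by (rule \<delta>(2)[OF W t(1) _ t(2)]) (use elim N(1)[of j] in \<open>simp_all add: fine_enough_def\<close>)
      qed
      then show ?case using e by (simp add: dist_real_def)
    qed
  qed
  from LIMSEQ_unique[OF L1 L2]
  show "weighted_mass b (V b) - weighted_mass a (V a) =
      (LINT t:{a..b}|lborel. space_term t (V t)) + (LINT t:{a..b}|lborel. time_term t (V t))" by simp
qed

text \<open>The two parts of the first variation are separately integrable, so they may be joined
  into the single integral \<open>action\<close>; integrals over the mass measure are pulled back to
  the bundle.\<close>

lemma term_identification: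
  assumes V: "bounded_varifold d R m V" and m: "m \<ge> 0" and t: "t \<in> {0..1}"
  shows "weighted_first_variation V (\<lambda>x. \<phi> (t, x)) (h V) = space_term t V"
    "(\<integral>x. vector_derivative (\<lambda>s. \<phi> (s, x)) (at t within {0..1}) \<partial>mass V) = time_term t V"
    "(\<integral>x. \<phi> (t, x) \<partial>mass V) = weighted_mass t V"
proof -
  note sV = bounded_varifold_sets[OF V] and sl = slices[OF t]
  have "integrable V (\<lambda>(x, S). \<phi> (t, x) * div_along S (h V) x)" "integrable V (\<lambda>(x, S :: real ^ 'n ^ 'n). px t x \<bullet> h V x)"
    by (rule bounded_varifold_integrable_continuous[OF V] continuous_on_action_integrand[OF V m sl(1) sl(3)])+
  then show "weighted_first_variation V (\<lambda>x. \<phi> (t, x)) (h V) = space_term t V"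
    unfolding weighted_first_variation_def grad_slice[OF t] space_term_def action_def by (simp add: split_beta')
  show "(\<integral>x. vector_derivative (\<lambda>s. \<phi> (s, x)) (at t within {0..1}) \<partial>mass V) = time_term t V"
    unfolding vector_derivative_slice[OF t] time_term_def
    by (rule integral_mass[OF sV borel_measurable_continuous_onI[OF sl(2)]])
  show "(\<integral>x. \<phi> (t, x) \<partial>mass V) = weighted_mass t V"
    unfolding weighted_mass_def by (rule integral_mass[OF sV borel_measurable_continuous_onI[OF sl(1)]])
qed

end

theorem proposition4p6:
  fixes d :: nat and \<epsilon> M c\<^sub>3 a b :: real
    and \<psi> :: "real ^ 'n \<Rightarrow> real"
    and V\<^sub>0 :: "((real ^ 'n) \<times> (real ^ 'n ^ 'n)) measure"
    and V :: "real \<Rightarrow> ((real ^ 'n) \<times> (real ^ 'n ^ 'n)) measure"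
    and \<phi> :: "real \<times> (real ^ 'n) \<Rightarrow> real"
  assumes "CARD('n) \<ge> 2" and "1 \<le> d" and "d \<le> CARD('n)"
    and "kernel_profile \<psi>"
    and "0 < \<epsilon>" and "\<epsilon> < 1" and "1 \<le> M"
    and "V\<^sub>0 \<in> varifolds d" and "compact (measure_support V\<^sub>0)"
    and "emeasure (mass V\<^sub>0) UNIV \<le> ennreal M"
    and "is_approx_mcf d \<psi> c\<^sub>3 M \<epsilon> V\<^sub>0 V"
    and "C1_on ({0..1} \<times> UNIV) \<phi>"
    and "\<forall>t\<in>{0..1}. \<forall>x. 0 \<le> \<phi> (t, x)"
    and "0 \<le> a" and "a \<le> b" and "b \<le> 1"
  shows
    "set_integrable lborel {a..b} (\<lambda>t. weighted_first_variation (V t) (\<lambda>x. \<phi> (t, x))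
       (approx_mean_curvature \<psi> \<epsilon> (V t))) \<and>
     set_integrable lborel {a..b} (\<lambda>t. \<integral>x. vector_derivative (\<lambda>s. \<phi> (s, x)) (at t within {0..1}) \<partial>mass (V t)) \<and>
     (\<integral>x. \<phi> (b, x) \<partial>mass (V b)) - (\<integral>x. \<phi> (a, x) \<partial>mass (V a)) =
       (LINT t:{a..b}|lborel. weighted_first_variation (V t) (\<lambda>x. \<phi> (t, x))
          (approx_mean_curvature \<psi> \<epsilon> (V t))) +
       (LINT t:{a..b}|lborel. \<integral>x. vector_derivative (\<lambda>s. \<phi> (s, x)) (at t within {0..1}) \<partial>mass (V t))"
proof -
  obtain R0 where V0: "bounded_varifold d R0 M V\<^sub>0"
    using compact_support_bounded_varifold[OF assms(8-10)] by blast
  obtain \<phi>' where \<phi>': "continuous_on ({0..1} \<times> UNIV) \<phi>'"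
    "\<forall>p\<in>{0..1} \<times> UNIV. (\<phi> has_derivative blinfun_apply (\<phi>' p)) (at p within {0..1} \<times> UNIV)"
    using assms(12) unfolding C1_on_def by blast
  interpret k: mcf_kernel \<psi> \<epsilon> by standard (rule assms)+
  have m: "M + 1 \<ge> 0" using assms(7) by simp
  \<comment> \<open>The constants are taken for mass \<open>M + 1\<close>, the bound that holds
    along the whole scheme, and not for the initial bound \<open>M\<close>.\<close>
  obtain K \<tau>0 where sc: "k.step_consts d (M + 1) K \<tau>0" using k.step_consts_exist[OF m] by blast
  interpret w: mcf_weight \<psi> \<epsilon> d M R0 K \<tau>0 V\<^sub>0 \<phi> \<phi>'
  proof
    show "0 \<le> M" using assms(7) by simp
    show "\<And>p. p \<in> {0..1} \<times> UNIV \<Longrightarrow> (\<phi> has_derivative blinfun_apply (\<phi>' p)) (at p within {0..1} \<times> UNIV)"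
      using \<phi>'(2) by blast
  qed (rule V0 sc \<phi>'(1))+
  obtain N0 where N0: "\<And>N. N \<ge> N0 \<Longrightarrow> w.fine_enough N" using w.fine_enough_eventually by blast
  \<comment> \<open>The right side of the admissibility bound is positive while
    \<open>c\<^sub>3\<close> times the mesh tends to 0, so fine uniform subdivisions are admissible
    for any real value of \<open>c\<^sub>3\<close>.\<close>
  have "0 < (M + 1) powi (-3) * \<epsilon> ^ 8" using assms(5,7) by (intro mult_pos_pos zero_less_power_int zero_less_power) simp_all
  moreover have "(\<lambda>N. c\<^sub>3 * (1 / real N)) \<longlonglongrightarrow> c\<^sub>3 * 0" by (intro tendsto_mult_left lim_1_over_n)
  ultimately have "\<forall>\<^sub>F N in sequentially. c\<^sub>3 * (1 / real N) < (M + 1) powi (-3) * \<epsilon> ^ 8"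
    by (intro order_tendstoD(2)) simp_all
  then obtain N1 where N1: "\<And>N. N \<ge> N1 \<Longrightarrow> c\<^sub>3 * (1 / real N) < (M + 1) powi (-3) * \<epsilon> ^ 8"
    unfolding eventually_sequentially by blast
  \<comment> \<open>The notion of flow asks for admissibility at every index, not only eventually;
    the shift discards the coarse subdivisions.\<close>
  define N where "N j = j + (N0 + N1)" for j
  have fine: "w.fine_enough (N j)" for j by (rule N0) (simp add: N_def)
  have Npos: "N j \<ge> 1" for j using fine[of j] by (simp add: w.fine_enough_def)
  have Ntop: "filterlim N at_top sequentially"
    unfolding N_def by (rule filterlim_add_const_nat_at_top)
  have adm: "subdivision (uniform_subdivision (N j)) \<and> c\<^sub>3 * mesh (uniform_subdivision (N j)) \<le> (M + 1) powi (-3) * \<epsilon> ^ 8" for j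
    using subdivision_uniform[OF Npos] mesh_uniform[OF Npos] N1[of "N j"] by (simp add: N_def less_imp_le)
  have mesh0: "(\<lambda>j. mesh (uniform_subdivision (N j))) \<longlonglongrightarrow> 0"
    unfolding mesh_uniform[OF Npos] by (rule filterlim_compose[OF lim_1_over_n Ntop])
  have Vv: "V t \<in> varifolds d" if "t \<in> {0..1}" for t
    using assms(11) that unfolding is_approx_mcf_def by blast
  have lim: "weak_star_limit d (\<lambda>j. discrete_flow d \<psi> \<epsilon> V\<^sub>0 (uniform_subdivision (N j)) t) (V t)" if "t \<in> {0..1}" for t
    using assms(11)[unfolded is_approx_mcf_def, rule_format, OF that, THEN conjunct2, rule_format, of "\<lambda>j. uniform_subdivision (N j)"] adm mesh0
    by blast
  note fi = w.flow_identity[OF fine Ntop Vv lim assms(14-16)]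
  have bv: "bounded_varifold d w.R1 (M + 1) (V t)" if "t \<in> {0..1}" for t
    by (rule fi(4)) (use that in simp_all)
  have id: "weighted_first_variation (V t) (\<lambda>x. \<phi> (t, x)) (approx_mean_curvature \<psi> \<epsilon> (V t)) = w.space_term t (V t)"
    "(\<integral>x. vector_derivative (\<lambda>s. \<phi> (s, x)) (at t within {0..1}) \<partial>mass (V t)) = w.time_term t (V t)"
    "(\<integral>x. \<phi> (t, x) \<partial>mass (V t)) = w.weighted_mass t (V t)" if "t \<in> {0..1}" for t
    by (rule w.term_identification[OF bv[OF that] m that])+
  have sub: "t \<in> {0..1}" if "t \<in> {a..b}" for t using that assms(14-16) by auto
  have ab01: "a \<in> {0..1}" "b \<in> {0..1}" using assms(14-16) by auto
  \<comment> \<open>Integrands are replaced only for \<open>t\<close> in the interval of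
    integration, since nothing is known about \<open>V t\<close> outside the unit interval.\<close>
  have i1: "set_integrable lborel {a..b} (\<lambda>t. weighted_first_variation (V t) (\<lambda>x. \<phi> (t, x)) (approx_mean_curvature \<psi> \<epsilon> (V t))) =
      set_integrable lborel {a..b} (\<lambda>t. w.space_term t (V t))"
    by (rule set_integrable_cong[OF refl refl]) (use id(1) sub in blast)
  have i2: "set_integrable lborel {a..b} (\<lambda>t. \<integral>x. vector_derivative (\<lambda>s. \<phi> (s, x)) (at t within {0..1}) \<partial>mass (V t)) =
      set_integrable lborel {a..b} (\<lambda>t. w.time_term t (V t))"
    by (rule set_integrable_cong[OF refl refl]) (use id(2) sub in blast)
  have l1: "(LINT t:{a..b}|lborel. weighted_first_variation (V t) (\<lambda>x. \<phi> (t, x)) (approx_mean_curvature \<psi> \<epsilon> (V t))) =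
      (LINT t:{a..b}|lborel. w.space_term t (V t))"
    by (rule set_lebesgue_integral_cong) (use id(1) sub in auto)
  have l2: "(LINT t:{a..b}|lborel. \<integral>x. vector_derivative (\<lambda>s. \<phi> (s, x)) (at t within {0..1}) \<partial>mass (V t)) =
      (LINT t:{a..b}|lborel. w.time_term t (V t))"
    by (rule set_lebesgue_integral_cong) (use id(2) sub in auto)
  show ?thesis
    unfolding i1 i2 l1 l2 id(3)[OF ab01(1)] id(3)[OF ab01(2)] using fi(1-3) by blast
qed

end
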